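(* Let $(M,g)$ be a Riemannian manifold of dimension $n\ge 2$, and let $c_1:\mathcal R(M,g)\to\mathbb R$ be the coefficient of $f_1$ in the expansion $$f_{1121}=\sum_{i=1}^nc_if_i+\sum_{i=2}^nc_{n+i-1}f_{1i}+\sum_{i=2}^nc_{2n+i-2}f_{1i1}$$ of the vector field $f_{1121}$ on $\mathcal R(M,g)$ in the local basis $\{f_1,\dots,f_n,f_{12},\dots,f_{1n},f_{121},\dots,f_{1n1}\}$ of $T\mathcal R(M,g)$. Then $c_1$ is a homothetic invariant of $(M,g)$, which can be expressed in terms of sectional curvatures as $$c_1(x,V,R)=|R|^2\sec(R,V).$$ In particular, if $(M,g)$ is a Riemannian surface, then $$c_1(x,V,R)=|R|^2K(x),$$ where $K$ is the Gaussian curvature of $(M,g)$.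
   Context: The manifold of curvature radii is $\mathcal R(M,g)=\{(x,V,R)\in TM\oplus TM:\langle R,V\rangle_g=0,\ |R|_g=|V|_g>0\}$, of dimension $3n-2$. On it, $f_1,\dots,f_n$ are the (local) vector fields whose integral curves $(x,V,R)(t)$ satisfy $$f_1:\ \dot x=V,\ D_tR=-V,\ D_tV=R;\qquad f_2:\ \dot x=0,\ \dot R=R,\ \dot V=V;\qquad f_j:\ \dot x=0,\ \dot R=b_j(x,V,R),\ \dot V=0\quad(j=3,\dots,n),$$ where $D_t$ is the Levi-Civita covariant derivative along $x(t)$ and $\{b_3,\dots,b_n\}$ is a smooth local orthogonal basis of $\{R,V\}^\perp\subset T_xM$ consisting of vectors of norm $|R|$. Iterated brackets (with $[X,Y]=XY-YX$): $f_{1i}=[f_1,f_i]$, $f_{1i1}=[f_1,[f_i,f_1]]$, $f_{1121}=[f_1,[f_1,[f_2,f_1]]]$. The $3n-2$ fields $f_1,\dots,f_n,f_{12},\dots,f_{1n},f_{121},\dots,f_{1n1}$ form a local basis of $T\mathcal R(M,g)$. $\sec(R,V)$ is the sectional curvature of the plane spanned by $R$ and $V$. "Homothetic invariant" means: if $\varphi:(M,g)\to(N,\eta)$ is a homothety (a diffeomorphism with $\varphi^\star\eta=\lambda g$, $\lambda>0$ constant), then the functions $c_1$ of $(M,g)$ and of $(N,\eta)$ correspond under the map $(x,V,R)\mapsto(\varphi(x),\varphi_\star V,\varphi_\star R)$. *)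

theory Defs
  imports "HOL-Analysis.Analysis"
begin

section \<open>Smooth functions between normed spaces\<close>

text \<open>Intended for open domains of finite-dimensional spaces, where it suffices to iterate
  directional derivatives.\<close>

primrec Ck_on :: "nat \<Rightarrow> 'a::real_normed_vector set \<Rightarrow> ('a \<Rightarrow> 'b::real_normed_vector) \<Rightarrow> bool" where
  "Ck_on 0 S f \<longleftrightarrow> continuous_on S f"
| "Ck_on (Suc k) S f \<longleftrightarrow>
     (\<forall>x\<in>S. f differentiable (at x)) \<and>
     (\<forall>v. Ck_on k S (\<lambda>x. frechet_derivative f (at x) v))"

definition smooth_on :: "'a::real_normed_vector set \<Rightarrow> ('a \<Rightarrow> 'b::real_normed_vector) \<Rightarrow> bool" where
  "smooth_on S f \<longleftrightarrow> (\<forall>k. Ck_on k S f)"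


section \<open>Smooth manifolds and tangent vectors\<close>

text \<open>A chart is a domain together with a coordinate map, whose values outside the domain are
  irrelevant.  The model space \<open>'e\<close> is an arbitrary Euclidean space; the dimension of the manifold
  is \<open>DIM('e)\<close>.  The manifold is the whole type \<open>'m\<close>.\<close>

type_synonym ('m, 'e) chart = "'m set \<times> ('m \<Rightarrow> 'e)"

definition chart_inv :: "('m, 'e) chart \<Rightarrow> 'e \<Rightarrow> 'm" where
  "chart_inv c = inv_into (fst c) (snd c)"

definition charts_at :: "('m, 'e) chart set \<Rightarrow> 'm \<Rightarrow> ('m, 'e) chart set" where
  "charts_at A x = {c \<in> A. x \<in> fst c}"

locale smooth_manifold =
  fixes A :: "('m::{t2_space, second_countable_topology}, 'e::euclidean_space) chart set"
  assumes open_domain: "c \<in> A \<Longrightarrow> open (fst c)"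
    and open_image: "c \<in> A \<Longrightarrow> open (snd c ` fst c)"
    and chart_homeomorphism: "c \<in> A \<Longrightarrow> homeomorphism (fst c) (snd c ` fst c) (snd c) (chart_inv c)"
    and atlas_covers: "(\<Union>c\<in>A. fst c) = UNIV"
    and smooth_transition:
      "c \<in> A \<Longrightarrow> d \<in> A \<Longrightarrow> smooth_on (snd c ` (fst c \<inter> fst d)) (snd d \<circ> chart_inv c)"

text \<open>A tangent vector at \<open>x\<close> is the family of its coordinate vectors in all charts around \<open>x\<close>,
  subject to the usual transformation law; it is set to \<open>0\<close> on all other arguments, so that equality
  of functions is equality of tangent vectors and linear combinations are taken pointwise.\<close>

type_synonym ('m, 'e) tvec = "('m, 'e) chart \<Rightarrow> 'e"

definition tangent_space ::
  "('m, 'e::euclidean_space) chart set \<Rightarrow> 'm \<Rightarrow> ('m, 'e) tvec set" where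
  "tangent_space A x = {v.
     (\<forall>c. c \<notin> charts_at A x \<longrightarrow> v c = 0) \<and>
     (\<forall>c\<in>charts_at A x. \<forall>d\<in>charts_at A x.
        v d = frechet_derivative (snd d \<circ> chart_inv c) (at (snd c x)) (v c))}"

text \<open>The tangent vector at \<open>x\<close> with coordinates \<open>u\<close> in the chart \<open>c\<close>.\<close>

definition tvec_of_coords ::
  "('m, 'e::euclidean_space) chart set \<Rightarrow> ('m, 'e) chart \<Rightarrow> 'm \<Rightarrow> 'e \<Rightarrow> ('m, 'e) tvec" where
  "tvec_of_coords A c x u = (\<lambda>d. if d \<in> charts_at A x
     then frechet_derivative (snd d \<circ> chart_inv c) (at (snd c x)) u else 0)"

definition smooth_map ::
  "('m::topological_space, 'e::euclidean_space) chart set \<Rightarrow> ('k::topological_space, 'e) chart set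
    \<Rightarrow> ('m \<Rightarrow> 'k) \<Rightarrow> bool" where
  "smooth_map A B \<phi> \<longleftrightarrow> continuous_on UNIV \<phi> \<and>
     (\<forall>c\<in>A. \<forall>d\<in>B. smooth_on (snd c ` (fst c \<inter> \<phi> -` fst d)) (snd d \<circ> \<phi> \<circ> chart_inv c))"

definition diffeomorphism ::
  "('m::topological_space, 'e::euclidean_space) chart set \<Rightarrow> ('k::topological_space, 'e) chart set
    \<Rightarrow> ('m \<Rightarrow> 'k) \<Rightarrow> bool" where
  "diffeomorphism A B \<phi> \<longleftrightarrow> bij \<phi> \<and> smooth_map A B \<phi> \<and> smooth_map B A (inv \<phi>)"

text \<open>The differential of \<open>\<phi>\<close> at \<open>x\<close>, computed with an arbitrary chart around \<open>x\<close>; by the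
  transformation law of tangent vectors the choice is irrelevant for smooth \<open>\<phi>\<close>.\<close>

definition pushforward ::
  "('m, 'e::euclidean_space) chart set \<Rightarrow> ('k, 'e) chart set \<Rightarrow> ('m \<Rightarrow> 'k) \<Rightarrow> 'm
    \<Rightarrow> ('m, 'e) tvec \<Rightarrow> ('k, 'e) tvec" where
  "pushforward A B \<phi> x u = (\<lambda>d. if d \<in> charts_at B (\<phi> x)
     then (let c = (SOME c. c \<in> charts_at A x)
           in frechet_derivative (snd d \<circ> \<phi> \<circ> chart_inv c) (at (snd c x)) (u c))
     else 0)"


section \<open>Riemannian manifolds\<close>

type_synonym ('m, 'e) metric = "'m \<Rightarrow> ('m, 'e) tvec \<Rightarrow> ('m, 'e) tvec \<Rightarrow> real"

definition metric_coords ::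
  "('m, 'e::euclidean_space) chart set \<Rightarrow> ('m, 'e) metric \<Rightarrow> ('m, 'e) chart \<Rightarrow> 'e \<Rightarrow> 'e \<Rightarrow> 'e \<Rightarrow> real"
  where
  "metric_coords A g c y u v =
     (let x = chart_inv c y in g x (tvec_of_coords A c x u) (tvec_of_coords A c x v))"

locale riemannian_manifold = smooth_manifold A
  for A :: "('m::{t2_space, second_countable_topology}, 'e::euclidean_space) chart set" +
  fixes g :: "('m, 'e) metric"
  assumes metric_sym:
      "u \<in> tangent_space A x \<Longrightarrow> v \<in> tangent_space A x \<Longrightarrow> g x u v = g x v u"
    and metric_linear:
      "u \<in> tangent_space A x \<Longrightarrow> v \<in> tangent_space A x \<Longrightarrow> w \<in> tangent_space A x \<Longrightarrow>
        g x (\<lambda>c. a *\<^sub>R u c + b *\<^sub>R v c) w = a * g x u w + b * g x v w"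
    and metric_pos:
      "u \<in> tangent_space A x \<Longrightarrow> u \<noteq> (\<lambda>_. 0) \<Longrightarrow> g x u u > 0"
    and metric_smooth:
      "c \<in> A \<Longrightarrow> smooth_on (snd c ` fst c) (\<lambda>y. metric_coords A g c y \<xi> \<zeta>)"

definition gnorm :: "('m, 'e) metric \<Rightarrow> 'm \<Rightarrow> ('m, 'e) tvec \<Rightarrow> real" where
  "gnorm g x u = sqrt (g x u u)"

definition homothety ::
  "('m::topological_space, 'e::euclidean_space) chart set \<Rightarrow> ('m, 'e) metric
    \<Rightarrow> ('k::topological_space, 'e) chart set \<Rightarrow> ('k, 'e) metric \<Rightarrow> ('m \<Rightarrow> 'k) \<Rightarrow> bool" where
  "homothety A g B h \<phi> \<longleftrightarrow> diffeomorphism A B \<phi> \<and>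
     (\<exists>l>0. \<forall>x. \<forall>u\<in>tangent_space A x. \<forall>v\<in>tangent_space A x.
        h (\<phi> x) (pushforward A B \<phi> x u) (pushforward A B \<phi> x v) = l * g x u v)"

text \<open>Christoffel symbols of the Levi-Civita connection at the coordinate point \<open>y\<close> of the chart
  \<open>c\<close>, as a bilinear map on coordinate vectors: Koszul's formula for the fields with constant
  coordinates \<open>u\<close>, \<open>v\<close>, \<open>z\<close> (whose brackets vanish).\<close>

definition christoffel ::
  "('m, 'e::euclidean_space) chart set \<Rightarrow> ('m, 'e) metric \<Rightarrow> ('m, 'e) chart \<Rightarrow> 'e \<Rightarrow> 'e \<Rightarrow> 'e \<Rightarrow> 'e"
  where
  "christoffel A g c y u v = (THE w. \<forall>z. 2 * metric_coords A g c y w z =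
       frechet_derivative (\<lambda>y'. metric_coords A g c y' v z) (at y) u
     + frechet_derivative (\<lambda>y'. metric_coords A g c y' u z) (at y) v
     - frechet_derivative (\<lambda>y'. metric_coords A g c y' u v) (at y) z)"

text \<open>Curvature endomorphism with the convention
  \<open>R(X,Y)Z = \<nabla>\<^sub>X\<nabla>\<^sub>YZ - \<nabla>\<^sub>Y\<nabla>\<^sub>XZ - \<nabla>\<^bsub>[X,Y]\<^esub>Z\<close>, evaluated in each
  chart on the extensions of \<open>X\<close>, \<open>Y\<close>, \<open>Z\<close> with constant coordinates.\<close>

definition curvature_endo ::
  "('m, 'e::euclidean_space) chart set \<Rightarrow> ('m, 'e) metric \<Rightarrow> 'm
    \<Rightarrow> ('m, 'e) tvec \<Rightarrow> ('m, 'e) tvec \<Rightarrow> ('m, 'e) tvec \<Rightarrow> ('m, 'e) tvec" where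
  "curvature_endo A g x X Y Z = (\<lambda>c. if c \<in> charts_at A x then
     (let y = snd c x; G = christoffel A g c in
         frechet_derivative (\<lambda>y'. G y' (Y c) (Z c)) (at y) (X c)
       - frechet_derivative (\<lambda>y'. G y' (X c) (Z c)) (at y) (Y c)
       + G y (X c) (G y (Y c) (Z c))
       - G y (Y c) (G y (X c) (Z c)))
     else 0)"

definition sectional_curvature ::
  "('m, 'e::euclidean_space) chart set \<Rightarrow> ('m, 'e) metric \<Rightarrow> 'm
    \<Rightarrow> ('m, 'e) tvec \<Rightarrow> ('m, 'e) tvec \<Rightarrow> real" where
  "sectional_curvature A g x X Y =
     g x (curvature_endo A g x X Y Y) X / (g x X X * g x Y Y - (g x X Y)\<^sup>2)"

text \<open>Only meaningful in dimension 2, where the tangent space is the only tangent plane at \<open>x\<close>.\<close>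

definition gaussian_curvature ::
  "('m, 'e::euclidean_space) chart set \<Rightarrow> ('m, 'e) metric \<Rightarrow> 'm \<Rightarrow> real" where
  "gaussian_curvature A g x = (THE k. \<forall>u\<in>tangent_space A x. \<forall>v\<in>tangent_space A x.
     (\<forall>a b. (\<lambda>c. a *\<^sub>R u c + b *\<^sub>R v c) = (\<lambda>_. 0) \<longrightarrow> a = 0 \<and> b = 0)
       \<longrightarrow> sectional_curvature A g x u v = k)"


section \<open>Vector fields along curves\<close>

definition curve_velocity ::
  "('m, 'e::euclidean_space) chart set \<Rightarrow> (real \<Rightarrow> 'm) \<Rightarrow> real \<Rightarrow> ('m, 'e) tvec" where
  "curve_velocity A x t = (\<lambda>c. if c \<in> charts_at A (x t)
     then vector_derivative (\<lambda>s. snd c (x s)) (at t) else 0)"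

definition cov_deriv ::
  "('m, 'e::euclidean_space) chart set \<Rightarrow> ('m, 'e) metric \<Rightarrow> (real \<Rightarrow> 'm) \<Rightarrow> (real \<Rightarrow> ('m, 'e) tvec)
    \<Rightarrow> real \<Rightarrow> ('m, 'e) tvec" where
  "cov_deriv A g x Y t = (\<lambda>c. if c \<in> charts_at A (x t)
     then vector_derivative (\<lambda>s. Y s c) (at t)
        + christoffel A g c (snd c (x t)) (curve_velocity A x t c) (Y t c)
     else 0)"

text \<open>Plain derivative of a field along a curve.  It is a tangent vector only if the curve has
  velocity \<open>0\<close> at time \<open>t\<close>, and it is used only in that situation.\<close>

definition fibre_deriv ::
  "('m, 'e::euclidean_space) chart set \<Rightarrow> (real \<Rightarrow> 'm) \<Rightarrow> (real \<Rightarrow> ('m, 'e) tvec)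
    \<Rightarrow> real \<Rightarrow> ('m, 'e) tvec" where
  "fibre_deriv A x Y t = (\<lambda>c. if c \<in> charts_at A (x t)
     then vector_derivative (\<lambda>s. Y s c) (at t) else 0)"


section \<open>The manifold of curvature radii\<close>

type_synonym ('m, 'e) radius = "'m \<times> ('m, 'e) tvec \<times> ('m, 'e) tvec"

definition curvature_radii ::
  "('m, 'e::euclidean_space) chart set \<Rightarrow> ('m, 'e) metric \<Rightarrow> ('m, 'e) radius set" where
  "curvature_radii A g = {(x, V, R). V \<in> tangent_space A x \<and> R \<in> tangent_space A x \<and>
     g x R V = 0 \<and> gnorm g x R = gnorm g x V \<and> gnorm g x V > 0}"

text \<open>The bundle chart of \<open>TM \<oplus> TM\<close> induced by a chart of \<open>M\<close>.  Topology and smooth functions on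
  \<open>curvature_radii\<close> are those of a submanifold of \<open>TM \<oplus> TM\<close>: open sets are traces of open sets,
  and a function is smooth near a point iff it extends smoothly to an open set in coordinates.\<close>

definition bundle_chart :: "('m, 'e) chart \<Rightarrow> ('m, 'e) radius \<Rightarrow> 'e \<times> 'e \<times> 'e" where
  "bundle_chart c = (\<lambda>(x, V, R). (snd c x, V c, R c))"

definition radii_open ::
  "('m, 'e::euclidean_space) chart set \<Rightarrow> ('m, 'e) metric \<Rightarrow> ('m, 'e) radius set \<Rightarrow> bool" where
  "radii_open A g W \<longleftrightarrow> W \<subseteq> curvature_radii A g \<and>
     (\<forall>c\<in>A. \<exists>S. open S \<and>
        (\<forall>p\<in>curvature_radii A g. fst p \<in> fst c \<longrightarrow> (p \<in> W \<longleftrightarrow> bundle_chart c p \<in> S)))"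

definition radii_smooth_at ::
  "('m, 'e::euclidean_space) chart set \<Rightarrow> ('m, 'e) metric \<Rightarrow> ('m, 'e) radius
    \<Rightarrow> (('m, 'e) radius \<Rightarrow> 'b::real_normed_vector) \<Rightarrow> bool" where
  "radii_smooth_at A g p F \<longleftrightarrow>
     (\<forall>c\<in>charts_at A (fst p). \<exists>S F'. open S \<and> bundle_chart c p \<in> S \<and> smooth_on S F' \<and>
        (\<forall>q\<in>curvature_radii A g. fst q \<in> fst c \<and> bundle_chart c q \<in> S
            \<longrightarrow> F q = F' (bundle_chart c q)))"

text \<open>Vector fields are derivations.  The derivation rules are imposed on functions that are smooth
  near the point under consideration (not only on those smooth on all of \<open>W\<close>); values of \<open>X F\<close> at
  points where \<open>F\<close> is not smooth are irrelevant.\<close>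

type_synonym ('m, 'e) vfield = "(('m, 'e) radius \<Rightarrow> real) \<Rightarrow> ('m, 'e) radius \<Rightarrow> real"

definition radii_vector_field ::
  "('m, 'e::euclidean_space) chart set \<Rightarrow> ('m, 'e) metric \<Rightarrow> ('m, 'e) radius set
    \<Rightarrow> ('m, 'e) vfield \<Rightarrow> bool" where
  "radii_vector_field A g W X \<longleftrightarrow>
     (\<forall>p\<in>W. \<forall>F H. radii_smooth_at A g p F \<and> radii_smooth_at A g p H \<longrightarrow>
        radii_smooth_at A g p (X F) \<and>
        (\<forall>a b. X (\<lambda>q. a * F q + b * H q) p = a * X F p + b * X H p) \<and>
        X (\<lambda>q. F q * H q) p = F p * X H p + H p * X F p)"

definition lie_bracket :: "('m, 'e) vfield \<Rightarrow> ('m, 'e) vfield \<Rightarrow> ('m, 'e) vfield" where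
  "lie_bracket X Y = (\<lambda>F p. X (Y F) p - Y (X F) p)"

definition radii_curve_at ::
  "('m::topological_space, 'e::euclidean_space) chart set \<Rightarrow> ('m, 'e) radius set
    \<Rightarrow> (real \<Rightarrow> ('m, 'e) radius) \<Rightarrow> real \<Rightarrow> bool" where
  "radii_curve_at A W \<gamma> t \<longleftrightarrow>
     (\<forall>\<^sub>F s in nhds t. \<gamma> s \<in> W) \<and> isCont (\<lambda>s. fst (\<gamma> s)) t \<and>
     (\<forall>c\<in>charts_at A (fst (\<gamma> t)). (\<lambda>s. bundle_chart c (\<gamma> s)) differentiable (at t))"

text \<open>\<open>\<gamma>\<close> satisfies the integral curve equation of \<open>X\<close> at time \<open>t\<close>.\<close>

definition integral_curve_at ::
  "('m, 'e::euclidean_space) chart set \<Rightarrow> ('m, 'e) metric \<Rightarrow> ('m, 'e) vfield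
    \<Rightarrow> (real \<Rightarrow> ('m, 'e) radius) \<Rightarrow> real \<Rightarrow> bool" where
  "integral_curve_at A g X \<gamma> t \<longleftrightarrow>
     (\<forall>F. radii_smooth_at A g (\<gamma> t) F \<longrightarrow>
        ((\<lambda>s. F (\<gamma> s)) has_real_derivative X F (\<gamma> t)) (at t))"

text \<open>\<open>X\<close> is the vector field on \<open>W\<close> whose integral curves are the solutions \<open>(x, V, R)\<close> of the
  first-order system \<open>E\<close>.  Both equations only involve the first derivatives of the curve at the time
  in question, so they are compared at each single time.\<close>

definition generated_by ::
  "('m::topological_space, 'e::euclidean_space) chart set \<Rightarrow> ('m, 'e) metric \<Rightarrow> ('m, 'e) radius set
    \<Rightarrow> ((real \<Rightarrow> 'm) \<Rightarrow> (real \<Rightarrow> ('m, 'e) tvec) \<Rightarrow> (real \<Rightarrow> ('m, 'e) tvec) \<Rightarrow> real \<Rightarrow> bool)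
    \<Rightarrow> ('m, 'e) vfield \<Rightarrow> bool" where
  "generated_by A g W E X \<longleftrightarrow> radii_vector_field A g W X \<and>
     (\<forall>\<gamma> t. radii_curve_at A W \<gamma> t \<longrightarrow>
        (integral_curve_at A g X \<gamma> t \<longleftrightarrow>
         E (\<lambda>s. fst (\<gamma> s)) (\<lambda>s. fst (snd (\<gamma> s))) (\<lambda>s. snd (snd (\<gamma> s))) t))"

definition f1_system ::
  "('m, 'e::euclidean_space) chart set \<Rightarrow> ('m, 'e) metric
    \<Rightarrow> (real \<Rightarrow> 'm) \<Rightarrow> (real \<Rightarrow> ('m, 'e) tvec) \<Rightarrow> (real \<Rightarrow> ('m, 'e) tvec) \<Rightarrow> real \<Rightarrow> bool" where
  "f1_system A g x V R t \<longleftrightarrow>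
     curve_velocity A x t = V t \<and>
     cov_deriv A g x R t = (\<lambda>c. - V t c) \<and>
     cov_deriv A g x V t = R t"

definition f2_system ::
  "('m, 'e::euclidean_space) chart set
    \<Rightarrow> (real \<Rightarrow> 'm) \<Rightarrow> (real \<Rightarrow> ('m, 'e) tvec) \<Rightarrow> (real \<Rightarrow> ('m, 'e) tvec) \<Rightarrow> real \<Rightarrow> bool" where
  "f2_system A x V R t \<longleftrightarrow>
     curve_velocity A x t = (\<lambda>_. 0) \<and>
     fibre_deriv A x R t = R t \<and>
     fibre_deriv A x V t = V t"

definition fj_system ::
  "('m, 'e::euclidean_space) chart set \<Rightarrow> (('m, 'e) radius \<Rightarrow> ('m, 'e) tvec)
    \<Rightarrow> (real \<Rightarrow> 'm) \<Rightarrow> (real \<Rightarrow> ('m, 'e) tvec) \<Rightarrow> (real \<Rightarrow> ('m, 'e) tvec) \<Rightarrow> real \<Rightarrow> bool" where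
  "fj_system A b x V R t \<longleftrightarrow>
     curve_velocity A x t = (\<lambda>_. 0) \<and>
     fibre_deriv A x R t = b (x t, V t, R t) \<and>
     fibre_deriv A x V t = (\<lambda>_. 0)"

text \<open>A smooth orthogonal basis \<open>b 3, \<dots>, b n\<close> of the orthogonal complement of \<open>R\<close> and \<open>V\<close>,
  by vectors of norm \<open>|R|\<close>, defined on \<open>W\<close>.\<close>

definition orthogonal_frame ::
  "('m, 'e::euclidean_space) chart set \<Rightarrow> ('m, 'e) metric \<Rightarrow> ('m, 'e) radius set
    \<Rightarrow> (nat \<Rightarrow> ('m, 'e) radius \<Rightarrow> ('m, 'e) tvec) \<Rightarrow> bool" where
  "orthogonal_frame A g W b \<longleftrightarrow>
     (\<forall>(x, V, R)\<in>W.
        (\<forall>j\<in>{3..DIM('e)}. b j (x, V, R) \<in> tangent_space A x \<and>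
           g x (b j (x, V, R)) R = 0 \<and> g x (b j (x, V, R)) V = 0 \<and>
           gnorm g x (b j (x, V, R)) = gnorm g x R) \<and>
        (\<forall>i\<in>{3..DIM('e)}. \<forall>j\<in>{3..DIM('e)}.
           i \<noteq> j \<longrightarrow> g x (b i (x, V, R)) (b j (x, V, R)) = 0) \<and>
        (\<forall>u\<in>tangent_space A x. g x u R = 0 \<and> g x u V = 0 \<longrightarrow>
           (\<exists>a. u = (\<lambda>c. \<Sum>j=3..DIM('e). a j *\<^sub>R b j (x, V, R) c))) \<and>
        (\<forall>j\<in>{3..DIM('e)}. \<forall>c\<in>charts_at A x.
           radii_smooth_at A g (x, V, R) (\<lambda>q. b j q c)))"

definition adapted_fields ::
  "('m::topological_space, 'e::euclidean_space) chart set \<Rightarrow> ('m, 'e) metric \<Rightarrow> ('m, 'e) radius set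
    \<Rightarrow> (nat \<Rightarrow> ('m, 'e) radius \<Rightarrow> ('m, 'e) tvec) \<Rightarrow> (nat \<Rightarrow> ('m, 'e) vfield) \<Rightarrow> bool" where
  "adapted_fields A g W b f \<longleftrightarrow>
     generated_by A g W (f1_system A g) (f 1) \<and>
     generated_by A g W (f2_system A) (f 2) \<and>
     (\<forall>j\<in>{3..DIM('e)}. generated_by A g W (fj_system A (b j)) (f j))"

definition f1121_expansion ::
  "('m, 'e::euclidean_space) chart set \<Rightarrow> ('m, 'e) metric \<Rightarrow> ('m, 'e) radius set
    \<Rightarrow> (nat \<Rightarrow> ('m, 'e) vfield) \<Rightarrow> (nat \<Rightarrow> ('m, 'e) radius \<Rightarrow> real) \<Rightarrow> bool" where
  "f1121_expansion A g W f c \<longleftrightarrow>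
     (let n = DIM('e) in
      \<forall>p\<in>W. \<forall>F. radii_smooth_at A g p F \<longrightarrow>
        lie_bracket (f 1) (lie_bracket (f 1) (lie_bracket (f 2) (f 1))) F p =
            (\<Sum>i=1..n. c i p * f i F p)
          + (\<Sum>i=2..n. c (n + i - 1) p * lie_bracket (f 1) (f i) F p)
          + (\<Sum>i=2..n. c (2 * n + i - 2) p * lie_bracket (f 1) (lie_bracket (f i) (f 1)) F p))"

text \<open>The coefficient of \<open>f 1\<close> at \<open>p\<close>, with respect to any local frame around \<open>p\<close>.\<close>

definition c1 ::
  "('m::topological_space, 'e::euclidean_space) chart set \<Rightarrow> ('m, 'e) metric
    \<Rightarrow> ('m, 'e) radius \<Rightarrow> real" where
  "c1 A g p = (THE a. \<exists>W b f c. radii_open A g W \<and> p \<in> W \<and> orthogonal_frame A g W b \<and>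
     adapted_fields A g W b f \<and> f1121_expansion A g W f c \<and> a = c 1 p)"

end

theory Submission
  imports Defs
begin

text \<open>
Let \<open>H\<^sub>a\<close> be the horizontal lift of a tangent vector \<open>a\<close> to \<open>TM \<oplus> TM\<close>, and let \<open>A\<^sub>a\<close> and \<open>B\<^sub>a\<close> be the
vertical vectors that move \<open>V\<close> and \<open>R\<close>, respectively, in the direction \<open>a\<close>.  Then
\<open>f\<^sub>1 = H\<^sub>V + A\<^sub>R - B\<^sub>V\<close>, \<open>f\<^sub>2 = A\<^sub>V + B\<^sub>R\<close>, and \<open>f\<^sub>j\<close> is \<open>B\<close> in the direction \<open>b\<^sub>j\<close>.  The field \<open>f\<^sub>2\<close>
generates dilations of the fibres; \<open>H\<^sub>V\<close> has degree one and \<open>A\<^sub>R - B\<^sub>V\<close> has degree zero, so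
\<open>[f\<^sub>2, f\<^sub>1] = H\<^sub>V\<close>.  The field \<open>A\<^sub>R - B\<^sub>V\<close> rotates \<open>V\<close> into \<open>R\<close> and \<open>R\<close> into \<open>-V\<close>, hence
\<open>[f\<^sub>1, H\<^sub>V] = H\<^sub>R\<close> and \<open>f1121 = [f\<^sub>1, H\<^sub>R] = -H\<^sub>V + [H\<^sub>V, H\<^sub>R]\<close>.  The bracket of the two horizontal fields is
vertical and is given by the curvature: its \<open>V\<close>-part is \<open>-Rm(V,R)V\<close>.  On the other side of the
expansion, \<open>f\<^sub>1\<^sub>2 = -H\<^sub>V\<close>, the field \<open>f\<^sub>1\<^sub>2\<^sub>1 = H\<^sub>R\<close> is horizontal, \<open>f\<^sub>1\<^sub>j\<close> is vertical with \<open>V\<close>-part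
\<open>-b\<^sub>j\<close>, and \<open>f\<^sub>1\<^sub>j\<^sub>1\<close> has horizontal part \<open>-b\<^sub>j\<close>.  Comparing horizontal parts shows that the coefficient of
\<open>f\<^sub>1\<^sub>2\<close> is \<open>c\<^sub>1 + 1\<close> and that those of all \<open>f\<^sub>1\<^sub>i\<^sub>1\<close> vanish.  Comparing the \<open>V\<close>-parts in the direction \<open>R\<close>
then leaves \<open>c\<^sub>1 |R|\<^sup>2 = -\<langle>Rm(V,R)V, R\<rangle> = \<langle>Rm(R,V)V, R\<rangle>\<close>, which is the claim because \<open>|R| = |V|\<close> and
\<open>R \<bottom> V\<close> (\<open>expansion_coefficient\<close>, \<open>c1_sectional\<close>).

The vector fields are derivations of functions on a submanifold.  They are handled in one chart through
a smooth retraction \<open>\<rho>\<close> of an open set of triples \<open>(y, v, r)\<close> onto the coordinate image of the manifold of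
curvature radii.  A derivation is represented by a map \<open>\<xi>\<close> with values fixed by the derivative of \<open>\<rho>\<close>, and
Lie brackets of derivations are represented by brackets of such maps (\<open>represents_bracket\<close>).  A
differential system for curves determines \<open>\<xi>\<close>, since every tangent vector is the velocity of some curve
of curvature radii (\<open>generated_represents\<close>, \<open>generated_exists\<close>).

As \<open>c1\<close> is a definite description, some local frame and some expansion must exist at every point.
Frames come from Gram-Schmidt with smooth parameters (\<open>frame_exists\<close>).  For the expansion, the
coefficients found above match the horizontal and the \<open>V\<close>-parts; the remainder is a tangent vector with
\<open>R\<close>-part only, tangency makes it orthogonal to \<open>R\<close> and \<open>V\<close>, and so it is a combination of the \<open>f\<^sub>j\<close>
(\<open>expansion_exists\<close>).

Koszul's formula yields the transformation laws of Christoffel symbols and curvature under any map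
that pulls one metric back to a constant multiple of another (\<open>chr_transform\<close>, \<open>curv_transform\<close>).
Changes of charts are the case of the factor 1; they make all notions independent of the chart.
A homothety multiplies \<open>|R|\<^sup>2\<close> by its factor and divides sectional curvature by it, so it preserves \<open>c1\<close>.
\<close>

section \<open>Calculus of smooth maps\<close>

abbreviation dd :: "('a::real_normed_vector \<Rightarrow> 'b::real_normed_vector) \<Rightarrow> 'a \<Rightarrow> 'a \<Rightarrow> 'b"
  where "dd f x \<equiv> frechet_derivative f (at x)"

lemma dd_eqI: "(f has_derivative f') (at x) \<Longrightarrow> dd f x = f'"
  using frechet_derivative_at by metis

lemma dd_works: "f differentiable (at x) \<Longrightarrow> (f has_derivative dd f x) (at x)"
  using frechet_derivative_works by blast

lemma has_derivative_cong_open: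
  assumes "open S" "x \<in> S" "\<And>y. y \<in> S \<Longrightarrow> f y = g y"
  shows "(f has_derivative f') (at x) \<longleftrightarrow> (g has_derivative f') (at x)"
  using assms has_derivative_transform_within_open[of _ _ x UNIV S] by metis

lemma differentiable_cong_open:
  assumes "open S" "x \<in> S" "\<And>y. y \<in> S \<Longrightarrow> f y = g y"
  shows "f differentiable (at x) \<longleftrightarrow> g differentiable (at x)"
  using has_derivative_cong_open[OF assms] unfolding differentiable_def by simp

lemma dd_cong_open:
  assumes "open S" "x \<in> S" "\<And>y. y \<in> S \<Longrightarrow> f y = g y"
  shows "dd f x = dd g x"
  using has_derivative_cong_open[OF assms] unfolding frechet_derivative_def by simp

lemma Ck_on_cong:
  assumes "open S" "\<And>y. y \<in> S \<Longrightarrow> f y = g y"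
  shows "Ck_on k S f \<longleftrightarrow> Ck_on k S g"
  using assms(2)
proof (induction k arbitrary: f g)
  case 0
  then show ?case by (simp cong: continuous_on_cong)
next
  case (Suc k)
  have "Ck_on k S (\<lambda>x. dd f x v) = Ck_on k S (\<lambda>x. dd g x v)" for v
    by (rule Suc.IH) (simp add: dd_cong_open[OF assms(1) _ Suc.prems])
  then show ?case
    using differentiable_cong_open[OF assms(1) _ Suc.prems] by simp
qed

lemma Ck_on_subset: "Ck_on k S f \<Longrightarrow> T \<subseteq> S \<Longrightarrow> Ck_on k T f"
proof (induction k arbitrary: f)
  case 0
  then show ?case using continuous_on_subset by auto
qed auto

lemma Ck_on_local:
  assumes "\<And>x. x \<in> S \<Longrightarrow> \<exists>T. open T \<and> x \<in> T \<and> Ck_on k T f"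
  shows "Ck_on k S f"
  using assms
proof (induction k arbitrary: f)
  case 0
  have "isCont f x" if "x \<in> S" for x
    using 0[OF that] continuous_on_eq_continuous_at by auto
  then show ?case by (simp add: continuous_at_imp_continuous_on)
next
  case (Suc k)
  have "f differentiable (at x)" if "x \<in> S" for x
    using Suc.prems[OF that] by auto
  moreover have "Ck_on k S (\<lambda>x. dd f x v)" for v
  proof (rule Suc.IH)
    fix x assume "x \<in> S"
    from Suc.prems[OF this] show "\<exists>T. open T \<and> x \<in> T \<and> Ck_on k T (\<lambda>x. dd f x v)" by auto
  qed
  ultimately show ?case by simp
qed

lemma Ck_on_Suc_imp: "Ck_on (Suc k) S f \<Longrightarrow> Ck_on k S f"
proof (induction k arbitrary: f)
  case 0
  then show ?case
    by (simp add: continuous_at_imp_continuous_on differentiable_imp_continuous_within)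
qed auto

lemma Ck_on_const: "Ck_on k S (\<lambda>_. c)"
  by (induction k arbitrary: c) auto

lemma Ck_on_SucI:
  assumes "open S" "\<And>x. x \<in> S \<Longrightarrow> (f has_derivative f' x) (at x)" "\<And>v. Ck_on k S (\<lambda>x. f' x v)"
  shows "Ck_on (Suc k) S f"
proof -
  have "Ck_on k S (\<lambda>x. dd f x v)" for v
    using Ck_on_cong[OF assms(1), of "\<lambda>x. dd f x v" "\<lambda>x. f' x v" k] dd_eqI[OF assms(2)] assms(3) by simp
  moreover have "f differentiable (at x)" if "x \<in> S" for x
    using assms(2)[OF that] by (rule differentiableI)
  ultimately show ?thesis by simp
qed

lemma Ck_on_bounded_linear:
  assumes "bounded_linear L" "Ck_on k S f" "open S"
  shows "Ck_on k S (\<lambda>x. L (f x))"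
  using assms(2)
proof (induction k arbitrary: f)
  case 0
  then show ?case by (simp add: assms(1) bounded_linear.continuous_on)
next
  case (Suc k)
  have d: "((\<lambda>x. L (f x)) has_derivative (\<lambda>v. L (dd f x v))) (at x)" if "x \<in> S" for x
    using Suc.prems that bounded_linear.has_derivative[OF assms(1)] dd_works by (metis Ck_on.simps(2))
  show ?case by (rule Ck_on_SucI[OF assms(3) d]) (use Suc in auto)
qed

lemma Ck_on_ident: "Ck_on k S (\<lambda>x. x)"
  by (cases k) (auto intro: Ck_on_const)

lemma Ck_on_add:
  assumes "Ck_on k S f" "Ck_on k S g" "open S"
  shows "Ck_on k S (\<lambda>x. f x + g x)"
  using assms(1,2)
proof (induction k arbitrary: f g)
  case 0
  then show ?case by (simp add: continuous_on_add)
next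
  case (Suc k)
  have d: "((\<lambda>x. f x + g x) has_derivative (\<lambda>v. dd f x v + dd g x v)) (at x)" if "x \<in> S" for x
    using Suc.prems that by (auto intro!: derivative_intros dd_works)
  show ?case by (rule Ck_on_SucI[OF assms(3) d]) (use Suc in auto)
qed

lemma Ck_on_scaleR:
  fixes f :: "'a::real_normed_vector \<Rightarrow> real" and g :: "'a \<Rightarrow> 'b::real_normed_vector"
  assumes "Ck_on k S f" "Ck_on k S g" "open S"
  shows "Ck_on k S (\<lambda>x. f x *\<^sub>R g x)"
  using assms(1,2)
proof (induction k arbitrary: f g)
  case 0
  then show ?case by (simp add: continuous_on_scaleR)
next
  case (Suc k)
  have d: "((\<lambda>x. f x *\<^sub>R g x) has_derivative (\<lambda>v. f x *\<^sub>R dd g x v + dd f x v *\<^sub>R g x)) (at x)"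
    if "x \<in> S" for x
    using Suc.prems that by (auto intro!: derivative_eq_intros dd_works)
  have "Ck_on k S (\<lambda>x. f x *\<^sub>R dd g x v + dd f x v *\<^sub>R g x)" for v
    using Suc Ck_on_Suc_imp[OF Suc.prems(1)] Ck_on_Suc_imp[OF Suc.prems(2)]
    by (intro Ck_on_add assms(3) Suc.IH) auto
  then show ?case by (auto intro: Ck_on_SucI[OF assms(3) d] simp del: Ck_on.simps)
qed

lemma Ck_on_sum:
  assumes "\<And>i. i \<in> I \<Longrightarrow> Ck_on k S (f i)" "open S"
  shows "Ck_on k S (\<lambda>x. \<Sum>i\<in>I. f i x)"
  using assms(1)
  by (induction I rule: infinite_finite_induct) (auto intro!: Ck_on_const Ck_on_add assms(2))

text \<open>The chain rule makes the derivative of a composite a sum of products of functions of one degree of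
smoothness less, once the inner derivative is expanded in a basis of the Euclidean middle space.\<close>

lemma Ck_on_compose:
  fixes f :: "'a::real_normed_vector \<Rightarrow> 'b::euclidean_space" and g :: "'b \<Rightarrow> 'c::real_normed_vector"
  assumes "Ck_on k T g" "Ck_on k S f" "open S" "open T" "f ` S \<subseteq> T"
  shows "Ck_on k S (\<lambda>x. g (f x))"
  using assms(1,2)
proof (induction k arbitrary: g)
  case 0
  then show ?case using assms(5) continuous_on_compose2 by auto
next
  case (Suc k)
  have lin: "linear (dd g (f x))" if "x \<in> S" for x
    using Suc.prems that assms(5) by (auto intro!: linear_frechet_derivative)
  have eq: "dd g (f x) (dd f x v) = (\<Sum>b\<in>Basis. (dd f x v \<bullet> b) *\<^sub>R dd g (f x) b)"
    if "x \<in> S" for x v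
  proof -
    have "dd g (f x) (dd f x v) = dd g (f x) (\<Sum>b\<in>Basis. (dd f x v \<bullet> b) *\<^sub>R b)"
      by (simp add: euclidean_representation)
    also have "\<dots> = (\<Sum>b\<in>Basis. (dd f x v \<bullet> b) *\<^sub>R dd g (f x) b)"
      by (simp add: linear_sum[OF lin[OF that]] linear_scale[OF lin[OF that]])
    finally show ?thesis .
  qed
  have d: "((\<lambda>x. g (f x)) has_derivative (\<lambda>v. dd g (f x) (dd f x v))) (at x)" if "x \<in> S" for x
  proof -
    have "f differentiable (at x)" "g differentiable (at (f x))"
      using Suc.prems that assms(5) by auto
    then show ?thesis
      using has_derivative_compose[OF dd_works dd_works] by blast
  qed
  have fS: "Ck_on k S f" using Suc.prems(2) by (rule Ck_on_Suc_imp)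
  have "Ck_on k S (\<lambda>x. \<Sum>b\<in>Basis. (dd f x v \<bullet> b) *\<^sub>R dd g (f x) b)" for v
  proof (intro Ck_on_sum Ck_on_scaleR assms(3))
    fix b :: 'b assume "b \<in> Basis"
    show "Ck_on k S (\<lambda>x. dd f x v \<bullet> b)"
      by (rule Ck_on_bounded_linear[OF bounded_linear_inner_left _ assms(3)]) (use Suc.prems(2) in auto)
    show "Ck_on k S (\<lambda>x. dd g (f x) b)"
      using Suc.IH[of "\<lambda>y. dd g y b"] Suc.prems fS by auto
  qed
  then have "Ck_on k S (\<lambda>x. dd g (f x) (dd f x v))" for v
    using Ck_on_cong[OF assms(3), of "\<lambda>x. dd g (f x) (dd f x v)"
      "\<lambda>x. \<Sum>b\<in>Basis. (dd f x v \<bullet> b) *\<^sub>R dd g (f x) b" k] eq by simp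
  then show ?case by (auto intro: Ck_on_SucI[OF assms(3) d] simp del: Ck_on.simps)
qed

text \<open>The real powers are closed under differentiation up to constant factors, so one induction covers
inverses and square roots.\<close>

lemma Ck_on_powr: "Ck_on k {0<..} (\<lambda>x::real. x powr a)"
proof (induction k arbitrary: a)
  case 0
  then show ?case by (auto intro!: continuous_intros)
next
  case (Suc k)
  have d: "((\<lambda>x. x powr a) has_derivative (\<lambda>v. v * (a * x powr (a - 1)))) (at x)" if "x > 0" for x
    using has_real_derivative_powr[OF that, of a] by (simp add: has_field_derivative_def mult_commute_abs)
  have "Ck_on k {0<..} (\<lambda>x::real. (v * a) *\<^sub>R (x powr (a - 1)))" for v
    by (intro Ck_on_scaleR Ck_on_const Suc.IH open_greaterThan)
  then have "Ck_on k {0<..} (\<lambda>x::real. v * (a * x powr (a - 1)))" for v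
    by (simp add: mult.assoc)
  then show ?case
    using Ck_on_SucI[of "{0<..}" "\<lambda>x. x powr a" "\<lambda>x v. v * (a * x powr (a - 1))"] d
    by (simp del: Ck_on.simps)
qed

lemma smooth_on_cong:
  assumes "open S" "\<And>y. y \<in> S \<Longrightarrow> f y = g y"
  shows "smooth_on S f \<longleftrightarrow> smooth_on S g"
  unfolding smooth_on_def by (simp add: Ck_on_cong[OF assms])

lemma smooth_on_subset: "smooth_on S f \<Longrightarrow> T \<subseteq> S \<Longrightarrow> smooth_on T f"
  unfolding smooth_on_def using Ck_on_subset by blast

lemma smooth_on_local:
  assumes "\<And>x. x \<in> S \<Longrightarrow> \<exists>T. open T \<and> x \<in> T \<and> smooth_on T f"
  shows "smooth_on S f"
  unfolding smooth_on_def
proof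
  show "Ck_on k S f" for k
  proof (rule Ck_on_local)
    fix x assume "x \<in> S"
    from assms[OF this] obtain T where "open T" "x \<in> T" "\<forall>k. Ck_on k T f"
      unfolding smooth_on_def by (elim exE conjE)
    then show "\<exists>T. open T \<and> x \<in> T \<and> Ck_on k T f" by (intro exI[of _ T] conjI) simp_all
  qed
qed

text \<open>Unfolding once in this form replaces inductions over the order of differentiability.\<close>

lemma smooth_on_Suc:
  "smooth_on S f \<longleftrightarrow> (\<forall>x\<in>S. f differentiable (at x)) \<and> (\<forall>v. smooth_on S (\<lambda>x. dd f x v))"
proof
  assume f: "smooth_on S f"
  have *: "Ck_on (Suc k) S f" for k using f[unfolded smooth_on_def, rule_format, of "Suc k"] .
  show "(\<forall>x\<in>S. f differentiable (at x)) \<and> (\<forall>v. smooth_on S (\<lambda>x. dd f x v))"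
    unfolding smooth_on_def using *[unfolded Ck_on.simps(2)] by (intro conjI allI) (elim conjE, assumption | simp)+
next
  assume r: "(\<forall>x\<in>S. f differentiable (at x)) \<and> (\<forall>v. smooth_on S (\<lambda>x. dd f x v))"
  have "Ck_on (Suc k) S f" for k
    unfolding Ck_on.simps(2) using r[unfolded smooth_on_def] by (intro conjI allI) (elim conjE, assumption | simp)+
  from Ck_on_Suc_imp[OF this] show "smooth_on S f" unfolding smooth_on_def by (rule allI)
qed

lemma smooth_on_differentiable: "smooth_on S f \<Longrightarrow> x \<in> S \<Longrightarrow> f differentiable (at x)"
  by (simp add: smooth_on_Suc[of S f])

lemma smooth_on_has_derivative: "smooth_on S f \<Longrightarrow> x \<in> S \<Longrightarrow> (f has_derivative dd f x) (at x)"
  by (rule dd_works[OF smooth_on_differentiable])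

lemma smooth_on_linear_dd: "smooth_on S f \<Longrightarrow> x \<in> S \<Longrightarrow> linear (dd f x)"
  by (rule linear_frechet_derivative[OF smooth_on_differentiable])

lemma smooth_on_dd: "smooth_on S f \<Longrightarrow> smooth_on S (\<lambda>x. dd f x v)"
  by (subst (asm) smooth_on_Suc) blast

lemma smooth_on_continuous: "smooth_on S f \<Longrightarrow> continuous_on S f"
  unfolding smooth_on_def using Ck_on.simps(1) by blast

lemma smooth_on_const: "smooth_on S (\<lambda>_. c)"
  unfolding smooth_on_def using Ck_on_const by blast

lemma smooth_on_ident: "smooth_on S (\<lambda>x. x)"
  unfolding smooth_on_def using Ck_on_ident by blast

lemma smooth_on_bounded_linear:
  "bounded_linear L \<Longrightarrow> smooth_on S f \<Longrightarrow> open S \<Longrightarrow> smooth_on S (\<lambda>x. L (f x))"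
  unfolding smooth_on_def using Ck_on_bounded_linear by blast

lemma smooth_on_add: "smooth_on S f \<Longrightarrow> smooth_on S g \<Longrightarrow> open S \<Longrightarrow> smooth_on S (\<lambda>x. f x + g x)"
  unfolding smooth_on_def using Ck_on_add by blast

lemma smooth_on_scaleR:
  fixes f :: "'a::real_normed_vector \<Rightarrow> real"
  shows "smooth_on S f \<Longrightarrow> smooth_on S g \<Longrightarrow> open S \<Longrightarrow> smooth_on S (\<lambda>x. f x *\<^sub>R g x)"
  unfolding smooth_on_def using Ck_on_scaleR by blast

lemma smooth_on_mult:
  fixes f :: "'a::real_normed_vector \<Rightarrow> real"
  shows "smooth_on S f \<Longrightarrow> smooth_on S g \<Longrightarrow> open S \<Longrightarrow> smooth_on S (\<lambda>x. f x * g x)"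
  using smooth_on_scaleR[of S f g] by simp

lemma smooth_on_uminus: "smooth_on S f \<Longrightarrow> open S \<Longrightarrow> smooth_on S (\<lambda>x. - f x)"
  using smooth_on_bounded_linear[OF bounded_linear_minus[OF bounded_linear_ident]] .

lemma smooth_on_diff: "smooth_on S f \<Longrightarrow> smooth_on S g \<Longrightarrow> open S \<Longrightarrow> smooth_on S (\<lambda>x. f x - g x)"
  using smooth_on_add[of S f "\<lambda>x. - g x"] smooth_on_uminus[of S g] by simp

lemma smooth_on_sum:
  "(\<And>i. i \<in> I \<Longrightarrow> smooth_on S (f i)) \<Longrightarrow> open S \<Longrightarrow> smooth_on S (\<lambda>x. \<Sum>i\<in>I. f i x)"
  by (simp add: smooth_on_def Ck_on_sum)

lemma smooth_on_compose:
  fixes f :: "'a::real_normed_vector \<Rightarrow> 'b::euclidean_space" and g :: "'b \<Rightarrow> 'c::real_normed_vector"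
  assumes "smooth_on T g" "smooth_on S f" "open S" "open T" "\<And>x. x \<in> S \<Longrightarrow> f x \<in> T"
  shows "smooth_on S (\<lambda>x. g (f x))"
  unfolding smooth_on_def
proof
  show "Ck_on k S (\<lambda>x. g (f x))" for k
    by (rule Ck_on_compose[where T=T]) (use assms in \<open>auto simp: smooth_on_def\<close>)
qed

lemma smooth_on_powr:
  fixes f :: "'a::real_normed_vector \<Rightarrow> real"
  assumes "smooth_on S f" "open S" "\<And>x. x \<in> S \<Longrightarrow> f x > 0"
  shows "smooth_on S (\<lambda>x. f x powr a)"
  using smooth_on_compose[of "{0<..}" "\<lambda>x. x powr a" S f] assms Ck_on_powr unfolding smooth_on_def by auto

lemma smooth_on_Pair:
  fixes f :: "'a::real_normed_vector \<Rightarrow> 'b::real_normed_vector" and g :: "'a \<Rightarrow> 'c::real_normed_vector"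
  assumes "smooth_on S f" "smooth_on S g" "open S"
  shows "smooth_on S (\<lambda>x. (f x, g x))"
proof -
  have "bounded_linear (\<lambda>x::'b. (x, 0::'c))" "bounded_linear (\<lambda>x::'c. (0::'b, x))"
    by (auto intro!: bounded_linear_intro[where K=1] simp: norm_Pair)
  then have "smooth_on S (\<lambda>x. (f x, 0::'c) + (0::'b, g x))"
    using assms by (intro smooth_on_add smooth_on_bounded_linear[of "\<lambda>x. (x,0)"] smooth_on_bounded_linear[of "\<lambda>x. (0,x)"])
  then show ?thesis by simp
qed

lemma smooth_on_fst: "smooth_on S f \<Longrightarrow> open S \<Longrightarrow> smooth_on S (\<lambda>x. fst (f x))"
  using smooth_on_bounded_linear[OF bounded_linear_fst] .

lemma smooth_on_snd: "smooth_on S f \<Longrightarrow> open S \<Longrightarrow> smooth_on S (\<lambda>x. snd (f x))"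
  using smooth_on_bounded_linear[OF bounded_linear_snd] .

lemma linear_expand:
  fixes L :: "'a::euclidean_space \<Rightarrow> 'b::real_vector"
  assumes "linear L"
  shows "L v = (\<Sum>b\<in>Basis. (v \<bullet> b) *\<^sub>R L b)"
proof -
  have "L v = L (\<Sum>b\<in>Basis. (v \<bullet> b) *\<^sub>R b)" by (simp add: euclidean_representation)
  then show ?thesis by (simp add: linear_sum[OF assms] linear_scale[OF assms])
qed

text \<open>Tensors are given by their values on constant vectors; expanding the argument in a basis allows variable
arguments.\<close>

lemma smooth_on_linear_param:
  fixes L :: "'z::real_normed_vector \<Rightarrow> 'a::euclidean_space \<Rightarrow> 'b::real_normed_vector"
  assumes "open S" "\<And>z. z \<in> S \<Longrightarrow> linear (L z)" "\<And>b. smooth_on S (\<lambda>z. L z b)" "smooth_on S k"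
  shows "smooth_on S (\<lambda>z. L z (k z))"
proof -
  have "smooth_on S (\<lambda>z. \<Sum>b\<in>Basis. (k z \<bullet> b) *\<^sub>R L z b)"
    using assms by (intro smooth_on_sum smooth_on_scaleR smooth_on_bounded_linear[OF bounded_linear_inner_left])
  then show ?thesis
    using smooth_on_cong[OF assms(1), OF linear_expand[OF assms(2)], of "\<lambda>z. z" k] by simp
qed

text \<open>The product rule for a linear map that depends on a parameter, from its partial derivatives
\<open>D v\<close> on constant vectors \<open>v\<close> alone.\<close>

lemma has_derivative_linear_param:
  fixes L :: "'z::real_normed_vector \<Rightarrow> 'a::euclidean_space \<Rightarrow> 'b::real_normed_vector"
  assumes "open S" "z0 \<in> S" "\<And>z. z \<in> S \<Longrightarrow> linear (L z)"
    "\<And>v. ((\<lambda>z. L z v) has_derivative D v) (at z0)" "(k has_derivative k') (at z0)"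
  shows "((\<lambda>z. L z (k z)) has_derivative (\<lambda>d. D (k z0) d + L z0 (k' d))) (at z0)"
proof -
  have D: "D v = (\<lambda>d. \<Sum>b\<in>Basis. (v \<bullet> b) *\<^sub>R D b d)" for v
  proof -
    have "((\<lambda>z. \<Sum>b\<in>Basis. (v \<bullet> b) *\<^sub>R L z b) has_derivative (\<lambda>d. \<Sum>b\<in>Basis. (v \<bullet> b) *\<^sub>R D b d)) (at z0)"
      by (auto intro!: derivative_eq_intros assms(4))
    then have "((\<lambda>z. L z v) has_derivative (\<lambda>d. \<Sum>b\<in>Basis. (v \<bullet> b) *\<^sub>R D b d)) (at z0)"
      using has_derivative_cong_open[OF assms(1,2) linear_expand[OF assms(3)], of "\<lambda>z. z" "\<lambda>_. v"] by blast
    then show ?thesis using assms(4) has_derivative_unique by blast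
  qed
  have "((\<lambda>z. \<Sum>b\<in>Basis. (k z \<bullet> b) *\<^sub>R L z b) has_derivative
      (\<lambda>d. \<Sum>b\<in>Basis. ((k z0 \<bullet> b) *\<^sub>R D b d + (k' d \<bullet> b) *\<^sub>R L z0 b))) (at z0)"
    by (auto intro!: derivative_eq_intros assms(4,5))
  moreover have "(\<Sum>b\<in>Basis. ((k z0 \<bullet> b) *\<^sub>R D b d + (k' d \<bullet> b) *\<^sub>R L z0 b)) = D (k z0) d + L z0 (k' d)" for d
    by (simp add: sum.distrib fun_cong[OF D[of "k z0"]] linear_expand[OF assms(3)[OF assms(2)], of "k' d"])
  ultimately show ?thesis
    using has_derivative_cong_open[OF assms(1,2) linear_expand[OF assms(3)], of "\<lambda>z. z" k] by simp
qed

lemma smooth_on_dd_apply: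
  fixes f :: "'a::euclidean_space \<Rightarrow> 'b::real_normed_vector"
  assumes "open S" "open T" "smooth_on T f" "smooth_on S h" "\<And>z. z \<in> S \<Longrightarrow> h z \<in> T" "smooth_on S k"
  shows "smooth_on S (\<lambda>z. dd f (h z) (k z))"
proof (rule smooth_on_linear_param)
  show "smooth_on S (\<lambda>z. dd f (h z) b)" for b
    using smooth_on_compose[OF smooth_on_dd[OF assms(3)] assms(4,1,2,5)] .
qed (use assms smooth_on_linear_dd in auto)

lemma dd_compose:
  assumes "f differentiable (at x)" "g differentiable (at (f x))"
  shows "dd (\<lambda>x. g (f x)) x = (\<lambda>v. dd g (f x) (dd f x v))"
  using dd_eqI[OF has_derivative_compose[OF dd_works[OF assms(1)] dd_works[OF assms(2)]]] .

section \<open>Symmetry of second derivatives\<close>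

text \<open>By two applications of the mean value theorem, the second difference of \<open>f\<close> over the parallelogram with
sides \<open>s u\<close> and \<open>s v\<close> is \<open>s\<^sup>2\<close> times a mixed derivative at a nearby point.  The two orders of
differentiation give the same difference, and \<open>s\<close> tends to \<open>0\<close>.\<close>

lemma second_derivative_sym_real:
  fixes f :: "'a::euclidean_space \<Rightarrow> real"
  assumes "open S" "smooth_on S f" "x \<in> S"
  shows "dd (\<lambda>y. dd f y u) x v = dd (\<lambda>y. dd f y v) x u"
proof -
  define P where "P u v = (\<lambda>y. dd (\<lambda>y. dd f y u) y v)" for u v
  have key: "\<exists>y. norm (y - x) \<le> s * (norm u + norm v) \<and>
     f (x + s *\<^sub>R u + s *\<^sub>R v) - f (x + s *\<^sub>R u) - f (x + s *\<^sub>R v) + f x = s * (s * P u v y)"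
    if s: "s > 0" "cball x (s * (norm u + norm v)) \<subseteq> S" for s u v
  proof -
    have bnd: "norm (a *\<^sub>R u + b *\<^sub>R v) \<le> s * (norm u + norm v)" if "0 \<le> a" "a \<le> s" "0 \<le> b" "b \<le> s" for a b
    proof -
      have "norm (a *\<^sub>R u + b *\<^sub>R v) \<le> a * norm u + b * norm v"
        using norm_triangle_ineq[of "a *\<^sub>R u" "b *\<^sub>R v"] that by simp
      also have "\<dots> \<le> s * norm u + s * norm v"
        using that by (intro add_mono mult_right_mono) auto
      finally show ?thesis by (simp add: algebra_simps)
    qed
    have inS: "x + a *\<^sub>R u + b *\<^sub>R v \<in> S" if "0 \<le> a" "a \<le> s" "0 \<le> b" "b \<le> s" for a b
      using bnd[OF that] s(2) by (auto simp: dist_norm add.assoc subset_iff norm_minus_commute algebra_simps)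
    define h where "h a = f (x + a *\<^sub>R u + s *\<^sub>R v) - f (x + a *\<^sub>R u)" for a
    have dh: "(h has_real_derivative (dd f (x + a *\<^sub>R u + s *\<^sub>R v) u - dd f (x + a *\<^sub>R u) u)) (at a)"
      if a: "0 \<le> a" "a \<le> s" for a
    proof -
      have 1: "((\<lambda>a. f (x + a *\<^sub>R u + w)) has_derivative (\<lambda>t. dd f (x + a *\<^sub>R u + w) (t *\<^sub>R u))) (at a)"
        if "x + a *\<^sub>R u + w \<in> S" for w
      proof -
        have "((\<lambda>a. x + a *\<^sub>R u + w) has_derivative (\<lambda>t. t *\<^sub>R u)) (at a)"
          by (auto intro!: derivative_eq_intros)
        from has_derivative_compose[OF this smooth_on_has_derivative[OF assms(2) that]]
        show ?thesis .
      qed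
      have l: "dd f (x + a *\<^sub>R u + w) (t *\<^sub>R u) = t * dd f (x + a *\<^sub>R u + w) u" if "x + a *\<^sub>R u + w \<in> S" for w t
        using linear_scale[OF smooth_on_linear_dd[OF assms(2) that]] by simp
      have "((\<lambda>a. f (x + a *\<^sub>R u + s *\<^sub>R v)) has_real_derivative dd f (x + a *\<^sub>R u + s *\<^sub>R v) u) (at a)"
           "((\<lambda>a. f (x + a *\<^sub>R u + 0)) has_real_derivative dd f (x + a *\<^sub>R u + 0) u) (at a)"
        using 1[of "s *\<^sub>R v"] 1[of 0] inS[of a s] inS[of a 0] a s(1) l[of "s *\<^sub>R v"] l[of 0]
        by (auto simp: has_field_derivative_def mult_commute_abs)
      then show ?thesis unfolding h_def by (auto intro: DERIV_diff)
    qed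
    obtain a where a: "0 < a" "a < s" "h s - h 0 = s * (dd f (x + a *\<^sub>R u + s *\<^sub>R v) u - dd f (x + a *\<^sub>R u) u)"
      using MVT2[of 0 s h, OF s(1) dh] by auto
    define k where "k b = dd f (x + a *\<^sub>R u + b *\<^sub>R v) u" for b
    have dk: "(k has_real_derivative P u v (x + a *\<^sub>R u + b *\<^sub>R v)) (at b)" if b: "0 \<le> b" "b \<le> s" for b
    proof -
      have i: "x + a *\<^sub>R u + b *\<^sub>R v \<in> S" using inS a b by auto
      have sm: "smooth_on S (\<lambda>y. dd f y u)" using assms(2) by (rule smooth_on_dd)
      have "((\<lambda>b. x + a *\<^sub>R u + b *\<^sub>R v) has_derivative (\<lambda>t. t *\<^sub>R v)) (at b)"
        by (auto intro!: derivative_eq_intros)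
      from has_derivative_compose[OF this smooth_on_has_derivative[OF sm i]]
      have "(k has_derivative (\<lambda>t. dd (\<lambda>y. dd f y u) (x + a *\<^sub>R u + b *\<^sub>R v) (t *\<^sub>R v))) (at b)"
        unfolding k_def .
      then show ?thesis unfolding P_def
        using linear_scale[OF smooth_on_linear_dd[OF sm i]]
        by (auto simp: has_field_derivative_def mult_commute_abs)
    qed
    obtain b where b: "0 < b" "b < s" "k s - k 0 = s * P u v (x + a *\<^sub>R u + b *\<^sub>R v)"
      using MVT2[of 0 s k, OF s(1) dk] by auto
    have "h s - h 0 = s * (s * P u v (x + a *\<^sub>R u + b *\<^sub>R v))"
      using a(3) b(3) by (simp add: k_def)
    then show ?thesis
      using bnd[of a b] a b by (intro exI[of _ "x + a *\<^sub>R u + b *\<^sub>R v"]) (auto simp: h_def algebra_simps)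
  qed
  have cont: "isCont (P u v) x" for u v
    using smooth_on_continuous[OF smooth_on_dd[OF smooth_on_dd[OF assms(2)]]] assms(1,3)
    unfolding P_def by (metis continuous_on_eq_continuous_at)
  \<comment> \<open>The summand 1 keeps \<open>C\<close> positive when \<open>u = v = 0\<close>.\<close>
  define C where "C = norm u + norm v + 1"
  have C: "C > 0" "norm u + norm v \<le> C" "norm v + norm u \<le> C" by (auto simp: C_def add_nonneg_pos)
  have "\<bar>P u v x - P v u x\<bar> \<le> e" if e: "e > 0" for e
  proof -
    obtain d1 where d1: "d1 > 0" "\<And>y. dist y x < d1 \<Longrightarrow> dist (P u v y) (P u v x) < e/2"
      using cont[of u v] e unfolding continuous_at_eps_delta by (meson half_gt_zero)
    obtain d2 where d2: "d2 > 0" "\<And>y. dist y x < d2 \<Longrightarrow> dist (P v u y) (P v u x) < e/2"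
      using cont[of v u] e unfolding continuous_at_eps_delta by (meson half_gt_zero)
    obtain d3 where d3: "d3 > 0" "cball x d3 \<subseteq> S" using assms(1,3) open_contains_cball by blast
    define d where "d = min d1 (min d2 d3)"
    define s where "s = d / (2 * C)"
    have s: "s > 0" using C d1(1) d2(1) d3(1) by (simp add: s_def d_def)
    have "s * (norm u + norm v) \<le> s * C" using C s by simp
    also have "s * C = d / 2" using C by (simp add: s_def)
    also have "\<dots> < d" using d1(1) d2(1) d3(1) unfolding d_def by linarith
    finally have sd: "s * (norm u + norm v) < d" .
    have sub: "cball x (s * (norm u + norm v)) \<subseteq> S" using sd d3 by (auto simp: d_def)
    obtain y where y: "norm (y - x) \<le> s * (norm u + norm v)"
     "f (x + s *\<^sub>R u + s *\<^sub>R v) - f (x + s *\<^sub>R u) - f (x + s *\<^sub>R v) + f x = s * (s * P u v y)"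
      using key[OF s sub] by blast
    obtain z where z: "norm (z - x) \<le> s * (norm u + norm v)"
     "f (x + s *\<^sub>R v + s *\<^sub>R u) - f (x + s *\<^sub>R v) - f (x + s *\<^sub>R u) + f x = s * (s * P v u z)"
      using key[OF s, of v u] sub by (auto simp: add.commute)
    have "f (x + s *\<^sub>R v + s *\<^sub>R u) = f (x + s *\<^sub>R u + s *\<^sub>R v)" by (simp add: algebra_simps)
    then have "s * (s * P u v y) = s * (s * P v u z)" using y(2) z(2) by linarith
    then have "P u v y = P v u z" using s by simp
    moreover have "dist (P u v y) (P u v x) < e/2" using d1 y sd by (simp add: dist_norm d_def)
    moreover have "dist (P v u z) (P v u x) < e/2" using d2 z sd by (simp add: dist_norm d_def)
    ultimately show ?thesis unfolding dist_real_def by linarith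
  qed
  then have "P u v x = P v u x" using field_le_epsilon[of "\<bar>P u v x - P v u x\<bar>" 0] by auto
  then show ?thesis by (simp add: P_def)
qed

lemma second_derivative_sym:
  fixes f :: "'a::euclidean_space \<Rightarrow> 'b::euclidean_space"
  assumes "open S" "smooth_on S f" "x \<in> S"
  shows "dd (\<lambda>y. dd f y u) x v = dd (\<lambda>y. dd f y v) x u"
proof (rule euclidean_eqI)
  fix b :: 'b
  have d: "dd (\<lambda>y. g y \<bullet> b) y = (\<lambda>v. dd g y v \<bullet> b)" if "smooth_on S g" "y \<in> S" for g :: "'a \<Rightarrow> 'b" and y
    using has_derivative_inner_left[OF smooth_on_has_derivative[OF that]] by (rule dd_eqI)
  have sm: "smooth_on S (\<lambda>y. f y \<bullet> b)"
    using smooth_on_bounded_linear[OF bounded_linear_inner_left assms(2,1)] .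
  have *: "dd (\<lambda>y. dd f y u) x v \<bullet> b = dd (\<lambda>y. dd (\<lambda>y. f y \<bullet> b) y u) x v" for u v
  proof -
    have "dd (\<lambda>y. dd (\<lambda>y. f y \<bullet> b) y u) x = dd (\<lambda>y. dd f y u \<bullet> b) x"
      by (rule dd_cong_open[OF assms(1,3)]) (simp add: d[OF assms(2)])
    then show ?thesis by (simp add: d[OF smooth_on_dd[OF assms(2)] assms(3)])
  qed
  show "dd (\<lambda>y. dd f y u) x v \<bullet> b = dd (\<lambda>y. dd f y v) x u \<bullet> b"
    using second_derivative_sym_real[OF assms(1) sm assms(3), of u v] by (simp add: *)
qed

section \<open>Parameter-dependent bilinear maps\<close>

lemma has_derivative_bilinear_comp:
  fixes B :: "'y::real_normed_vector \<Rightarrow> 'a::euclidean_space \<Rightarrow> 'b::euclidean_space \<Rightarrow> 'c::real_normed_vector"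
    and h :: "'z::real_normed_vector \<Rightarrow> 'y"
  assumes "open V" "h z0 \<in> V" "\<And>y. y \<in> V \<Longrightarrow> bilinear (B y)"
    "\<And>u v. (\<lambda>y. B y u v) differentiable (at (h z0))"
    "(h has_derivative h') (at z0)" "(k has_derivative k') (at z0)" "(l has_derivative l') (at z0)"
  shows "((\<lambda>z. B (h z) (k z) (l z)) has_derivative
     (\<lambda>d. dd (\<lambda>y. B y (k z0) (l z0)) (h z0) (h' d) + B (h z0) (k' d) (l z0) + B (h z0) (k z0) (l' d))) (at z0)"
proof -
  have "\<forall>\<^sub>F z in nhds z0. h z \<in> V"
    using topological_tendstoD[OF has_derivative_continuous[OF assms(5), unfolded continuous_at] assms(1,2)] assms(2)
    unfolding eventually_nhds_conv_at by blast
  then obtain S where S: "open S" "z0 \<in> S" "\<And>z. z \<in> S \<Longrightarrow> h z \<in> V"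
    unfolding eventually_nhds by blast
  have lin: "linear (\<lambda>u. B (h z) u v)" "linear (B (h z) u)" if "z \<in> S" for z u v
    using assms(3)[OF S(3)[OF that]] by (auto simp: bilinear_def)
  have 0: "((\<lambda>z. B (h z) u v) has_derivative (\<lambda>d. dd (\<lambda>y. B y u v) (h z0) (h' d))) (at z0)" for u v
    using has_derivative_compose[OF assms(5) dd_works[OF assms(4)]] .
  have 1: "((\<lambda>z. B (h z) (k z) v) has_derivative
     (\<lambda>d. dd (\<lambda>y. B y (k z0) v) (h z0) (h' d) + B (h z0) (k' d) v)) (at z0)" for v
    using has_derivative_linear_param[OF S(1,2), of "\<lambda>z u. B (h z) u v" "\<lambda>u d. dd (\<lambda>y. B y u v) (h z0) (h' d)", OF lin(1) 0 assms(6)] .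
  show ?thesis
    using has_derivative_linear_param[OF S(1,2), of "\<lambda>z. B (h z) (k z)", OF lin(2) 1 assms(7)] .
qed

lemma smooth_on_bilinear_comp:
  fixes B :: "'y::euclidean_space \<Rightarrow> 'a::euclidean_space \<Rightarrow> 'b::euclidean_space \<Rightarrow> 'c::real_normed_vector"
    and h :: "'z::real_normed_vector \<Rightarrow> 'y"
  assumes "open S" "open V" "\<And>z. z \<in> S \<Longrightarrow> h z \<in> V" "\<And>y. y \<in> V \<Longrightarrow> bilinear (B y)"
    "\<And>u v. smooth_on V (\<lambda>y. B y u v)" "smooth_on S h" "smooth_on S k" "smooth_on S l"
  shows "smooth_on S (\<lambda>z. B (h z) (k z) (l z))"
proof -
  have lin: "linear (\<lambda>u. B (h z) u v)" "linear (B (h z) u)" if "z \<in> S" for z u v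
    using assms(4)[OF assms(3)[OF that]] by (auto simp: bilinear_def)
  have "smooth_on S (\<lambda>z. B (h z) u v)" for u v
    using smooth_on_compose[OF assms(5,6,1,2,3)] .
  then have "smooth_on S (\<lambda>z. B (h z) (k z) v)" for v
    using smooth_on_linear_param[OF assms(1), of "\<lambda>z u. B (h z) u v" k] lin(1) assms(7) by blast
  then show ?thesis
    using smooth_on_linear_param[OF assms(1), of "\<lambda>z. B (h z) (k z)" l] lin(2) assms(8) by blast
qed

section \<open>Smooth orthonormal families\<close>

definition inner_form :: "('e::euclidean_space \<Rightarrow> 'e \<Rightarrow> real) \<Rightarrow> bool" where
  "inner_form B \<longleftrightarrow> bilinear B \<and> (\<forall>u v. B u v = B v u) \<and> (\<forall>u. u \<noteq> 0 \<longrightarrow> B u u > 0)"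

text \<open>Numbered from 1, as the frames in the theorem are.\<close>

definition orthonormal_upto :: "nat \<Rightarrow> ('e \<Rightarrow> 'e \<Rightarrow> real) \<Rightarrow> (nat \<Rightarrow> 'e) \<Rightarrow> bool" where
  "orthonormal_upto k B e \<longleftrightarrow> (\<forall>i\<in>{1..k}. \<forall>j\<in>{1..k}. B (e i) (e j) = (if i = j then 1 else 0))"

lemma inner_formD:
  assumes "inner_form B"
  shows "bilinear B" "linear (B u)" "linear (\<lambda>x. B x v)" "B u v = B v u" "u \<noteq> 0 \<Longrightarrow> B u u > 0"
    "B u u = 0 \<longleftrightarrow> u = 0"
  using assms unfolding inner_form_def by (auto simp: bilinear_def linear_0 intro: ccontr)

lemma inner_form_nondegenerate:
  assumes "inner_form B" "\<And>z. B u z = B v z"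
  shows "u = v"
proof -
  have "B (u - v) (u - v) = 0"
    using linear_diff[OF inner_formD(3)[OF assms(1)]] assms(2) by simp
  then show ?thesis using inner_formD(6)[OF assms(1)] by simp
qed

text \<open>The difference of the two sides is orthogonal to the \<open>e i\<close>, which span the space because there are
\<open>DIM('e)\<close> of them and they are independent.\<close>

lemma orthonormal_expand:
  fixes B :: "'e::euclidean_space \<Rightarrow> 'e \<Rightarrow> real"
  assumes "inner_form B" "orthonormal_upto DIM('e) B e"
  shows "v = (\<Sum>i=1..DIM('e). B (e i) v *\<^sub>R e i)"
proof -
  note lin = inner_formD(2,3)[OF assms(1)]
  have on: "B (e i) (e j) = (if i = j then 1 else 0)" if "i \<in> {1..DIM('e)}" "j \<in> {1..DIM('e)}" for i j
    using assms(2) that unfolding orthonormal_upto_def by blast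
  let ?I = "{1..DIM('e)}"
  have inj: "inj_on e ?I"
    by (rule inj_onI) (use on in \<open>metis zero_neq_one\<close>)
  have ind: "independent (e ` ?I)"
  proof (rule independent_if_scalars_zero)
    fix f x assume s: "(\<Sum>x\<in>e ` ?I. f x *\<^sub>R x) = 0" and "x \<in> e ` ?I"
    then obtain i where i: "i \<in> ?I" "x = e i" by blast
    have "0 = B (e i) (\<Sum>j\<in>?I. f (e j) *\<^sub>R e j)"
      using s linear_0[OF lin(1)] unfolding sum.reindex[OF inj] o_def by simp
    also have "\<dots> = (\<Sum>j\<in>?I. f (e j) * B (e i) (e j))"
      by (simp add: linear_sum[OF lin(1)] linear_scale[OF lin(1)])
    also have "\<dots> = (\<Sum>j\<in>?I. if i = j then f (e j) else 0)"
      by (rule sum.cong) (use on i in auto)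
    also have "\<dots> = f x" using i by simp
    finally show "f x = 0" by simp
  qed simp
  have "span (e ` ?I) = UNIV"
    using ind inj by (metis card_atLeastAtMost card_image diff_Suc_1 dim_eq_full dim_span dim_span_eq_card_independent dim_UNIV)
  define u where "u = v - (\<Sum>i\<in>?I. B (e i) v *\<^sub>R e i)"
  have "B u (e j) = 0" if j: "j \<in> ?I" for j
  proof -
    have "B u (e j) = B v (e j) - (\<Sum>i\<in>?I. B (e i) v * B (e i) (e j))"
      unfolding u_def by (simp add: linear_diff[OF lin(2)] linear_sum[OF lin(2)] linear_scale[OF lin(2)])
    also have "(\<Sum>i\<in>?I. B (e i) v * B (e i) (e j)) = (\<Sum>i\<in>?I. if i = j then B (e i) v else 0)"
      by (rule sum.cong) (use on j in auto)
    also have "\<dots> = B (e j) v" using j by simp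
    finally show ?thesis using inner_formD(4)[OF assms(1), of v] by simp
  qed
  then have "B u x = 0" if "x \<in> e ` ?I" for x using that by blast
  then have "B u u = 0" using linear_eq_0_on_span[of "B u" "e ` ?I" u, OF lin(1)]
    using \<open>span (e ` ?I) = UNIV\<close> by simp
  then show ?thesis using inner_formD(6)[OF assms(1)] by (simp add: u_def)
qed

text \<open>One step of Gram-Schmidt with parameters.  A constant vector outside the span of the family at \<open>p\<close> has
a nonzero orthogonal part at \<open>p\<close>, hence also near \<open>p\<close>, where it can be normalised smoothly.\<close>

lemma smooth_orthonormal_step:
  fixes H :: "'z::euclidean_space \<Rightarrow> 'e::euclidean_space \<Rightarrow> 'e \<Rightarrow> real"
  assumes "open W" "p \<in> W" "\<And>z. z \<in> W \<Longrightarrow> inner_form (H z)" "\<And>u v. smooth_on W (\<lambda>z. H z u v)"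
    "k < DIM('e)" "\<And>i. i \<in> {1..k} \<Longrightarrow> smooth_on W (e i)"
    "\<And>z. z \<in> W \<Longrightarrow> orthonormal_upto k (H z) (\<lambda>i. e i z)"
  shows "\<exists>S f. open S \<and> p \<in> S \<and> S \<subseteq> W \<and> smooth_on S f \<and>
     (\<forall>z\<in>S. H z (f z) (f z) = 1 \<and> (\<forall>i\<in>{1..k}. H z (e i z) (f z) = 0))"
proof -
  have bil: "bilinear (H z)" if "z \<in> W" for z using inner_formD(1) assms(3) that by blast
  have smH: "smooth_on W (\<lambda>z. H z (a z) (b z))" if "smooth_on W a" "smooth_on W b" for a b
    using smooth_on_bilinear_comp[OF assms(1,1) _ bil assms(4) smooth_on_ident that] by blast
  have "dim ((\<lambda>i. e i p) ` {1..k}) \<le> k"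
    using dim_le_card'[of "(\<lambda>i. e i p) ` {1..k}"] card_image_le[of "{1..k}" "\<lambda>i. e i p"] by simp
  then have "span ((\<lambda>i. e i p) ` {1..k}) \<noteq> UNIV"
    using assms(5) by (metis dim_UNIV dim_span not_less)
  then obtain w where w: "w \<notin> span ((\<lambda>i. e i p) ` {1..k})" by blast
  define u where "u z = w - (\<Sum>i\<in>{1..k}. H z (e i z) w *\<^sub>R e i z)" for z
  have smu: "smooth_on W u" unfolding u_def
    by (intro smooth_on_diff smooth_on_const smooth_on_sum smooth_on_scaleR smH assms)
  define N where "N z = H z (u z) (u z)" for z
  have smN: "smooth_on W N" unfolding N_def by (intro smH smu)
  have "u p \<noteq> 0"
  proof
    assume "u p = 0"
    then have "w = (\<Sum>i\<in>{1..k}. H p (e i p) w *\<^sub>R e i p)" by (simp add: u_def)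
    moreover have "\<dots> \<in> span ((\<lambda>i. e i p) ` {1..k})"
      by (intro span_sum span_scale span_base) auto
    ultimately show False using w by simp
  qed
  then have Np: "N p > 0" unfolding N_def using inner_formD(5)[OF assms(3)[OF assms(2)]] by blast
  define S where "S = W \<inter> N -` {0<..}"
  have S: "open S" unfolding S_def
    using continuous_open_preimage[OF smooth_on_continuous[OF smN] assms(1)] by auto
  define f where "f z = N z powr (-1/2) *\<^sub>R u z" for z
  have "smooth_on S f" unfolding f_def
    by (intro smooth_on_scaleR smooth_on_powr S smooth_on_subset[OF smu] smooth_on_subset[OF smN])
      (auto simp: S_def)
  moreover have "H z (f z) (f z) = 1" "\<forall>i\<in>{1..k}. H z (e i z) (f z) = 0" if z: "z \<in> S" for z
  proof -
    have zW: "z \<in> W" and Nz: "N z > 0" using z by (auto simp: S_def)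
    note lin = inner_formD(2,3)[OF assms(3)[OF zW]]
    have "H z (f z) (f z) = N z powr (-1/2) * N z powr (-1/2) * N z"
      unfolding f_def by (simp add: linear_scale[OF lin(1)] linear_scale[OF lin(2)] N_def)
    also have "N z powr (-1/2) * N z powr (-1/2) = N z powr (-1)"
      by (simp flip: powr_add)
    finally show "H z (f z) (f z) = 1" using Nz by (simp add: powr_minus)
    show "\<forall>i\<in>{1..k}. H z (e i z) (f z) = 0"
    proof
      fix j assume j: "j \<in> {1..k}"
      have "H z (e j z) (u z) = H z (e j z) w - (\<Sum>i\<in>{1..k}. H z (e i z) w * H z (e j z) (e i z))"
        unfolding u_def by (simp add: linear_diff[OF lin(1)] linear_sum[OF lin(1)] linear_scale[OF lin(1)])
      also have "(\<Sum>i\<in>{1..k}. H z (e i z) w * H z (e j z) (e i z)) = (\<Sum>i\<in>{1..k}. if j = i then H z (e i z) w else 0)"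
        by (rule sum.cong) (use assms(7)[OF zW] j in \<open>auto simp: orthonormal_upto_def\<close>)
      also have "\<dots> = H z (e j z) w" using j by simp
      finally show "H z (e j z) (f z) = 0" unfolding f_def by (simp add: linear_scale[OF lin(1)])
    qed
  qed
  moreover have "p \<in> S" "S \<subseteq> W" using Np assms(2) by (auto simp: S_def)
  ultimately show ?thesis using S by blast
qed

text \<open>With \<open>k = 0\<close> this yields local orthonormal frames of a metric, and with \<open>k = 2\<close> frames of the orthogonal
complement of \<open>R\<close> and \<open>V\<close>.\<close>

lemma smooth_orthonormal_extend:
  fixes H :: "'z::euclidean_space \<Rightarrow> 'e::euclidean_space \<Rightarrow> 'e \<Rightarrow> real"
  assumes "open W" "p \<in> W" "\<And>z. z \<in> W \<Longrightarrow> inner_form (H z)" "\<And>u v. smooth_on W (\<lambda>z. H z u v)"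
    "k \<le> DIM('e)" "\<And>i. i \<in> {1..k} \<Longrightarrow> smooth_on W (e i)"
    "\<And>z. z \<in> W \<Longrightarrow> orthonormal_upto k (H z) (\<lambda>i. e i z)"
  shows "\<exists>S f. open S \<and> p \<in> S \<and> S \<subseteq> W \<and> (\<forall>i\<in>{1..k}. f i = e i) \<and> (\<forall>i\<in>{1..DIM('e)}. smooth_on S (f i)) \<and>
     (\<forall>z\<in>S. orthonormal_upto DIM('e) (H z) (\<lambda>i. f i z))"
proof -
  have "m \<le> DIM('e) \<Longrightarrow> \<exists>S f. open S \<and> p \<in> S \<and> S \<subseteq> W \<and> (\<forall>i\<in>{1..k}. f i = e i) \<and> (\<forall>i\<in>{1..m}. smooth_on S (f i)) \<and>
     (\<forall>z\<in>S. orthonormal_upto m (H z) (\<lambda>i. f i z))" if "k \<le> m" for m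
    using that
  proof (induction m rule: dec_induct)
    case base
    then show ?case using assms by blast
  next
    case (step m)
    then obtain S f where S: "open S" "p \<in> S" "S \<subseteq> W" and f: "\<forall>i\<in>{1..k}. f i = e i"
      "\<forall>i\<in>{1..m}. smooth_on S (f i)" "\<forall>z\<in>S. orthonormal_upto m (H z) (\<lambda>i. f i z)"
      by auto
    have iff: "inner_form (H z)" if "z \<in> S" for z using assms(3) S that by blast
    have sm: "smooth_on S (\<lambda>z. H z u v)" for u v using smooth_on_subset[OF assms(4) S(3)] .
    obtain S' h where S': "open S'" "p \<in> S'" "S' \<subseteq> S" and h: "smooth_on S' h"
      "\<And>z. z \<in> S' \<Longrightarrow> H z (h z) (h z) = 1" "\<And>z i. z \<in> S' \<Longrightarrow> i \<in> {1..m} \<Longrightarrow> H z (f i z) (h z) = 0"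
      using smooth_orthonormal_step[OF S(1,2) iff sm, of m f] f step.prems by auto
    define f' where "f' = f(Suc m := h)"
    have "\<forall>i\<in>{1..k}. f' i = e i" using f(1) step.hyps by (auto simp: f'_def)
    moreover have "smooth_on S' (f' i)" if "i \<in> {1..Suc m}" for i
    proof (cases "i = Suc m")
      case False
      then have "smooth_on S (f i)" using f(2) that by simp
      then show ?thesis using smooth_on_subset[OF _ S'(3)] False by (simp add: f'_def)
    qed (simp add: f'_def h(1))
    moreover have "orthonormal_upto (Suc m) (H z) (\<lambda>i. f' i z)" if z: "z \<in> S'" for z
    proof -
      have o: "orthonormal_upto m (H z) (\<lambda>i. f i z)" using f(3) z S'(3) by blast
      have s: "H z (h z) (f i z) = H z (f i z) (h z)" for i
        using inner_formD(4)[OF iff] z S'(3) by blast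
      show ?thesis unfolding orthonormal_upto_def
        using o h(2,3)[OF z] s
        by (auto simp: f'_def le_Suc_eq orthonormal_upto_def)
    qed
    ultimately show ?case using S' S(3) by (intro exI[of _ S'] exI[of _ f']) auto
  qed
  from this[OF assms(5)] show ?thesis by simp
qed

section \<open>Riemannian metrics in coordinates\<close>

definition koszul :: "('e::euclidean_space \<Rightarrow> 'e \<Rightarrow> 'e \<Rightarrow> real) \<Rightarrow> 'e \<Rightarrow> 'e \<Rightarrow> 'e \<Rightarrow> 'e \<Rightarrow> real" where
  "koszul G y u v z = dd (\<lambda>y'. G y' v z) y u + dd (\<lambda>y'. G y' u z) y v - dd (\<lambda>y'. G y' u v) y z"

text \<open>\<open>chr\<close> and \<open>curv\<close> are the Christoffel symbols and the curvature of a metric given by its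
Gram matrices \<open>G y\<close> at the points \<open>y\<close> of an open set of \<open>'e\<close>.\<close>

definition chr :: "('e::euclidean_space \<Rightarrow> 'e \<Rightarrow> 'e \<Rightarrow> real) \<Rightarrow> 'e \<Rightarrow> 'e \<Rightarrow> 'e \<Rightarrow> 'e" where
  "chr G y u v = (THE w. \<forall>z. 2 * G y w z = koszul G y u v z)"

definition curv :: "('e::euclidean_space \<Rightarrow> 'e \<Rightarrow> 'e \<Rightarrow> real) \<Rightarrow> 'e \<Rightarrow> 'e \<Rightarrow> 'e \<Rightarrow> 'e \<Rightarrow> 'e" where
  "curv G y X Y Z = dd (\<lambda>y'. chr G y' Y Z) y X - dd (\<lambda>y'. chr G y' X Z) y Y
     + chr G y X (chr G y Y Z) - chr G y Y (chr G y X Z)"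

locale metric_field =
  fixes U :: "'e::euclidean_space set" and G :: "'e \<Rightarrow> 'e \<Rightarrow> 'e \<Rightarrow> real"
  assumes openU: "open U"
    and innerG: "y \<in> U \<Longrightarrow> inner_form (G y)"
    and smoothG: "smooth_on U (\<lambda>y. G y u v)"
begin

lemmas G_linear = inner_formD(2,3)[OF innerG]
lemmas G_sym = inner_formD(4)[OF innerG]
lemmas G_pos = inner_formD(5)[OF innerG]
lemmas G_bil = inner_formD(1)[OF innerG]

lemma G_add: "y \<in> U \<Longrightarrow> G y (a + b) v = G y a v + G y b v" "y \<in> U \<Longrightarrow> G y v (a + b) = G y v a + G y v b"
  using linear_add[OF G_linear(1)] linear_add[OF G_linear(2)] by blast+
lemma G_diff: "y \<in> U \<Longrightarrow> G y (a - b) v = G y a v - G y b v" "y \<in> U \<Longrightarrow> G y v (a - b) = G y v a - G y v b"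
  using linear_diff[OF G_linear(1)] linear_diff[OF G_linear(2)] by blast+
lemma G_neg: "y \<in> U \<Longrightarrow> G y (- a) v = - G y a v" "y \<in> U \<Longrightarrow> G y v (- a) = - G y v a"
  using linear_neg[OF G_linear(1)] linear_neg[OF G_linear(2)] by blast+
lemma G_scale: "y \<in> U \<Longrightarrow> G y (c *\<^sub>R a) v = c * G y a v" "y \<in> U \<Longrightarrow> G y v (c *\<^sub>R a) = c * G y v a"
  using linear_scale[OF G_linear(1)] linear_scale[OF G_linear(2)] by (metis real_scaleR_def)+
lemma G_zero: "y \<in> U \<Longrightarrow> G y 0 v = 0" "y \<in> U \<Longrightarrow> G y v 0 = 0"
  using linear_0[OF G_linear(1)] linear_0[OF G_linear(2)] by blast+
lemma G_sum: "y \<in> U \<Longrightarrow> G y (\<Sum>i\<in>I. f i) v = (\<Sum>i\<in>I. G y (f i) v)"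
  using linear_sum[OF G_linear(2)] by blast

lemmas G_simps = G_add G_diff G_neg G_scale G_zero

abbreviation dG :: "'e \<Rightarrow> 'e \<Rightarrow> 'e \<Rightarrow> 'e \<Rightarrow> real" where
  "dG y u v z \<equiv> dd (\<lambda>y'. G y' v z) y u"

lemma dG_sym: "y \<in> U \<Longrightarrow> dG y u v z = dG y u z v"
  by (rule fun_cong[OF dd_cong_open[OF openU]]) (auto simp: G_sym)

lemma G_diffble: "y \<in> U \<Longrightarrow> (\<lambda>y'. G y' u v) differentiable (at y)"
  using smooth_on_differentiable[OF smoothG] .

lemma dG_linear:
  assumes y: "y \<in> U"
  shows "linear (\<lambda>u. dG y u v z)" "linear (\<lambda>v. dG y u v z)" "linear (\<lambda>z. dG y u v z)"
proof -
  show "linear (\<lambda>u. dG y u v z)" using smooth_on_linear_dd[OF smoothG y] .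
  show l: "linear (\<lambda>v. dG y u v z)" for z
  proof (rule linearI)
    fix a b
    have "((\<lambda>y'. G y' a z + G y' b z) has_derivative (\<lambda>u. dG y u a z + dG y u b z)) (at y)"
      using dd_works[OF G_diffble[OF y]] by (intro derivative_intros)
    then have "((\<lambda>y'. G y' (a + b) z) has_derivative (\<lambda>u. dG y u a z + dG y u b z)) (at y)"
      by (subst has_derivative_cong_open[OF openU y]) (auto simp: G_simps)
    from dd_eqI[OF this] show "dG y u (a + b) z = dG y u a z + dG y u b z" by simp
  next
    fix c a
    have "((\<lambda>y'. c * G y' a z) has_derivative (\<lambda>u. c * dG y u a z)) (at y)"
      using dd_works[OF G_diffble[OF y]] by (intro derivative_intros)
    then have "((\<lambda>y'. G y' (c *\<^sub>R a) z) has_derivative (\<lambda>u. c * dG y u a z)) (at y)"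
      by (subst has_derivative_cong_open[OF openU y]) (auto simp: G_simps)
    from dd_eqI[OF this] show "dG y u (c *\<^sub>R a) z = c *\<^sub>R dG y u a z" by simp
  qed
  have "(\<lambda>z. dG y u v z) = (\<lambda>z. dG y u z v)" using dG_sym[OF y] by blast
  then show "linear (\<lambda>z. dG y u v z)" using l[of v] by simp
qed

lemma local_frame:
  assumes "y0 \<in> U"
  obtains S e where "open S" "y0 \<in> S" "S \<subseteq> U" "\<And>i. i \<in> {1..DIM('e)} \<Longrightarrow> smooth_on S (e i)"
    "\<And>y. y \<in> S \<Longrightarrow> orthonormal_upto DIM('e) (G y) (\<lambda>i. e i y)"
proof -
  have "\<exists>S f. open S \<and> y0 \<in> S \<and> S \<subseteq> U \<and> (\<forall>i\<in>{1..0}. f i = (\<lambda>_. 0)) \<and> (\<forall>i\<in>{1..DIM('e)}. smooth_on S (f i)) \<and>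
     (\<forall>z\<in>S. orthonormal_upto DIM('e) (G z) (\<lambda>i. f i z))"
    by (rule smooth_orthonormal_extend[OF openU assms innerG smoothG]) (auto simp: orthonormal_upto_def)
  then show ?thesis using that by blast
qed

text \<open>In an orthonormal frame the vector that represents a linear functional is explicit; this gives existence
of the Christoffel symbols and their smooth dependence on the point.\<close>

lemma riesz:
  assumes y: "y \<in> U" and e: "orthonormal_upto DIM('e) (G y) e" and K: "linear K"
  shows "G y (\<Sum>i=1..DIM('e). K (e i) *\<^sub>R e i) z = K z"
proof -
  have "K z = K (\<Sum>i=1..DIM('e). G y (e i) z *\<^sub>R e i)"
    using orthonormal_expand[OF innerG[OF y] e, of z] by simp
  also have "\<dots> = (\<Sum>i=1..DIM('e). G y (e i) z * K (e i))"
    by (simp add: linear_sum[OF K] linear_scale[OF K])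
  finally show ?thesis by (simp add: G_sum y G_scale mult.commute)
qed

lemma koszul_linear:
  assumes "y \<in> U" shows "linear (koszul G y u v)"
  unfolding koszul_def
  by (intro linear_compose_add linear_compose_sub dG_linear assms)

lemma chr_eqI:
  assumes y: "y \<in> U" and "\<And>z. 2 * G y w z = koszul G y u v z"
  shows "chr G y u v = w"
  unfolding chr_def
proof (rule the_equality)
  show "\<forall>z. 2 * G y w z = koszul G y u v z" using assms(2) by blast
  show "w' = w" if "\<forall>z. 2 * G y w' z = koszul G y u v z" for w'
    by (rule inner_form_nondegenerate[OF innerG[OF y]]) (use that assms(2) in \<open>metis mult_left_cancel zero_neq_numeral\<close>)
qed

lemma chr_frame:
  assumes y: "y \<in> U" and e: "orthonormal_upto DIM('e) (G y) e"
  shows "chr G y u v = (\<Sum>i=1..DIM('e). (koszul G y u v (e i) / 2) *\<^sub>R e i)"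
proof (rule chr_eqI[OF y])
  have "linear (\<lambda>z. koszul G y u v z / 2)"
    using linear_compose[OF koszul_linear[OF y] linear_scaleR[of "1/2"]] by (simp add: o_def)
  from riesz[OF y e this, of z for z] show "2 * G y (\<Sum>i=1..DIM('e). (koszul G y u v (e i) / 2) *\<^sub>R e i) z = koszul G y u v z" for z
    by (metis (no_types, lifting) nonzero_mult_div_cancel_left times_divide_eq_right zero_neq_numeral)
qed

lemma chr_koszul: "y \<in> U \<Longrightarrow> 2 * G y (chr G y u v) z = koszul G y u v z"
proof -
  assume y: "y \<in> U"
  obtain S e where "y \<in> S" "\<And>y. y \<in> S \<Longrightarrow> orthonormal_upto DIM('e) (G y) (\<lambda>i. e i y)"
    using local_frame[OF y] by metis
  then have e: "orthonormal_upto DIM('e) (G y) (\<lambda>i. e i y)" by blast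
  have "linear (\<lambda>z. koszul G y u v z / 2)"
    using linear_compose[OF koszul_linear[OF y] linear_scaleR[of "1/2"]] by (simp add: o_def)
  from riesz[OF y e this, of z] show ?thesis by (simp add: chr_frame[OF y e])
qed

lemma chr_sym: "y \<in> U \<Longrightarrow> chr G y u v = chr G y v u"
proof (rule chr_eqI, assumption)
  fix z assume y: "y \<in> U"
  have "dG y z u v = dG y z v u" by (rule dG_sym[OF y])
  then show "2 * G y (chr G y v u) z = koszul G y u v z"
    by (simp add: chr_koszul[OF y] koszul_def)
qed

lemma chr_linear:
  assumes y: "y \<in> U" shows "linear (\<lambda>v. chr G y u v)" "linear (\<lambda>u. chr G y u v)"
proof -
  show l: "linear (\<lambda>v. chr G y u v)" for u
  proof (rule linearI)
    fix a b
    show "chr G y u (a + b) = chr G y u a + chr G y u b"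
      by (rule chr_eqI[OF y])
        (simp add: G_simps y distrib_left chr_koszul koszul_def linear_add[OF dG_linear(1)[OF y]]
          linear_add[OF dG_linear(2)[OF y]] linear_add[OF dG_linear(3)[OF y]])
    fix c
    show "chr G y u (c *\<^sub>R a) = c *\<^sub>R chr G y u a"
      using chr_koszul[OF y, of u a]
      by (intro chr_eqI[OF y])
        (simp add: G_simps y chr_koszul koszul_def linear_scale[OF dG_linear(1)[OF y]]
          linear_scale[OF dG_linear(2)[OF y]] linear_scale[OF dG_linear(3)[OF y]] algebra_simps)
  qed
  show "linear (\<lambda>u. chr G y u v)" proof -
    have "(\<lambda>u. chr G y u v) = chr G y v" using chr_sym[OF y] by blast
    then show ?thesis using l[of v] by simp
  qed
qed

lemma chr_bil: "y \<in> U \<Longrightarrow> bilinear (chr G y)"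
  unfolding bilinear_def using chr_linear by blast

lemma chr_smooth: "smooth_on U (\<lambda>y. chr G y u v)"
proof (rule smooth_on_local)
  fix y0 assume "y0 \<in> U"
  then obtain S e where S: "open S" "y0 \<in> S" "S \<subseteq> U" "\<And>i. i \<in> {1..DIM('e)} \<Longrightarrow> smooth_on S (e i)"
    "\<And>y. y \<in> S \<Longrightarrow> orthonormal_upto DIM('e) (G y) (\<lambda>i. e i y)" using local_frame by metis
  have k: "smooth_on S (\<lambda>y. koszul G y u v (k y))" if "smooth_on S k" for k
  proof (rule smooth_on_linear_param[OF S(1) _ _ that])
    show "linear (koszul G z u v)" if "z \<in> S" for z using koszul_linear that S(3) by blast
    show "smooth_on S (\<lambda>z. koszul G z u v b)" for b
      unfolding koszul_def
      by (intro smooth_on_diff smooth_on_add S(1) smooth_on_dd smooth_on_subset[OF smoothG S(3)])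
  qed
  have "smooth_on S (\<lambda>y. \<Sum>i=1..DIM('e). (koszul G y u v (e i y) * (1/2)) *\<^sub>R e i y)"
    by (intro smooth_on_sum smooth_on_scaleR smooth_on_mult smooth_on_const k S(1,4))
  moreover have "chr G y u v = (\<Sum>i=1..DIM('e). (koszul G y u v (e i y) * (1/2)) *\<^sub>R e i y)" if "y \<in> S" for y
    using chr_frame[OF _ S(5)[OF that]] that S(3) by auto
  ultimately have "smooth_on S (\<lambda>y. chr G y u v)"
    by (subst smooth_on_cong[OF S(1)]) auto
  then show "\<exists>T. open T \<and> y0 \<in> T \<and> smooth_on T (\<lambda>y. chr G y u v)" using S by blast
qed

lemma chr_add: "y \<in> U \<Longrightarrow> chr G y (a + b) v = chr G y a v + chr G y b v" "y \<in> U \<Longrightarrow> chr G y v (a + b) = chr G y v a + chr G y v b"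
  using linear_add[OF chr_linear(1)] linear_add[OF chr_linear(2)] by blast+
lemma chr_diff: "y \<in> U \<Longrightarrow> chr G y (a - b) v = chr G y a v - chr G y b v" "y \<in> U \<Longrightarrow> chr G y v (a - b) = chr G y v a - chr G y v b"
  using linear_diff[OF chr_linear(1)] linear_diff[OF chr_linear(2)] by blast+
lemma chr_neg: "y \<in> U \<Longrightarrow> chr G y (- a) v = - chr G y a v" "y \<in> U \<Longrightarrow> chr G y v (- a) = - chr G y v a"
  using linear_neg[OF chr_linear(1)] linear_neg[OF chr_linear(2)] by blast+
lemma chr_scale: "y \<in> U \<Longrightarrow> chr G y (c *\<^sub>R a) v = c *\<^sub>R chr G y a v" "y \<in> U \<Longrightarrow> chr G y v (c *\<^sub>R a) = c *\<^sub>R chr G y v a"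
  using linear_scale[OF chr_linear(1)] linear_scale[OF chr_linear(2)] by blast+
lemma chr_zero: "y \<in> U \<Longrightarrow> chr G y 0 v = 0" "y \<in> U \<Longrightarrow> chr G y v 0 = 0"
  using linear_0[OF chr_linear(1)] linear_0[OF chr_linear(2)] by blast+
lemmas chr_simps = chr_add chr_diff chr_neg chr_scale chr_zero

lemma chr_diffble: "y \<in> U \<Longrightarrow> (\<lambda>y'. chr G y' u v) differentiable (at y)"
  using smooth_on_differentiable[OF chr_smooth] .

text \<open>In the sum of Koszul's formula for \<open>(u, v, z)\<close> and for \<open>(u, z, v)\<close> the other derivatives cancel.\<close>

lemma metric_compatible:
  assumes y: "y \<in> U"
  shows "dG y u v z = G y (chr G y u v) z + G y v (chr G y u z)"
proof -
  have "dG y v u z = dG y v z u" "dG y z u v = dG y z v u" "dG y u v z = dG y u z v"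
    by (rule dG_sym[OF y])+
  then show ?thesis
    using chr_koszul[OF y, of u v z] chr_koszul[OF y, of u z v] G_sym[OF y, of v "chr G y u z"]
    unfolding koszul_def by argo
qed

abbreviation dchr :: "'e \<Rightarrow> 'e \<Rightarrow> 'e \<Rightarrow> 'e \<Rightarrow> 'e" where
  "dchr y w u v \<equiv> dd (\<lambda>y'. chr G y' u v) y w"

lemma dchr_linear:
  assumes y: "y \<in> U"
  shows "linear (\<lambda>w. dchr y w u v)" "linear (\<lambda>u. dchr y w u v)" "linear (\<lambda>v. dchr y w u v)"
proof -
  show "linear (\<lambda>w. dchr y w u v)" using smooth_on_linear_dd[OF chr_smooth y] .
  show l: "linear (\<lambda>u. dchr y w u v)" for v
  proof (rule linearI)
    fix a b
    have "((\<lambda>y'. chr G y' a v + chr G y' b v) has_derivative (\<lambda>w. dchr y w a v + dchr y w b v)) (at y)"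
      using dd_works[OF chr_diffble[OF y]] by (intro derivative_intros)
    then have "((\<lambda>y'. chr G y' (a + b) v) has_derivative (\<lambda>w. dchr y w a v + dchr y w b v)) (at y)"
      by (subst has_derivative_cong_open[OF openU y]) (auto simp: chr_simps)
    from dd_eqI[OF this] show "dchr y w (a + b) v = dchr y w a v + dchr y w b v" by simp
  next
    fix c a
    have "((\<lambda>y'. c *\<^sub>R chr G y' a v) has_derivative (\<lambda>w. c *\<^sub>R dchr y w a v)) (at y)"
      using dd_works[OF chr_diffble[OF y]] by (intro derivative_intros)
    then have "((\<lambda>y'. chr G y' (c *\<^sub>R a) v) has_derivative (\<lambda>w. c *\<^sub>R dchr y w a v)) (at y)"
      by (subst has_derivative_cong_open[OF openU y]) (auto simp: chr_simps)
    from dd_eqI[OF this] show "dchr y w (c *\<^sub>R a) v = c *\<^sub>R dchr y w a v" by simp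
  qed
  have "dd (\<lambda>y'. chr G y' u v) y = dd (\<lambda>y'. chr G y' v u) y" for u v
    by (rule dd_cong_open[OF openU y]) (rule chr_sym)
  then show "linear (\<lambda>v. dchr y w u v)" using l[of u] by presburger
qed

lemma curv_linear:
  assumes y: "y \<in> U"
  shows "linear (\<lambda>X. curv G y X Y Z)" "linear (\<lambda>Y. curv G y X Y Z)" "linear (\<lambda>Z. curv G y X Y Z)"
  unfolding curv_def
  by (rule linearI; simp add: linear_add[OF dchr_linear(1)[OF y]] linear_add[OF dchr_linear(2)[OF y]]
      linear_add[OF dchr_linear(3)[OF y]] linear_scale[OF dchr_linear(1)[OF y]] linear_scale[OF dchr_linear(2)[OF y]]
      linear_scale[OF dchr_linear(3)[OF y]] chr_simps y algebra_simps)+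

lemma curv_antisym: "curv G y X Y Z = - curv G y Y X Z"
  unfolding curv_def by simp

text \<open>Differentiate \<open>dG y Y Z Z = 2 * G y (chr G y Y Z) Z\<close> in the direction \<open>X\<close>.  The left-hand side
becomes a second derivative, symmetric in \<open>X\<close> and \<open>Y\<close>; the antisymmetric part of the right-hand side is
the curvature term.\<close>

lemma curv_skew_diag:
  assumes y: "y \<in> U"
  shows "G y (curv G y X Y Z) Z = 0"
proof -
  have *: "dd (\<lambda>y'. dG y' Y Z Z) y X = 2 * (G y (chr G y X (chr G y Y Z)) Z + G y (chr G y Y Z) (chr G y X Z)
      + G y (dchr y X Y Z) Z)" for X Y
  proof -
    have "((\<lambda>y'. 2 * G y' (chr G y' Y Z) Z) has_derivative
       (\<lambda>d. 2 * (dG y d (chr G y Y Z) Z + G y (dchr y d Y Z) Z + G y (chr G y Y Z) 0))) (at y)"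
      by (intro has_derivative_mult_right has_derivative_bilinear_comp[OF openU])
        (auto intro!: y G_bil G_diffble dd_works chr_diffble)
    moreover have "dG y' Y Z Z = 2 * G y' (chr G y' Y Z) Z" if "y' \<in> U" for y'
      using metric_compatible[OF that, of Z Z Y] G_sym[OF that, of Z] by simp
    ultimately have "((\<lambda>y'. dG y' Y Z Z) has_derivative
       (\<lambda>d. 2 * (dG y d (chr G y Y Z) Z + G y (dchr y d Y Z) Z + G y (chr G y Y Z) 0))) (at y)"
      using has_derivative_cong_open[OF openU y, of "\<lambda>y'. dG y' Y Z Z"] by simp
    from dd_eqI[OF this] show ?thesis
      using metric_compatible[OF y, of "chr G y Y Z" Z X] by (simp add: G_simps y)
  qed
  have "dd (\<lambda>y'. dG y' Y Z Z) y X = dd (\<lambda>y'. dG y' X Z Z) y Y"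
    by (rule second_derivative_sym_real[OF openU smoothG y])
  then show ?thesis
    unfolding curv_def using *[of Y X] *[of X Y] G_sym[OF y, of "chr G y Y Z" "chr G y X Z"]
    by (simp add: G_simps y)
qed

lemma curv_skew:
  assumes y: "y \<in> U"
  shows "G y (curv G y X Y Z) W = - G y (curv G y X Y W) Z"
proof -
  have "G y (curv G y X Y (Z + W)) (Z + W) = 0" using curv_skew_diag[OF y] .
  then show ?thesis
    using curv_skew_diag[OF y, of X Y Z] curv_skew_diag[OF y, of X Y W]
    by (simp add: linear_add[OF curv_linear(3)[OF y]] G_simps y)
qed

end

section \<open>Pulling back a metric up to a constant factor\<close>

text \<open>Changes of charts are the case \<open>\<mu> = 1\<close>; coordinate expressions of homotheties are the general case.\<close>

locale scaled_pullback = M1: metric_field U G + M2: metric_field U' G'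
  for U :: "'e::euclidean_space set" and G and U' :: "'e set" and G' +
  fixes \<tau> :: "'e \<Rightarrow> 'e" and \<mu> :: real
  assumes mu: "\<mu> > 0"
    and maps: "y \<in> U \<Longrightarrow> \<tau> y \<in> U'"
    and smooth: "smooth_on U \<tau>"
    and pull: "y \<in> U \<Longrightarrow> G' (\<tau> y) (dd \<tau> y u) (dd \<tau> y v) = \<mu> * G y u v"
begin

abbreviation T :: "'e \<Rightarrow> 'e \<Rightarrow> 'e" where "T \<equiv> dd \<tau>"
abbreviation T2 :: "'e \<Rightarrow> 'e \<Rightarrow> 'e \<Rightarrow> 'e" where "T2 y u v \<equiv> dd (\<lambda>y'. dd \<tau> y' v) y u"

lemma T_linear: "y \<in> U \<Longrightarrow> linear (T y)"
  using smooth_on_linear_dd[OF smooth] .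

lemma T2_sym: "y \<in> U \<Longrightarrow> T2 y u v = T2 y v u"
  by (rule second_derivative_sym[OF M1.openU smooth])

text \<open>\<open>T y\<close> multiplies lengths by a positive constant, so it is injective.\<close>

lemma T_surj:
  assumes y: "y \<in> U" shows "surj (T y)"
proof -
  have "inj (T y)"
    unfolding linear_injective_0[OF T_linear[OF y]]
  proof (intro allI impI)
    fix v assume "T y v = 0"
    then have "G y v v = 0" using pull[OF y, of v v] mu M2.G_zero[OF maps[OF y]] by simp
    then show "v = 0" using inner_formD(6)[OF M1.innerG[OF y]] by simp
  qed
  then show ?thesis using linear_injective_imp_surjective[OF T_linear[OF y]] by blast
qed

lemma T_deriv: "y \<in> U \<Longrightarrow> ((\<lambda>y'. T y' v) has_derivative (\<lambda>u. T2 y u v)) (at y)"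
  using smooth_on_has_derivative[OF smooth_on_dd[OF smooth]] .

lemma dG_transform:
  assumes y: "y \<in> U"
  shows "\<mu> * M1.dG y u v z = M2.dG (\<tau> y) (T y u) (T y v) (T y z)
      + G' (\<tau> y) (T2 y u v) (T y z) + G' (\<tau> y) (T y v) (T2 y u z)"
proof -
  have "((\<lambda>y. G' (\<tau> y) (T y v) (T y z)) has_derivative (\<lambda>u. M2.dG (\<tau> y) (T y u) (T y v) (T y z)
      + G' (\<tau> y) (T2 y u v) (T y z) + G' (\<tau> y) (T y v) (T2 y u z))) (at y)"
    using maps[OF y] by (intro has_derivative_bilinear_comp[OF M2.openU] T_deriv y
      smooth_on_has_derivative[OF smooth] M2.G_bil M2.G_diffble)
  then have 1: "((\<lambda>y. \<mu> * G y v z) has_derivative (\<lambda>u. M2.dG (\<tau> y) (T y u) (T y v) (T y z)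
      + G' (\<tau> y) (T2 y u v) (T y z) + G' (\<tau> y) (T y v) (T2 y u z))) (at y)"
    using has_derivative_cong_open[OF M1.openU y, of "\<lambda>y. G' (\<tau> y) (T y v) (T y z)" "\<lambda>y. \<mu> * G y v z"] pull by simp
  have "((\<lambda>y. \<mu> * G y v z) has_derivative (\<lambda>u. \<mu> * M1.dG y u v z)) (at y)"
    by (intro has_derivative_mult_right dd_works M1.G_diffble y)
  from fun_cong[OF has_derivative_unique[OF this 1], of u] show ?thesis .
qed

text \<open>In Koszul's formula for the pulled back metric the terms with second derivatives of \<open>\<tau>\<close> add up to
\<open>2 * G' (\<tau> y) (T2 y u v) (T y z)\<close>, by symmetry of \<open>T2\<close>.  Surjectivity of \<open>T y\<close> makes the arguments
\<open>T y z\<close> sufficient to determine the Christoffel symbols of \<open>G'\<close>.\<close>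

lemma chr_transform:
  assumes y: "y \<in> U"
  shows "T y (chr G y u v) = chr G' (\<tau> y) (T y u) (T y v) + T2 y u v"
proof -
  have "chr G' (\<tau> y) (T y u) (T y v) = T y (chr G y u v) - T2 y u v"
  proof (rule M2.chr_eqI[OF maps[OF y]])
    fix z'
    obtain z where z: "z' = T y z" using T_surj[OF y] by (metis surjD)
    have "2 * G' (\<tau> y) (T y (chr G y u v)) (T y z) = \<mu> * koszul G y u v z"
      using M1.chr_koszul[OF y, of u v z] pull[OF y, of "chr G y u v" z] by (simp add: ac_simps)
    then show "2 * G' (\<tau> y) (T y (chr G y u v) - T2 y u v) z' = koszul G' (\<tau> y) (T y u) (T y v) z'"
      unfolding z koszul_def
      using dG_transform[OF y, of v z u] dG_transform[OF y, of u z v] dG_transform[OF y, of u v z]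
        T2_sym[OF y, of v u] T2_sym[OF y, of z u] T2_sym[OF y, of z v]
        M2.G_sym[OF maps[OF y], of "T2 y u z" "T y v"]
      by (simp add: M2.G_simps maps y algebra_simps)
  qed
  then show ?thesis by simp
qed

lemma dchr_transform:
  assumes y: "y \<in> U"
  shows "T y (M1.dchr y w u v) + T2 y w (chr G y u v) =
     M2.dchr (\<tau> y) (T y w) (T y u) (T y v) + chr G' (\<tau> y) (T2 y w u) (T y v) + chr G' (\<tau> y) (T y u) (T2 y w v)
     + dd (\<lambda>y'. T2 y' u v) y w"
proof -
  have 1: "((\<lambda>y. T y (chr G y u v)) has_derivative (\<lambda>w. T2 y w (chr G y u v) + T y (M1.dchr y w u v))) (at y)"
    by (rule has_derivative_linear_param[OF M1.openU y T_linear T_deriv dd_works[OF M1.chr_diffble[OF y]]]) (auto simp: y)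
  have "((\<lambda>y. chr G' (\<tau> y) (T y u) (T y v) + T2 y u v) has_derivative (\<lambda>w.
     M2.dchr (\<tau> y) (T y w) (T y u) (T y v) + chr G' (\<tau> y) (T2 y w u) (T y v) + chr G' (\<tau> y) (T y u) (T2 y w v)
     + dd (\<lambda>y'. T2 y' u v) y w)) (at y)"
    using maps[OF y] by (intro has_derivative_add has_derivative_bilinear_comp[OF M2.openU] T_deriv y
      smooth_on_has_derivative[OF smooth] M2.chr_bil M2.chr_diffble
      smooth_on_has_derivative[OF smooth_on_dd[OF smooth_on_dd[OF smooth]]])
  then have "((\<lambda>y. T y (chr G y u v)) has_derivative (\<lambda>w.
     M2.dchr (\<tau> y) (T y w) (T y u) (T y v) + chr G' (\<tau> y) (T2 y w u) (T y v) + chr G' (\<tau> y) (T y u) (T2 y w v)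
     + dd (\<lambda>y'. T2 y' u v) y w)) (at y)"
    using has_derivative_cong_open[OF M1.openU y, of "\<lambda>y. T y (chr G y u v)"] chr_transform by simp
  from fun_cong[OF has_derivative_unique[OF this 1], of w] show ?thesis
    by (simp only: add.commute[of "T y (M1.dchr y w u v)"])
qed

text \<open>Differentiating \<open>chr_transform\<close> once more and antisymmetrising, the terms with \<open>T2\<close> cancel in pairs,
and the third derivative of \<open>\<tau>\<close> disappears by symmetry.\<close>

lemma curv_transform:
  assumes y: "y \<in> U"
  shows "T y (curv G y X Y Z) = curv G' (\<tau> y) (T y X) (T y Y) (T y Z)"
proof -
  have s: "dd (\<lambda>y'. T2 y' X Z) y Y = dd (\<lambda>y'. T2 y' Y Z) y X"
    by (rule second_derivative_sym[OF M1.openU smooth_on_dd[OF smooth] y])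
  note da = M2.chr_add(2)[OF maps[OF y]]
  have t1: "T y (M1.dchr y X Y Z) = M2.dchr (\<tau> y) (T y X) (T y Y) (T y Z) + chr G' (\<tau> y) (T2 y X Y) (T y Z)
     + chr G' (\<tau> y) (T y Y) (T2 y X Z) + dd (\<lambda>y'. T2 y' Y Z) y X - T2 y X (chr G y Y Z)"
    using dchr_transform[OF y, of Y Z X] by (simp only: eq_diff_eq)
  have t2: "T y (M1.dchr y Y X Z) = M2.dchr (\<tau> y) (T y Y) (T y X) (T y Z) + chr G' (\<tau> y) (T2 y X Y) (T y Z)
     + chr G' (\<tau> y) (T y X) (T2 y Y Z) + dd (\<lambda>y'. T2 y' Y Z) y X - T2 y Y (chr G y X Z)"
    using dchr_transform[OF y, of X Z Y] T2_sym[OF y, of X Y] s by (simp only: eq_diff_eq)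
  have t3: "T y (chr G y X (chr G y Y Z)) = chr G' (\<tau> y) (T y X) (chr G' (\<tau> y) (T y Y) (T y Z))
     + chr G' (\<tau> y) (T y X) (T2 y Y Z) + T2 y X (chr G y Y Z)" for X Y
    by (simp only: chr_transform[OF y] da)
  have "T y (curv G y X Y Z) = T y (M1.dchr y X Y Z) - T y (M1.dchr y Y X Z) + T y (chr G y X (chr G y Y Z)) - T y (chr G y Y (chr G y X Z))"
    unfolding curv_def by (simp only: linear_add[OF T_linear[OF y]] linear_diff[OF T_linear[OF y]])
  also have "\<dots> = curv G' (\<tau> y) (T y X) (T y Y) (T y Z)"
    unfolding t1 t2 t3 curv_def by (simp add: algebra_simps)
  finally show ?thesis .
qed

end

section \<open>Derivations on a smooth retract\<close>

text \<open>\<open>P\<close> is the part of a submanifold that lies in one chart, with coordinates \<open>\<kappa>\<close>.  The map \<open>\<pi>\<close> inverts \<open>\<kappa>\<close> and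
is defined on a neighbourhood \<open>W\<close> of the coordinate image, so that \<open>\<kappa> \<circ> \<pi>\<close> retracts \<open>W\<close> onto this image.
A function \<open>F\<close> on \<open>P\<close> then has the canonical extension \<open>F \<circ> \<pi>\<close> to \<open>W\<close>.\<close>

locale retract =
  fixes P :: "'p set" and \<kappa> :: "'p \<Rightarrow> 'z::euclidean_space" and \<pi> :: "'z \<Rightarrow> 'p" and W :: "'z set"
  assumes openW: "open W"
    and pi_in: "z \<in> W \<Longrightarrow> \<pi> z \<in> P"
    and kappa_pi_in: "z \<in> W \<Longrightarrow> \<kappa> (\<pi> z) \<in> W"
    and kappa_in: "q \<in> P \<Longrightarrow> \<kappa> q \<in> W"
    and pi_kappa: "q \<in> P \<Longrightarrow> \<pi> (\<kappa> q) = q"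
    and smooth_rho: "smooth_on W (\<lambda>z. \<kappa> (\<pi> z))"
begin

abbreviation "\<rho> \<equiv> \<lambda>z. \<kappa> (\<pi> z)"

definition smooth_at :: "'p \<Rightarrow> ('p \<Rightarrow> 'b::real_normed_vector) \<Rightarrow> bool" where
  "smooth_at q F \<longleftrightarrow> (\<exists>S. open S \<and> \<kappa> q \<in> S \<and> S \<subseteq> W \<and> smooth_on S (\<lambda>z. F (\<pi> z)))"

text \<open>Tangent vectors of the coordinate image are the vectors fixed by the derivative of \<open>\<rho>\<close>.\<close>

definition represents :: "'z set \<Rightarrow> (('p \<Rightarrow> real) \<Rightarrow> 'p \<Rightarrow> real) \<Rightarrow> ('z \<Rightarrow> 'z) \<Rightarrow> bool" where
  "represents S X \<xi> \<longleftrightarrow> open S \<and> S \<subseteq> W \<and> smooth_on S \<xi> \<and>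
     (\<forall>q\<in>P. \<kappa> q \<in> S \<longrightarrow> dd \<rho> (\<kappa> q) (\<xi> (\<kappa> q)) = \<xi> (\<kappa> q) \<and>
        (\<forall>F. smooth_at q F \<longrightarrow> X F q = dd (\<lambda>z. F (\<pi> z)) (\<kappa> q) (\<xi> (\<kappa> q))))"

lemma rho_fix: "q \<in> P \<Longrightarrow> \<rho> (\<kappa> q) = \<kappa> q"
  using pi_kappa by simp

lemma open_rho_vimage:
  assumes "open S" "S \<subseteq> W"
  shows "open {w \<in> S. \<rho> w \<in> S}"
proof -
  have "open (S \<inter> \<rho> -` S)"
    using continuous_open_preimage[OF smooth_on_continuous[OF smooth_on_subset[OF smooth_rho assms(2)]] assms(1,1)] .
  moreover have "S \<inter> \<rho> -` S = {w \<in> S. \<rho> w \<in> S}" by auto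
  ultimately show ?thesis by simp
qed

lemma represents_apply_pi:
  assumes "represents S X \<xi>" "open S1" "S1 \<subseteq> W" "smooth_on S1 (\<lambda>z. F (\<pi> z))" "w \<in> W" "\<rho> w \<in> S" "\<rho> w \<in> S1"
  shows "X F (\<pi> w) = dd (\<lambda>z. F (\<pi> z)) (\<rho> w) (\<xi> (\<rho> w))"
proof -
  have "smooth_at (\<pi> w) F" unfolding smooth_at_def using assms by blast
  then show ?thesis using assms pi_in[OF assms(5)] unfolding represents_def by blast
qed

lemma represents_smooth_ext:
  assumes "represents S X \<xi>" "q \<in> P" "\<kappa> q \<in> S" "smooth_at q F"
  obtains T where "open T" "\<kappa> q \<in> T" "T \<subseteq> S" "smooth_on T (\<lambda>z. F (\<pi> z))"
    "smooth_on T (\<lambda>w. dd (\<lambda>z. F (\<pi> z)) w (\<xi> w))"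
    "\<forall>w\<in>T. \<rho> w \<in> T \<longrightarrow> X F (\<pi> w) = dd (\<lambda>z. F (\<pi> z)) (\<rho> w) (\<xi> (\<rho> w))"
proof -
  have S: "open S" "S \<subseteq> W" "smooth_on S \<xi>" using assms(1) unfolding represents_def by auto
  obtain S1 where S1: "open S1" "\<kappa> q \<in> S1" "S1 \<subseteq> W" "smooth_on S1 (\<lambda>z. F (\<pi> z))"
    using assms(4) unfolding smooth_at_def by blast
  define T where "T = S \<inter> S1"
  have T: "open T" "\<kappa> q \<in> T" "T \<subseteq> S" "T \<subseteq> S1" "T \<subseteq> W" using S S1 assms(3) by (auto simp: T_def)
  have sF: "smooth_on T (\<lambda>z. F (\<pi> z))" using smooth_on_subset[OF S1(4) T(4)] .
  have "smooth_on T (\<lambda>w. dd (\<lambda>z. F (\<pi> z)) w (\<xi> w))"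
    by (rule smooth_on_dd_apply[OF T(1,1) sF smooth_on_ident _ smooth_on_subset[OF S(3) T(3)]])
  moreover have "X F (\<pi> w) = dd (\<lambda>z. F (\<pi> z)) (\<rho> w) (\<xi> (\<rho> w))" if "w \<in> T" "\<rho> w \<in> T" for w
    by (rule represents_apply_pi[OF assms(1) S1(1,3,4)]) (use that T in auto)
  ultimately show ?thesis using that T sF by blast
qed

lemma represents_smooth:
  assumes "represents S X \<xi>" "q \<in> P" "\<kappa> q \<in> S" "smooth_at q F"
  shows "smooth_at q (X F)"
proof -
  obtain T where T: "open T" "\<kappa> q \<in> T" "T \<subseteq> S"
    "smooth_on T (\<lambda>w. dd (\<lambda>z. F (\<pi> z)) w (\<xi> w))"
    "\<forall>w\<in>T. \<rho> w \<in> T \<longrightarrow> X F (\<pi> w) = dd (\<lambda>z. F (\<pi> z)) (\<rho> w) (\<xi> (\<rho> w))"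
    by (rule represents_smooth_ext[OF assms])
  have TW: "T \<subseteq> W" using T(3) assms(1) unfolding represents_def by blast
  define T' where "T' = {w \<in> T. \<rho> w \<in> T}"
  have oT': "open T'" unfolding T'_def by (rule open_rho_vimage[OF T(1) TW])
  have "smooth_on T' (\<lambda>w. dd (\<lambda>z. F (\<pi> z)) (\<rho> w) (\<xi> (\<rho> w)))"
    by (rule smooth_on_compose[OF T(4) smooth_on_subset[OF smooth_rho] oT' T(1)])
      (use TW in \<open>auto simp: T'_def\<close>)
  then have "smooth_on T' (\<lambda>w. X F (\<pi> w))"
    using smooth_on_cong[OF oT', of "\<lambda>w. X F (\<pi> w)" "\<lambda>w. dd (\<lambda>z. F (\<pi> z)) (\<rho> w) (\<xi> (\<rho> w))"] T(5)
    by (auto simp: T'_def)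
  then show ?thesis unfolding smooth_at_def
    using oT' T(2) TW rho_fix[OF assms(2)] by (intro exI[of _ T']) (auto simp: T'_def)
qed

text \<open>The derivative of \<open>Y F\<close> along a tangent vector \<open>v\<close>: the retraction disappears because its derivative
fixes \<open>v\<close>.\<close>

lemma dd_along_rho:
  fixes f :: "'z \<Rightarrow> 'b::real_normed_vector"
  assumes "open T" "z \<in> T" "T \<subseteq> W" "\<rho> z = z" "dd \<rho> z v = v" "smooth_on T f" "smooth_on T \<eta>"
  shows "dd (\<lambda>w. dd f (\<rho> w) (\<eta> (\<rho> w))) z v = dd (\<lambda>w. dd f w (\<eta> z)) z v + dd f z (dd \<eta> z v)"
proof -
  have 1: "((\<lambda>w. dd f w (\<eta> w)) has_derivative (\<lambda>d. dd (\<lambda>w. dd f w (\<eta> z)) z d + dd f z (dd \<eta> z d))) (at z)"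
    by (rule has_derivative_linear_param[OF assms(1,2) smooth_on_linear_dd[OF assms(6)]
      smooth_on_has_derivative[OF smooth_on_dd[OF assms(6)] assms(2)] smooth_on_has_derivative[OF assms(7,2)]])
  have "z \<in> W" using assms(2,3) by blast
  have "dd (\<lambda>w. (\<lambda>w. dd f w (\<eta> w)) (\<rho> w)) z = (\<lambda>v. dd (\<lambda>w. dd f w (\<eta> w)) (\<rho> z) (dd \<rho> z v))"
    using 1 by (intro dd_compose smooth_on_differentiable[OF smooth_rho \<open>z \<in> W\<close>])
      (auto simp: assms(4) intro: differentiableI)
  then show ?thesis using dd_eqI[OF 1] assms(4,5) by simp
qed

text \<open>\<open>X (Y F)\<close> and \<open>Y (X F)\<close> contain the same second derivative of \<open>F\<close>, in the directions \<open>\<xi>\<close> and \<open>\<eta>\<close>.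
Tangency of the bracket is the same computation with \<open>\<rho>\<close> in place of \<open>F\<close>, because the derivative of \<open>\<rho>\<close>
fixes \<open>\<xi>\<close> and \<open>\<eta>\<close> at all points of the coordinate image.\<close>

lemma represents_bracket:
  assumes X: "represents S X \<xi>" and Y: "represents S Y \<eta>"
  shows "represents S (\<lambda>F p. X (Y F) p - Y (X F) p) (\<lambda>z. dd \<eta> z (\<xi> z) - dd \<xi> z (\<eta> z))"
  unfolding represents_def
proof (intro conjI ballI impI allI)
  have S: "open S" "S \<subseteq> W" "smooth_on S \<xi>" "smooth_on S \<eta>" using X Y unfolding represents_def by auto
  then show "open S" "S \<subseteq> W" by auto
  show "smooth_on S (\<lambda>z. dd \<eta> z (\<xi> z) - dd \<xi> z (\<eta> z))"
    using S by (intro smooth_on_diff smooth_on_dd_apply[OF S(1,1) _ smooth_on_ident])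
  fix q assume q: "q \<in> P" "\<kappa> q \<in> S"
  let ?z = "\<kappa> q"
  have zW: "?z \<in> W" using q S by blast
  have fx: "\<rho> ?z = ?z" using rho_fix q by blast
  have tan: "dd \<rho> ?z (\<xi> ?z) = \<xi> ?z" "dd \<rho> ?z (\<eta> ?z) = \<eta> ?z"
    using X Y q unfolding represents_def by auto
  have tang: "dd (\<lambda>w. dd \<rho> w (\<eta> ?z)) ?z (\<xi> ?z) + dd \<rho> ?z (dd \<eta> ?z (\<xi> ?z)) = dd \<eta> ?z (\<xi> ?z)"
    if R: "represents S X \<xi>" "represents S Y \<eta>" for X Y \<xi> \<eta>
  proof -
    have s: "smooth_on S \<eta>" using R unfolding represents_def by blast
    have t: "dd \<rho> ?z (\<xi> ?z) = \<xi> ?z" using R q unfolding represents_def by blast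
    define T where "T = {w \<in> S. \<rho> w \<in> S}"
    have oT: "open T" unfolding T_def by (rule open_rho_vimage[OF S(1,2)])
    have zT: "?z \<in> T" using q fx by (auto simp: T_def)
    have "dd \<rho> (\<rho> w) (\<eta> (\<rho> w)) = \<eta> (\<rho> w)" if "w \<in> T" for w
    proof -
      have "w \<in> W" "\<rho> w \<in> S" using that S by (auto simp: T_def)
      then show ?thesis using R(2) pi_in[of w] unfolding represents_def by blast
    qed
    then have "dd (\<lambda>w. dd \<rho> (\<rho> w) (\<eta> (\<rho> w))) ?z (\<xi> ?z) = dd (\<lambda>w. \<eta> (\<rho> w)) ?z (\<xi> ?z)"
      using dd_cong_open[OF oT zT, of "\<lambda>w. dd \<rho> (\<rho> w) (\<eta> (\<rho> w))" "\<lambda>w. \<eta> (\<rho> w)"] by simp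
    also have "\<dots> = dd \<eta> ?z (\<xi> ?z)"
      using dd_compose[of \<rho> ?z \<eta>] smooth_on_differentiable[OF smooth_rho zW] fx t
        smooth_on_differentiable[OF s q(2)] by simp
    finally show ?thesis
      using dd_along_rho[OF S(1) q(2) S(2) fx t smooth_on_subset[OF smooth_rho S(2)] s] by simp
  qed
  have "dd (\<lambda>w. dd \<rho> w (\<eta> ?z)) ?z (\<xi> ?z) = dd (\<lambda>w. dd \<rho> w (\<xi> ?z)) ?z (\<eta> ?z)"
    by (rule second_derivative_sym[OF openW smooth_rho zW])
  then have "dd \<rho> ?z (dd \<eta> ?z (\<xi> ?z)) - dd \<rho> ?z (dd \<xi> ?z (\<eta> ?z)) = dd \<eta> ?z (\<xi> ?z) - dd \<xi> ?z (\<eta> ?z)"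
    using arg_cong2[OF tang[OF X Y] tang[OF Y X], of "(-)"] by simp
  then show "dd \<rho> ?z (dd \<eta> ?z (\<xi> ?z) - dd \<xi> ?z (\<eta> ?z)) = dd \<eta> ?z (\<xi> ?z) - dd \<xi> ?z (\<eta> ?z)"
    by (simp only: linear_diff[OF smooth_on_linear_dd[OF smooth_rho zW]])
  fix F :: "'p \<Rightarrow> real" assume F: "smooth_at q F"
  let ?f = "\<lambda>z. F (\<pi> z)"
  have XY: "X (Y F) q = dd (\<lambda>w. dd ?f w (\<eta> ?z)) ?z (\<xi> ?z) + dd ?f ?z (dd \<eta> ?z (\<xi> ?z))"
    if R: "represents S X \<xi>" "represents S Y \<eta>" for X Y \<xi> \<eta>
  proof -
    have t: "dd \<rho> ?z (\<xi> ?z) = \<xi> ?z" using R q unfolding represents_def by blast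
    obtain T where T: "open T" "\<kappa> q \<in> T" "T \<subseteq> S" "smooth_on T ?f"
      "\<forall>w\<in>T. \<rho> w \<in> T \<longrightarrow> Y F (\<pi> w) = dd ?f (\<rho> w) (\<eta> (\<rho> w))"
      by (rule represents_smooth_ext[OF R(2) q F])
    have TW: "T \<subseteq> W" using T S by blast
    have oT: "open {w \<in> T. \<rho> w \<in> T}" by (rule open_rho_vimage[OF T(1) TW])
    have sE: "smooth_on T \<eta>" using R(2) smooth_on_subset[OF _ T(3)] unfolding represents_def by blast
    have "X (Y F) q = dd (\<lambda>w. Y F (\<pi> w)) ?z (\<xi> ?z)"
      using R(1) q represents_smooth[OF R(2) q F] unfolding represents_def by blast
    also have "\<dots> = dd (\<lambda>w. dd ?f (\<rho> w) (\<eta> (\<rho> w))) ?z (\<xi> ?z)"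
      using dd_cong_open[OF oT, of ?z "\<lambda>w. Y F (\<pi> w)" "\<lambda>w. dd ?f (\<rho> w) (\<eta> (\<rho> w))"] T(2,5) fx by simp
    also have "\<dots> = dd (\<lambda>w. dd ?f w (\<eta> ?z)) ?z (\<xi> ?z) + dd ?f ?z (dd \<eta> ?z (\<xi> ?z))"
      by (rule dd_along_rho[OF T(1,2) TW fx t T(4) sE])
    finally show ?thesis .
  qed
  obtain T where T: "open T" "?z \<in> T" "smooth_on T ?f" using F unfolding smooth_at_def by blast
  have "dd (\<lambda>w. dd ?f w (\<eta> ?z)) ?z (\<xi> ?z) = dd (\<lambda>w. dd ?f w (\<xi> ?z)) ?z (\<eta> ?z)"
    by (rule second_derivative_sym[OF T(1,3,2)])
  then show "X (Y F) q - Y (X F) q = dd ?f ?z (dd \<eta> ?z (\<xi> ?z) - dd \<xi> ?z (\<eta> ?z))"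
    using XY[OF X Y] XY[OF Y X] linear_diff[OF smooth_on_linear_dd[OF T(3,2)]] by simp
qed

lemma represents_cong:
  assumes "represents S X \<xi>" "\<And>z. z \<in> S \<Longrightarrow> \<xi> z = \<eta> z"
  shows "represents S X \<eta>"
  using assms smooth_on_cong[of S \<xi> \<eta>] unfolding represents_def by auto

lemma represents_tangent: "represents S X \<xi> \<Longrightarrow> q \<in> P \<Longrightarrow> \<kappa> q \<in> S \<Longrightarrow> dd \<rho> (\<kappa> q) (\<xi> (\<kappa> q)) = \<xi> (\<kappa> q)"
  unfolding represents_def by blast

lemma represents_apply: "represents S X \<xi> \<Longrightarrow> q \<in> P \<Longrightarrow> \<kappa> q \<in> S \<Longrightarrow> smooth_at q F \<Longrightarrow> X F q = dd (\<lambda>z. F (\<pi> z)) (\<kappa> q) (\<xi> (\<kappa> q))"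
  unfolding represents_def by blast

lemma smooth_at_coordinate:
  assumes "q \<in> P" shows "smooth_at q (\<lambda>p. \<kappa> p \<bullet> b)"
  unfolding smooth_at_def using openW kappa_in[OF assms] smooth_on_bounded_linear[OF bounded_linear_inner_left smooth_rho openW] by blast

lemma dd_coordinate:
  assumes "q \<in> P" shows "dd (\<lambda>z. \<kappa> (\<pi> z) \<bullet> b) (\<kappa> q) v = dd \<rho> (\<kappa> q) v \<bullet> b"
  using dd_eqI[OF has_derivative_inner_left[OF smooth_on_has_derivative[OF smooth_rho kappa_in[OF assms]]]] by simp

lemma curve_derivative:
  assumes "\<forall>\<^sub>F s in nhds t. \<gamma> s \<in> P" "((\<lambda>s. \<kappa> (\<gamma> s)) has_vector_derivative w) (at t)" "smooth_at (\<gamma> t) F"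
  shows "((\<lambda>s. F (\<gamma> s)) has_vector_derivative dd (\<lambda>z. F (\<pi> z)) (\<kappa> (\<gamma> t)) w) (at t)"
proof -
  obtain T where T: "open T" "t \<in> T" "\<And>s. s \<in> T \<Longrightarrow> \<gamma> s \<in> P"
    using assms(1) unfolding eventually_nhds by blast
  obtain S where S: "\<kappa> (\<gamma> t) \<in> S" "smooth_on S (\<lambda>z. F (\<pi> z))" using assms(3) unfolding smooth_at_def by blast
  have l: "linear (dd (\<lambda>z. F (\<pi> z)) (\<kappa> (\<gamma> t)))" by (rule smooth_on_linear_dd[OF S(2,1)])
  have "((\<lambda>s. F (\<pi> (\<kappa> (\<gamma> s)))) has_derivative (\<lambda>h. dd (\<lambda>z. F (\<pi> z)) (\<kappa> (\<gamma> t)) (h *\<^sub>R w))) (at t)"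
    using has_derivative_compose[OF assms(2)[unfolded has_vector_derivative_def] smooth_on_has_derivative[OF S(2,1)]] .
  then have "((\<lambda>s. F (\<gamma> s)) has_derivative (\<lambda>h. dd (\<lambda>z. F (\<pi> z)) (\<kappa> (\<gamma> t)) (h *\<^sub>R w))) (at t)"
    using has_derivative_cong_open[OF T(1,2), of "\<lambda>s. F (\<pi> (\<kappa> (\<gamma> s)))" "\<lambda>s. F (\<gamma> s)"] pi_kappa[OF T(3)] by simp
  then show ?thesis unfolding has_vector_derivative_def by (simp add: linear_scale[OF l])
qed

end

section \<open>Charts and tangent vectors\<close>

abbreviation transition :: "('m, 'e) chart \<Rightarrow> ('m, 'e) chart \<Rightarrow> 'e \<Rightarrow> 'e" where
  "transition c d \<equiv> snd d \<circ> chart_inv c"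

lemma charts_at_iff: "c \<in> charts_at A x \<longleftrightarrow> c \<in> A \<and> x \<in> fst c"
  by (simp add: charts_at_def)

context smooth_manifold
begin

lemma chart_inv_left: "c \<in> A \<Longrightarrow> x \<in> fst c \<Longrightarrow> chart_inv c (snd c x) = x"
  using chart_homeomorphism[of c] by (simp add: homeomorphism_def)

lemma chart_inv_right: "c \<in> A \<Longrightarrow> y \<in> snd c ` fst c \<Longrightarrow> snd c (chart_inv c y) = y"
  using chart_homeomorphism[of c] by (auto simp: homeomorphism_def)

lemma chart_inv_in: "c \<in> A \<Longrightarrow> y \<in> snd c ` fst c \<Longrightarrow> chart_inv c y \<in> fst c"
  using chart_inv_left by fastforce

lemma open_chart_image:
  assumes "c \<in> A" "open Q" shows "open (snd c ` (fst c \<inter> Q))"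
proof -
  have "continuous_on (snd c ` fst c) (chart_inv c)"
    using chart_homeomorphism[OF assms(1)] by (simp add: homeomorphism_def)
  then have "open (snd c ` fst c \<inter> chart_inv c -` Q)"
    using continuous_open_preimage open_image assms by blast
  moreover have "snd c ` fst c \<inter> chart_inv c -` Q = snd c ` (fst c \<inter> Q)"
    using chart_inv_left[OF assms(1)] by auto
  ultimately show ?thesis by simp
qed

lemma open_overlap: "c \<in> A \<Longrightarrow> d \<in> A \<Longrightarrow> open (snd c ` (fst c \<inter> fst d))"
  using open_chart_image open_domain by blast

lemma in_overlap_iff: "c \<in> A \<Longrightarrow> x \<in> fst c \<Longrightarrow> snd c x \<in> snd c ` (fst c \<inter> Q) \<longleftrightarrow> x \<in> Q"
proof
  assume c: "c \<in> A" "x \<in> fst c" and "snd c x \<in> snd c ` (fst c \<inter> Q)"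
  then obtain x' where x': "x' \<in> fst c" "x' \<in> Q" "snd c x = snd c x'" by blast
  have "chart_inv c (snd c x) = chart_inv c (snd c x')" by (rule arg_cong[OF x'(3)])
  then have "x = x'" by (simp only: chart_inv_left[OF c] chart_inv_left[OF c(1) x'(1)])
  then show "x \<in> Q" using x'(2) by (simp only:)
qed blast

lemma transition_self: "c \<in> A \<Longrightarrow> y \<in> snd c ` fst c \<Longrightarrow> transition c c y = y"
  by (simp add: chart_inv_right)

lemma transition_coord: "c \<in> A \<Longrightarrow> x \<in> fst c \<Longrightarrow> transition c d (snd c x) = snd d x"
  by (simp add: chart_inv_left)

lemma transition_differentiable:
  assumes "c \<in> charts_at A x" "d \<in> charts_at A x"
  shows "transition c d differentiable (at (snd c x))"
  using smooth_on_differentiable[OF smooth_transition[of c d]] assms by (auto simp: charts_at_iff)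

lemma transition_linear:
  assumes "c \<in> charts_at A x" "d \<in> charts_at A x"
  shows "linear (dd (transition c d) (snd c x))"
  using transition_differentiable[OF assms] linear_frechet_derivative by blast

lemma dtransition_self:
  assumes "c \<in> charts_at A x" shows "dd (transition c c) (snd c x) u = u"
proof -
  have c: "c \<in> A" "x \<in> fst c" using assms by (auto simp: charts_at_iff)
  have "dd (transition c c) (snd c x) = dd (\<lambda>y. y) (snd c x)"
    by (rule dd_cong_open[OF open_image[OF c(1)]]) (use c transition_self in auto)
  then show ?thesis by simp
qed

lemma dtransition_chain:
  assumes "c \<in> charts_at A x" "d \<in> charts_at A x" "e \<in> charts_at A x"
  shows "dd (transition d e) (snd d x) (dd (transition c d) (snd c x) u) = dd (transition c e) (snd c x) u"
proof -
  have c: "c \<in> A" "x \<in> fst c" "d \<in> A" "x \<in> fst d" using assms by (auto simp: charts_at_iff)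
  have o: "open (snd c ` (fst c \<inter> fst d))" using open_overlap c by blast
  have "dd (transition c e) (snd c x) = dd (\<lambda>y. transition d e (transition c d y)) (snd c x)"
    by (rule dd_cong_open[OF o]) (use c in \<open>auto simp: chart_inv_left\<close>)
  also have "\<dots> = (\<lambda>v. dd (transition d e) (transition c d (snd c x)) (dd (transition c d) (snd c x) v))"
    by (rule dd_compose[of "transition c d" "snd c x" "transition d e"])
      (simp_all only: transition_coord[OF c(1,2)] transition_differentiable[OF assms(1,2)] transition_differentiable[OF assms(2,3)])
  finally show ?thesis by (simp only: transition_coord[OF c(1,2)])
qed

lemma tangentI:
  assumes "\<And>c. c \<notin> charts_at A x \<Longrightarrow> V c = 0"
    "\<And>c d. c \<in> charts_at A x \<Longrightarrow> d \<in> charts_at A x \<Longrightarrow> V d = dd (transition c d) (snd c x) (V c)"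
  shows "V \<in> tangent_space A x"
  unfolding tangent_space_def using assms by blast

lemma tangentD: "V \<in> tangent_space A x \<Longrightarrow> c \<in> charts_at A x \<Longrightarrow> d \<in> charts_at A x \<Longrightarrow> V d = dd (transition c d) (snd c x) (V c)"
  unfolding tangent_space_def by blast

lemma tangent_outside: "V \<in> tangent_space A x \<Longrightarrow> c \<notin> charts_at A x \<Longrightarrow> V c = 0"
  unfolding tangent_space_def by blast

lemma tangent_eqI:
  assumes "U \<in> tangent_space A x" "V \<in> tangent_space A x" "c \<in> charts_at A x" "U c = V c"
  shows "U = V"
proof
  fix d show "U d = V d"
    by (cases "d \<in> charts_at A x") (use assms tangentD tangent_outside in metis)+
qed

lemma tvec_in: "c \<in> charts_at A x \<Longrightarrow> tvec_of_coords A c x u \<in> tangent_space A x"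
  by (rule tangentI) (simp_all only: tvec_of_coords_def if_True if_False dtransition_chain simp_thms)

lemma tvec_coord: "c \<in> charts_at A x \<Longrightarrow> tvec_of_coords A c x u c = u"
  unfolding tvec_of_coords_def using dtransition_self by simp

lemma tvec_tangent: "c \<in> charts_at A x \<Longrightarrow> V \<in> tangent_space A x \<Longrightarrow> tvec_of_coords A c x (V c) = V"
  using tangent_eqI tvec_in tvec_coord by metis

lemma tvec_change:
  assumes "c \<in> charts_at A x" "d \<in> charts_at A x"
  shows "tvec_of_coords A d x (dd (transition c d) (snd c x) u) = tvec_of_coords A c x u"
  unfolding tvec_of_coords_def by (intro ext) (simp only: dtransition_chain[OF assms] cong: if_cong)

lemma tangent_comb:
  assumes "U \<in> tangent_space A x" "V \<in> tangent_space A x"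
  shows "(\<lambda>c. a *\<^sub>R U c + b *\<^sub>R V c) \<in> tangent_space A x"
proof (rule tangentI)
  show "a *\<^sub>R U d + b *\<^sub>R V d = dd (transition c d) (snd c x) (a *\<^sub>R U c + b *\<^sub>R V c)"
    if "c \<in> charts_at A x" "d \<in> charts_at A x" for c d
    by (simp only: linear_add[OF transition_linear[OF that]] linear_scale[OF transition_linear[OF that]]
        tangentD[OF assms(1) that, symmetric] tangentD[OF assms(2) that, symmetric])
qed (simp add: tangent_outside[OF assms(1)] tangent_outside[OF assms(2)])

lemma tangent_zero: "(\<lambda>_. 0) \<in> tangent_space A x"
  by (rule tangentI) (simp_all add: linear_0[OF transition_linear])

lemma tangent_uminus: "V \<in> tangent_space A x \<Longrightarrow> (\<lambda>c. - V c) \<in> tangent_space A x"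
  using tangent_comb[OF _ tangent_zero, of V x "-1" 0] by simp

lemma tangent_sum:
  assumes "\<And>i. i \<in> I \<Longrightarrow> V i \<in> tangent_space A x"
  shows "(\<lambda>c. \<Sum>i\<in>I. a i *\<^sub>R V i c) \<in> tangent_space A x"
  using assms
proof (induction I rule: infinite_finite_induct)
  case (insert i I)
  have "(\<lambda>c. a i *\<^sub>R V i c + 1 *\<^sub>R (\<Sum>i\<in>I. a i *\<^sub>R V i c)) \<in> tangent_space A x"
    by (rule tangent_comb) (use insert in auto)
  then show ?case using insert by simp
qed (use tangent_zero in auto)

lemma tvec_comb:
  assumes "c \<in> charts_at A x"
  shows "tvec_of_coords A c x (a *\<^sub>R u + b *\<^sub>R v) = (\<lambda>d. a *\<^sub>R tvec_of_coords A c x u d + b *\<^sub>R tvec_of_coords A c x v d)"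
  by (rule tangent_eqI[OF tvec_in tangent_comb[OF tvec_in tvec_in] assms]) (auto simp: assms tvec_coord)

definition bundle_transition :: "('m, 'e) chart \<Rightarrow> ('m, 'e) chart \<Rightarrow> 'e \<times> 'e \<times> 'e \<Rightarrow> 'e \<times> 'e \<times> 'e" where
  "bundle_transition c d = (\<lambda>(y, v, r). (transition c d y, dd (transition c d) y v, dd (transition c d) y r))"

abbreviation bundle_overlap :: "('m, 'e) chart \<Rightarrow> ('m, 'e) chart \<Rightarrow> ('e \<times> 'e \<times> 'e) set" where
  "bundle_overlap c d \<equiv> (snd c ` (fst c \<inter> fst d)) \<times> UNIV"

lemma open_bundle_overlap: "c \<in> A \<Longrightarrow> d \<in> A \<Longrightarrow> open (bundle_overlap c d)"
  by (intro open_Times open_overlap) auto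

lemma bundle_transition_smooth:
  assumes "c \<in> A" "d \<in> A" shows "smooth_on (bundle_overlap c d) (bundle_transition c d)"
proof -
  note o = open_bundle_overlap[OF assms]
  have f: "smooth_on (bundle_overlap c d) fst" "smooth_on (bundle_overlap c d) snd"
    using smooth_on_fst[OF smooth_on_ident o] smooth_on_snd[OF smooth_on_ident o] by auto
  have "smooth_on (bundle_overlap c d) (\<lambda>z. (transition c d (fst z), dd (transition c d) (fst z) (fst (snd z)), dd (transition c d) (fst z) (snd (snd z))))"
    by (intro smooth_on_Pair o smooth_on_dd_apply[OF o open_overlap[OF assms] smooth_transition[OF assms] f(1)]
       smooth_on_fst[OF f(2)] smooth_on_snd[OF f(2)] smooth_on_compose[OF smooth_transition[OF assms] f(1) o open_overlap[OF assms]]) auto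
  then show ?thesis by (simp add: bundle_transition_def case_prod_beta')
qed

lemma open_bundle_transition_vimage:
  assumes "c \<in> A" "d \<in> A" "open S" shows "open (bundle_overlap c d \<inter> bundle_transition c d -` S)"
  using continuous_open_preimage[OF smooth_on_continuous[OF bundle_transition_smooth[OF assms(1,2)]] open_bundle_overlap[OF assms(1,2)] assms(3)] .

lemma bundle_transition_bundle:
  assumes "c \<in> charts_at A x" "d \<in> charts_at A x" "V \<in> tangent_space A x" "R \<in> tangent_space A x"
  shows "bundle_transition c d (bundle_chart c (x, V, R)) = bundle_chart d (x, V, R)"
  using transition_coord[of c x d] tangentD[OF assms(3,1,2)] tangentD[OF assms(4,1,2)] assms(1)
  by (simp add: bundle_transition_def bundle_chart_def charts_at_iff)

lemma bundle_in_bundle_overlap_iff: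
  assumes "c \<in> A" "x \<in> fst c" shows "bundle_chart c (x, V, R) \<in> bundle_overlap c d \<longleftrightarrow> x \<in> fst d"
  using in_overlap_iff[OF assms] by (simp add: bundle_chart_def)

end

section \<open>Metric, curvature and covariant derivative in different charts\<close>

lemma metric_field_subset: "metric_field U G \<Longrightarrow> open V \<Longrightarrow> V \<subseteq> U \<Longrightarrow> metric_field V G"
  unfolding metric_field_def using smooth_on_subset by blast

lemma christoffel_eq: "christoffel A g c = chr (metric_coords A g c)"
  by (intro ext) (simp add: christoffel_def chr_def koszul_def)

context riemannian_manifold
begin

lemma g_linear2:
  assumes "u \<in> tangent_space A x" "v \<in> tangent_space A x" "w \<in> tangent_space A x"
  shows "g x w (\<lambda>c. a *\<^sub>R u c + b *\<^sub>R v c) = a * g x w u + b * g x w v"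
  using metric_linear[OF assms, of a b] metric_sym[OF assms(3) tangent_comb[OF assms(1,2)]]
    metric_sym[OF assms(3,1)] metric_sym[OF assms(3,2)] by simp

lemma g_coords:
  assumes "c \<in> charts_at A x" "U \<in> tangent_space A x" "V \<in> tangent_space A x"
  shows "g x U V = metric_coords A g c (snd c x) (U c) (V c)"
  using assms tvec_tangent by (simp add: metric_coords_def charts_at_iff chart_inv_left)

lemma metric_coords_at:
  assumes "c \<in> charts_at A x"
  shows "metric_coords A g c (snd c x) u v = g x (tvec_of_coords A c x u) (tvec_of_coords A c x v)"
  using assms by (simp add: metric_coords_def charts_at_iff chart_inv_left)

lemma metric_coords_inner:
  assumes "c \<in> charts_at A x"
  shows "inner_form (metric_coords A g c (snd c x))"
  unfolding inner_form_def bilinear_def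
proof (intro conjI allI impI)
  note c = assms
  show "linear (metric_coords A g c (snd c x) u)" for u
  proof -
    have "metric_coords A g c (snd c x) u (p *\<^sub>R a + q *\<^sub>R b) =
        p * metric_coords A g c (snd c x) u a + q * metric_coords A g c (snd c x) u b" for p q a b
      by (simp only: metric_coords_at[OF c] tvec_comb[OF c] g_linear2[OF tvec_in[OF c] tvec_in[OF c] tvec_in[OF c]])
    from this[where p=1 and q=1] this[where q=0] show ?thesis
      by (intro linearI) simp_all
  qed
  show s: "metric_coords A g c (snd c x) u v = metric_coords A g c (snd c x) v u" for u v
    using metric_sym[OF tvec_in[OF c] tvec_in[OF c]] by (simp add: metric_coords_at[OF c])
  show "linear (\<lambda>u. metric_coords A g c (snd c x) u v)" for v
    using \<open>\<And>u. linear (metric_coords A g c (snd c x) u)\<close>[of v] by (subst s)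
  show "metric_coords A g c (snd c x) u u > 0" if "u \<noteq> 0" for u
    using metric_pos[OF tvec_in[OF c]] tvec_coord[OF c, of u] that by (metis metric_coords_at[OF c])
qed

lemma chart_metric_field:
  assumes "c \<in> A" shows "metric_field (snd c ` fst c) (metric_coords A g c)"
proof
  show "open (snd c ` fst c)" using open_image assms by blast
  show "inner_form (metric_coords A g c y)" if "y \<in> snd c ` fst c" for y
    using that metric_coords_inner[of c] assms by (auto simp: charts_at_iff)
  show "smooth_on (snd c ` fst c) (\<lambda>y. metric_coords A g c y u v)" for u v
    using metric_smooth[OF assms] .
qed

lemma chart_change:
  assumes "c \<in> A" "d \<in> A"
  shows "scaled_pullback (snd c ` (fst c \<inter> fst d)) (metric_coords A g c) (snd d ` fst d) (metric_coords A g d) (transition c d) 1"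
  unfolding scaled_pullback_def scaled_pullback_axioms_def
proof (intro conjI allI impI)
  show "metric_field (snd c ` (fst c \<inter> fst d)) (metric_coords A g c)"
    by (rule metric_field_subset[OF chart_metric_field[OF assms(1)] open_overlap[OF assms]]) auto
  show "metric_field (snd d ` fst d) (metric_coords A g d)" by (rule chart_metric_field[OF assms(2)])
  show "smooth_on (snd c ` (fst c \<inter> fst d)) (transition c d)" using smooth_transition assms by blast
  fix y assume "y \<in> snd c ` (fst c \<inter> fst d)"
  then obtain x where x: "x \<in> fst c" "x \<in> fst d" "y = snd c x" by blast
  have ch: "c \<in> charts_at A x" "d \<in> charts_at A x" using x assms by (auto simp: charts_at_iff)
  show "transition c d y \<in> snd d ` fst d" using x transition_coord[OF assms(1)] by auto
  fix u v
  show "metric_coords A g d (transition c d y) (dd (transition c d) y u) (dd (transition c d) y v) = 1 * metric_coords A g c y u v"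
    unfolding x(3) transition_coord[OF assms(1) x(1)] metric_coords_at[OF ch(1)] metric_coords_at[OF ch(2)] tvec_change[OF ch]
    by simp
qed simp

lemma curvature_coords:
  assumes "c \<in> charts_at A x"
  shows "curvature_endo A g x X Y Z c = curv (metric_coords A g c) (snd c x) (X c) (Y c) (Z c)"
  using assms by (simp add: curvature_endo_def curv_def christoffel_eq Let_def)

lemma curvature_tangent:
  assumes "X \<in> tangent_space A x" "Y \<in> tangent_space A x" "Z \<in> tangent_space A x"
  shows "curvature_endo A g x X Y Z \<in> tangent_space A x"
proof (rule tangentI)
  show "curvature_endo A g x X Y Z c = 0" if "c \<notin> charts_at A x" for c
    using that by (simp add: curvature_endo_def)
  fix c d assume cd: "c \<in> charts_at A x" "d \<in> charts_at A x"
  then have c: "c \<in> A" "d \<in> A" "x \<in> fst c" "x \<in> fst d" by (auto simp: charts_at_iff)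
  interpret T: scaled_pullback "snd c ` (fst c \<inter> fst d)" "metric_coords A g c" "snd d ` fst d" "metric_coords A g d" "transition c d" 1
    by (rule chart_change[OF c(1,2)])
  have "snd c x \<in> snd c ` (fst c \<inter> fst d)" using c by blast
  from T.curv_transform[OF this, of "X c" "Y c" "Z c"]
  show "curvature_endo A g x X Y Z d = dd (transition c d) (snd c x) (curvature_endo A g x X Y Z c)"
    unfolding curvature_coords[OF cd(1)] curvature_coords[OF cd(2)]
    tangentD[OF assms(1) cd, symmetric] tangentD[OF assms(2) cd, symmetric] tangentD[OF assms(3) cd, symmetric]
    transition_coord[OF c(1,3)] by simp
qed

lemma curve_change:
  assumes "c \<in> charts_at A (x t)" "d \<in> charts_at A (x t)" "isCont x t"
    "((\<lambda>s. snd c (x s)) has_vector_derivative y') (at t)"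
  shows "((\<lambda>s. snd d (x s)) has_vector_derivative dd (transition c d) (snd c (x t)) y') (at t)"
    and "\<forall>\<^sub>F s in nhds t. x s \<in> fst c \<inter> fst d"
proof -
  have c: "c \<in> A" "d \<in> A" "x t \<in> fst c \<inter> fst d" using assms(1,2) by (auto simp: charts_at_iff)
  have "open (fst c \<inter> fst d)" using open_domain c by blast
  then show ev: "\<forall>\<^sub>F s in nhds t. x s \<in> fst c \<inter> fst d"
    using topological_tendstoD[OF assms(3)[unfolded continuous_at] _ c(3)] c(3)
    unfolding eventually_nhds_conv_at by blast
  then obtain T where T: "open T" "t \<in> T" "\<And>s. s \<in> T \<Longrightarrow> x s \<in> fst c \<inter> fst d"
    unfolding eventually_nhds by blast
  have "((\<lambda>s. transition c d (snd c (x s))) has_derivative (\<lambda>h. dd (transition c d) (snd c (x t)) (h *\<^sub>R y'))) (at t)"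
    using has_derivative_compose[OF assms(4)[unfolded has_vector_derivative_def] dd_works[OF transition_differentiable[OF assms(1,2)]]] .
  then have "((\<lambda>s. snd d (x s)) has_derivative (\<lambda>h. dd (transition c d) (snd c (x t)) (h *\<^sub>R y'))) (at t)"
    using has_derivative_cong_open[OF T(1,2), of "\<lambda>s. transition c d (snd c (x s))" "\<lambda>s. snd d (x s)"] transition_coord[OF c(1)] T(3) by simp
  then show "((\<lambda>s. snd d (x s)) has_vector_derivative dd (transition c d) (snd c (x t)) y') (at t)"
    unfolding has_vector_derivative_def by (simp add: linear_scale[OF transition_linear[OF assms(1,2)]])
qed

text \<open>The term with the second derivative of the transition map is the failure of the plain derivative of a field
to be a tangent vector; \<open>chr_transform\<close> compensates it in \<open>cov_deriv_tangent\<close>.\<close>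

lemma field_change:
  assumes "c \<in> charts_at A (x t)" "d \<in> charts_at A (x t)" "isCont x t"
    "((\<lambda>s. snd c (x s)) has_vector_derivative y') (at t)"
    "((\<lambda>s. Y s c) has_vector_derivative v') (at t)"
    "\<forall>\<^sub>F s in nhds t. Y s \<in> tangent_space A (x s)"
  shows "((\<lambda>s. Y s d) has_vector_derivative (dd (\<lambda>y. dd (transition c d) y (Y t c)) (snd c (x t)) y' + dd (transition c d) (snd c (x t)) v')) (at t)"
proof -
  have c: "c \<in> A" "d \<in> A" "x t \<in> fst c \<inter> fst d" using assms(1,2) by (auto simp: charts_at_iff)
  let ?O = "snd c ` (fst c \<inter> fst d)" and ?y = "snd c (x t)"
  have "\<forall>\<^sub>F s in nhds t. x s \<in> fst c \<inter> fst d \<and> Y s \<in> tangent_space A (x s)"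
    using curve_change(2)[OF assms(1-4)] assms(6) by (rule eventually_conj)
  then obtain T where T: "open T" "t \<in> T" "\<And>s. s \<in> T \<Longrightarrow> x s \<in> fst c \<inter> fst d" "\<And>s. s \<in> T \<Longrightarrow> Y s \<in> tangent_space A (x s)"
    unfolding eventually_nhds by blast
  have o: "open ?O" using open_overlap c by blast
  have sm: "smooth_on ?O (transition c d)" using smooth_transition c by blast
  have y: "?y \<in> ?O" using c by blast
  have 1: "((\<lambda>y. dd (transition c d) y v) has_derivative dd (\<lambda>y. dd (transition c d) y v) ?y) (at ?y)" for v
    by (rule smooth_on_has_derivative[OF smooth_on_dd[OF sm] y])
  have 2: "((\<lambda>s. dd (transition c d) (snd c (x s)) v) has_derivative (\<lambda>h. dd (\<lambda>y. dd (transition c d) y v) ?y (h *\<^sub>R y'))) (at t)" for v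
    using has_derivative_compose[OF assms(4)[unfolded has_vector_derivative_def] 1] .
  have lin: "linear (dd (transition c d) (snd c (x s)))" if "s \<in> T" for s
    by (rule transition_linear) (use T(3)[OF that] c in \<open>auto simp: charts_at_iff\<close>)
  have "((\<lambda>s. dd (transition c d) (snd c (x s)) (Y s c)) has_derivative
     (\<lambda>h. dd (\<lambda>y. dd (transition c d) y (Y t c)) ?y (h *\<^sub>R y') + dd (transition c d) ?y (h *\<^sub>R v'))) (at t)"
    by (rule has_derivative_linear_param[OF T(1,2) lin 2 assms(5)[unfolded has_vector_derivative_def]])
  moreover have "dd (transition c d) (snd c (x s)) (Y s c) = Y s d" if "s \<in> T" for s
    using tangentD[OF T(4)[OF that], of c d] T(3)[OF that] c by (simp add: charts_at_iff)
  ultimately have "((\<lambda>s. Y s d) has_derivative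
     (\<lambda>h. dd (\<lambda>y. dd (transition c d) y (Y t c)) ?y (h *\<^sub>R y') + dd (transition c d) ?y (h *\<^sub>R v'))) (at t)"
    using has_derivative_cong_open[OF T(1,2), of "\<lambda>s. dd (transition c d) (snd c (x s)) (Y s c)" "\<lambda>s. Y s d"] by simp
  then show ?thesis unfolding has_vector_derivative_def
    by (simp add: linear_scale[OF lin[OF T(2)]] linear_scale[OF smooth_on_linear_dd[OF smooth_on_dd[OF sm] y]] scaleR_add_right)
qed

lemma velocity_tangent:
  assumes "isCont x t" "\<And>c. c \<in> charts_at A (x t) \<Longrightarrow> (\<lambda>s. snd c (x s)) differentiable (at t)"
  shows "curve_velocity A x t \<in> tangent_space A (x t)"
proof (rule tangentI)
  show "curve_velocity A x t c = 0" if "c \<notin> charts_at A (x t)" for c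
    using that by (simp add: curve_velocity_def)
  fix c d assume cd: "c \<in> charts_at A (x t)" "d \<in> charts_at A (x t)"
  have "((\<lambda>s. snd c (x s)) has_vector_derivative vector_derivative (\<lambda>s. snd c (x s)) (at t)) (at t)"
    using assms(2)[OF cd(1)] vector_derivative_works by blast
  from vector_derivative_at[OF curve_change(1)[OF cd assms(1) this]]
  show "curve_velocity A x t d = dd (transition c d) (snd c (x t)) (curve_velocity A x t c)"
    using cd by (simp add: curve_velocity_def)
qed

lemma cov_deriv_tangent:
  assumes "isCont x t" "\<And>c. c \<in> charts_at A (x t) \<Longrightarrow> (\<lambda>s. snd c (x s)) differentiable (at t)"
    "\<And>c. c \<in> charts_at A (x t) \<Longrightarrow> (\<lambda>s. Y s c) differentiable (at t)"
    "\<forall>\<^sub>F s in nhds t. Y s \<in> tangent_space A (x s)"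
  shows "cov_deriv A g x Y t \<in> tangent_space A (x t)"
proof (rule tangentI)
  show "cov_deriv A g x Y t c = 0" if "c \<notin> charts_at A (x t)" for c
    using that by (simp add: cov_deriv_def)
  fix c d assume cd: "c \<in> charts_at A (x t)" "d \<in> charts_at A (x t)"
  then have c: "c \<in> A" "d \<in> A" "x t \<in> fst c" "x t \<in> fst d" by (auto simp: charts_at_iff)
  let ?y' = "vector_derivative (\<lambda>s. snd c (x s)) (at t)" and ?v' = "vector_derivative (\<lambda>s. Y s c) (at t)"
  have 1: "((\<lambda>s. snd c (x s)) has_vector_derivative ?y') (at t)"
    using assms(2)[OF cd(1)] vector_derivative_works by blast
  have 2: "((\<lambda>s. Y s c) has_vector_derivative ?v') (at t)"
    using assms(3)[OF cd(1)] vector_derivative_works by blast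
  interpret T: scaled_pullback "snd c ` (fst c \<inter> fst d)" "metric_coords A g c" "snd d ` fst d" "metric_coords A g d" "transition c d" 1
    by (rule chart_change[OF c(1,2)])
  have y: "snd c (x t) \<in> snd c ` (fst c \<inter> fst d)" using c by blast
  have Yt: "Y t \<in> tangent_space A (x t)" using assms(4) by (rule eventually_nhds_x_imp_x)
  have vel: "curve_velocity A x t d = dd (transition c d) (snd c (x t)) ?y'"
    using tangentD[OF velocity_tangent[OF assms(1,2)] cd] cd by (simp add: curve_velocity_def)
  show "cov_deriv A g x Y t d = dd (transition c d) (snd c (x t)) (cov_deriv A g x Y t c)"
    using cd vector_derivative_at[OF field_change[OF cd assms(1) 1 2 assms(4)]] T.chr_transform[OF y, of ?y' "Y t c"]
      linear_add[OF transition_linear[OF cd], of ?v' "chr (metric_coords A g c) (snd c (x t)) ?y' (Y t c)"]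
      tangentD[OF Yt cd] transition_coord[OF c(1,3)] vel
    by (simp add: cov_deriv_def christoffel_eq curve_velocity_def algebra_simps)
qed

text \<open>Brings the fibre derivatives in the systems of \<open>f\<^sub>2\<close> and \<open>f\<^sub>j\<close> into the form of \<open>f\<^sub>1\<close>.\<close>

lemma cov_deriv_static:
  assumes "curve_velocity A x t = (\<lambda>_. 0)"
  shows "cov_deriv A g x Y t = fibre_deriv A x Y t"
proof
  fix c
  have "chr (metric_coords A g c) (snd c (x t)) 0 (Y t c) = 0" if "c \<in> charts_at A (x t)"
    using metric_field.chr_zero(1)[OF chart_metric_field] that by (auto simp: charts_at_iff)
  then show "cov_deriv A g x Y t c = fibre_deriv A x Y t c"
    using assms by (simp add: cov_deriv_def fibre_deriv_def christoffel_eq)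
qed

end

section \<open>Curvature radii in coordinates\<close>

context metric_field
begin

abbreviation py :: "'e \<times> 'e \<times> 'e \<Rightarrow> 'e" where "py z \<equiv> fst z"
abbreviation pv :: "'e \<times> 'e \<times> 'e \<Rightarrow> 'e" where "pv z \<equiv> fst (snd z)"
abbreviation pr :: "'e \<times> 'e \<times> 'e \<Rightarrow> 'e" where "pr z \<equiv> snd (snd z)"

text \<open>The retraction onto curvature radii keeps \<open>y\<close> and \<open>v\<close>, subtracts from \<open>r\<close> its component along \<open>v\<close>,
and rescales the result to the length of \<open>v\<close>.\<close>

definition orth_coeff :: "'e \<times> 'e \<times> 'e \<Rightarrow> real" where
  "orth_coeff z = G (py z) (pr z) (pv z) * G (py z) (pv z) (pv z) powr (-1)"
definition orth_part :: "'e \<times> 'e \<times> 'e \<Rightarrow> 'e" where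
  "orth_part z = pr z - orth_coeff z *\<^sub>R pv z"
definition norm_ratio :: "'e \<times> 'e \<times> 'e \<Rightarrow> real" where
  "norm_ratio z = G (py z) (pv z) (pv z) powr (1/2) * G (py z) (orth_part z) (orth_part z) powr (-1/2)"
definition to_radii :: "'e \<times> 'e \<times> 'e \<Rightarrow> 'e \<times> 'e \<times> 'e" where
  "to_radii z = (py z, pv z, norm_ratio z *\<^sub>R orth_part z)"
definition radii_nbhd :: "('e \<times> 'e \<times> 'e) set" where
  "radii_nbhd = {z. py z \<in> U \<and> pv z \<noteq> 0 \<and> orth_part z \<noteq> 0}"
definition radii :: "('e \<times> 'e \<times> 'e) set" where
  "radii = {z. py z \<in> U \<and> pv z \<noteq> 0 \<and> G (py z) (pr z) (pv z) = 0 \<and> G (py z) (pr z) (pr z) = G (py z) (pv z) (pv z)}"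
text \<open>The tangent vector with base velocity \<open>a\<close> and covariant derivatives \<open>b\<close> of \<open>V\<close> and \<open>d\<close> of \<open>R\<close>.\<close>

definition lift :: "'e \<times> 'e \<times> 'e \<Rightarrow> 'e \<Rightarrow> 'e \<Rightarrow> 'e \<Rightarrow> 'e \<times> 'e \<times> 'e" where
  "lift z a b d = (a, b - chr G (py z) a (pv z), d - chr G (py z) a (pr z))"

lemma open_W0: "open {z :: 'e \<times> 'e \<times> 'e. py z \<in> U \<and> pv z \<noteq> 0}"
proof -
  have "{z :: 'e \<times> 'e \<times> 'e. py z \<in> U \<and> pv z \<noteq> 0} = U \<times> ((- {0}) \<times> UNIV)" by auto
  then show ?thesis using openU by (auto intro!: open_Times)
qed

lemma smooth_proj:
  assumes "open S"
  shows "smooth_on S py" "smooth_on S pv" "smooth_on S pr"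
  using smooth_on_fst[OF smooth_on_ident assms] smooth_on_snd[OF smooth_on_ident assms]
    smooth_on_fst[OF _ assms] smooth_on_snd[OF _ assms] by auto

lemma smooth_G_comp:
  assumes "open S" "\<And>z. z \<in> S \<Longrightarrow> py z \<in> U" "smooth_on S k" "smooth_on S l"
  shows "smooth_on S (\<lambda>z. G (py z) (k z) (l z))"
  by (rule smooth_on_bilinear_comp[OF assms(1) openU assms(2) G_bil smoothG smooth_proj(1)[OF assms(1)] assms(3,4)])

lemma smooth_chr_comp:
  assumes "open S" "\<And>z. z \<in> S \<Longrightarrow> py z \<in> U" "smooth_on S k" "smooth_on S l"
  shows "smooth_on S (\<lambda>z. chr G (py z) (k z) (l z))"
  by (rule smooth_on_bilinear_comp[OF assms(1) openU assms(2) chr_bil chr_smooth smooth_proj(1)[OF assms(1)] assms(3,4)])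

lemma orth_coeff_smooth:
  assumes "open S" "\<And>z. z \<in> S \<Longrightarrow> py z \<in> U \<and> pv z \<noteq> 0"
  shows "smooth_on S orth_coeff"
  unfolding orth_coeff_def[abs_def]
  by (intro smooth_on_mult smooth_on_powr smooth_G_comp smooth_proj assms(1)) (use assms(2) G_pos in auto)

lemma orth_part_smooth:
  assumes "open S" "\<And>z. z \<in> S \<Longrightarrow> py z \<in> U \<and> pv z \<noteq> 0"
  shows "smooth_on S orth_part"
  unfolding orth_part_def[abs_def]
  by (intro smooth_on_diff smooth_on_scaleR smooth_proj orth_coeff_smooth assms)

lemma open_radii_nbhd: "open radii_nbhd"
proof -
  have "smooth_on {z :: 'e \<times> 'e \<times> 'e. py z \<in> U \<and> pv z \<noteq> 0} orth_part"
    by (rule orth_part_smooth[OF open_W0]) auto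
  from continuous_open_preimage[OF smooth_on_continuous[OF this] open_W0, of "- {0}"]
  have "open ({z :: 'e \<times> 'e \<times> 'e. py z \<in> U \<and> pv z \<noteq> 0} \<inter> orth_part -` (- {0}))" by auto
  moreover have "{z :: 'e \<times> 'e \<times> 'e. py z \<in> U \<and> pv z \<noteq> 0} \<inter> orth_part -` (- {0}) = radii_nbhd"
    by (auto simp: radii_nbhd_def)
  ultimately show ?thesis by simp
qed

lemma norm_ratio_smooth: "smooth_on radii_nbhd norm_ratio"
  unfolding norm_ratio_def[abs_def]
  by (intro smooth_on_mult smooth_on_powr smooth_G_comp smooth_proj orth_part_smooth open_radii_nbhd)
    (use G_pos in \<open>auto simp: radii_nbhd_def\<close>)

lemma to_radii_smooth: "smooth_on radii_nbhd to_radii"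
  unfolding to_radii_def[abs_def]
  by (intro smooth_on_Pair smooth_on_scaleR smooth_proj orth_part_smooth norm_ratio_smooth open_radii_nbhd) (auto simp: radii_nbhd_def)

lemma orth_coeff_eq: "z \<in> radii_nbhd \<Longrightarrow> orth_coeff z * G (py z) (pv z) (pv z) = G (py z) (pr z) (pv z)"
  using G_pos[of "py z" "pv z"] by (simp add: orth_coeff_def radii_nbhd_def powr_minus)

lemma norm_ratio_eq: "z \<in> radii_nbhd \<Longrightarrow> norm_ratio z * (norm_ratio z * G (py z) (orth_part z) (orth_part z)) = G (py z) (pv z) (pv z)"
proof -
  assume z: "z \<in> radii_nbhd"
  then have p: "G (py z) (pv z) (pv z) > 0" "G (py z) (orth_part z) (orth_part z) > 0" using G_pos by (auto simp: radii_nbhd_def)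
  have "norm_ratio z * (norm_ratio z * G (py z) (orth_part z) (orth_part z)) = (G (py z) (pv z) (pv z) powr (1/2) * G (py z) (pv z) (pv z) powr (1/2))
    * (G (py z) (orth_part z) (orth_part z) powr (-1/2) * G (py z) (orth_part z) (orth_part z) powr (-1/2)) * G (py z) (orth_part z) (orth_part z)"
    by (simp add: norm_ratio_def)
  also have "G (py z) (orth_part z) (orth_part z) powr (-1/2) * G (py z) (orth_part z) (orth_part z) powr (-1/2) = G (py z) (orth_part z) (orth_part z) powr (-1)"
    by (simp flip: powr_add)
  also have "G (py z) (pv z) (pv z) powr (1/2) * G (py z) (pv z) (pv z) powr (1/2) = G (py z) (pv z) (pv z)"
    using p by (simp flip: powr_add)
  finally have "norm_ratio z * (norm_ratio z * G (py z) (orth_part z) (orth_part z)) = G (py z) (pv z) (pv z) * G (py z) (orth_part z) (orth_part z) powr (-1) * G (py z) (orth_part z) (orth_part z)" .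
  also have "\<dots> = G (py z) (pv z) (pv z)" using p by (simp add: powr_minus)
  finally show ?thesis .
qed

lemma orth_part_orth: "z \<in> radii_nbhd \<Longrightarrow> G (py z) (orth_part z) (pv z) = 0"
  using orth_coeff_eq[of z] by (simp add: orth_part_def radii_nbhd_def G_simps)

lemma to_radii_in:
  assumes z: "z \<in> radii_nbhd" shows "to_radii z \<in> radii"
proof -
  have "py z \<in> U" "pv z \<noteq> 0" using z by (auto simp: radii_nbhd_def)
  then show ?thesis using orth_part_orth[OF z] norm_ratio_eq[OF z] by (simp add: radii_def to_radii_def G_simps)
qed

lemma orth_coeff_radii: "z \<in> radii \<Longrightarrow> orth_coeff z = 0" by (simp add: orth_coeff_def radii_def)

lemma orth_part_radii: "z \<in> radii \<Longrightarrow> orth_part z = pr z" by (simp add: orth_part_def orth_coeff_radii)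

lemma radii_subset:
  assumes "z \<in> radii" shows "z \<in> radii_nbhd"
proof -
  have "py z \<in> U" "pv z \<noteq> 0" using assms by (auto simp: radii_def)
  then have "G (py z) (pv z) (pv z) > 0" using G_pos by blast
  then have "pr z \<noteq> 0" using assms G_zero[OF \<open>py z \<in> U\<close>] by (auto simp: radii_def)
  then show ?thesis using \<open>py z \<in> U\<close> \<open>pv z \<noteq> 0\<close> orth_part_radii[OF assms] by (simp add: radii_nbhd_def)
qed

lemma norm_ratio_radii: "z \<in> radii \<Longrightarrow> norm_ratio z = 1"
proof -
  assume z: "z \<in> radii"
  then have "G (py z) (pv z) (pv z) > 0" using G_pos by (auto simp: radii_def)
  moreover have "G (py z) (orth_part z) (orth_part z) = G (py z) (pv z) (pv z)" using z orth_part_radii[OF z] by (simp add: radii_def)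
  ultimately show "norm_ratio z = 1" by (simp add: norm_ratio_def powr_minus flip: powr_add)
qed

lemma to_radii_radii: "z \<in> radii \<Longrightarrow> to_radii z = z"
  by (simp add: to_radii_def norm_ratio_radii orth_part_radii)

lemma proj_deriv: "(py has_derivative py) (at z)" "(pv has_derivative pv) (at z)" "(pr has_derivative pr) (at z)"
  by (auto intro!: derivative_eq_intros)

lemma G_comp_deriv:
  assumes "py z \<in> U" "(k has_derivative k') (at z)" "(l has_derivative l') (at z)"
  shows "((\<lambda>z. G (py z) (k z) (l z)) has_derivative (\<lambda>w. dG (py z) (py w) (k z) (l z) + G (py z) (k' w) (l z)
     + G (py z) (k z) (l' w))) (at z)"
  by (rule has_derivative_bilinear_comp[OF openU assms(1) G_bil G_diffble[OF assms(1)] proj_deriv(1) assms(2,3)])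

lemma chr_comp_deriv:
  assumes "py z \<in> U" "(k has_derivative k') (at z)" "(l has_derivative l') (at z)"
  shows "((\<lambda>z. chr G (py z) (k z) (l z)) has_derivative (\<lambda>w. dchr (py z) (py w) (k z) (l z) + chr G (py z) (k' w) (l z)
     + chr G (py z) (k z) (l' w))) (at z)"
  by (rule has_derivative_bilinear_comp[OF openU assms(1) chr_bil chr_diffble[OF assms(1)] proj_deriv(1) assms(2,3)])

text \<open>By metric compatibility, the hypotheses say that \<open>\<langle>R, V\<rangle>\<close> and \<open>|R|\<^sup>2 - |V|\<^sup>2\<close> are stationary in the
direction of the lifted vector.  The derivatives of \<open>orth_coeff\<close> and \<open>norm_ratio\<close> are found by
differentiating \<open>orth_coeff_eq\<close> and \<open>norm_ratio_eq\<close>, which avoids real powers.\<close>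

lemma to_radii_tangent:
  assumes z: "z \<in> radii" and t: "G (py z) d (pv z) + G (py z) (pr z) b = 0" "G (py z) d (pr z) = G (py z) b (pv z)"
  shows "dd to_radii z (lift z a b d) = lift z a b d"
proof -
  let ?y = "py z" and ?v = "pv z" and ?r = "pr z" and ?w = "lift z a b d"
  have zr: "z \<in> radii_nbhd" using radii_subset[OF z] .
  have y: "?y \<in> U" using z by (simp add: radii_def)
  have w: "py ?w = a" "pv ?w = b - chr G ?y a ?v" "pr ?w = d - chr G ?y a ?r" by (simp_all add: lift_def)
  have bd: "(orth_coeff has_derivative dd orth_coeff z) (at z)"
    by (rule smooth_on_has_derivative[OF orth_coeff_smooth[OF open_radii_nbhd] zr]) (simp add: radii_nbhd_def)
  have sd: "(norm_ratio has_derivative dd norm_ratio z) (at z)"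
    by (rule smooth_on_has_derivative[OF norm_ratio_smooth zr])
  have dv: "((\<lambda>z. G (py z) (pv z) (pv z)) has_derivative (\<lambda>w. dG ?y (py w) ?v ?v + G ?y (pv w) ?v + G ?y ?v (pv w))) (at z)"
    by (intro G_comp_deriv y proj_deriv)
  have dn: "((\<lambda>z. G (py z) (pr z) (pv z)) has_derivative (\<lambda>w. dG ?y (py w) ?r ?v + G ?y (pr w) ?v + G ?y ?r (pv w))) (at z)"
    by (intro G_comp_deriv y proj_deriv)
  have rjd: "(orth_part has_derivative (\<lambda>w. pr w - (orth_coeff z *\<^sub>R pv w + dd orth_coeff z w *\<^sub>R ?v))) (at z)"
    unfolding orth_part_def[abs_def] by (intro has_derivative_diff has_derivative_scaleR bd proj_deriv)
  have "((\<lambda>z. orth_coeff z * G (py z) (pv z) (pv z)) has_derivative (\<lambda>w. orth_coeff z * (dG ?y (py w) ?v ?v + G ?y (pv w) ?v + G ?y ?v (pv w))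
    + dd orth_coeff z w * G ?y ?v ?v)) (at z)"
    by (intro has_derivative_mult bd dv)
  then have "((\<lambda>z. G (py z) (pr z) (pv z)) has_derivative (\<lambda>w. orth_coeff z * (dG ?y (py w) ?v ?v + G ?y (pv w) ?v + G ?y ?v (pv w))
    + dd orth_coeff z w * G ?y ?v ?v)) (at z)"
    using has_derivative_cong_open[OF open_radii_nbhd zr, of "\<lambda>z. orth_coeff z * G (py z) (pv z) (pv z)"] orth_coeff_eq by simp
  from fun_cong[OF has_derivative_unique[OF this dn], of ?w]
  have "dd orth_coeff z ?w * G ?y ?v ?v = 0"
    using t(1) metric_compatible[OF y, of ?r ?v a] by (simp add: orth_coeff_radii[OF z] w G_simps y)
  moreover have vpos: "G ?y ?v ?v > 0" using G_pos[OF y] z by (simp add: radii_def)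
  ultimately have b0: "dd orth_coeff z ?w = 0" by simp
  have rjw: "((\<lambda>z. G (py z) (orth_part z) (orth_part z)) has_derivative (\<lambda>w. dG ?y (py w) (orth_part z) (orth_part z) +
    G ?y (pr w - (orth_coeff z *\<^sub>R pv w + dd orth_coeff z w *\<^sub>R ?v)) (orth_part z) + G ?y (orth_part z) (pr w - (orth_coeff z *\<^sub>R pv w + dd orth_coeff z w *\<^sub>R ?v)))) (at z)"
    by (intro G_comp_deriv y rjd)
  let ?s = "G ?y (orth_part z) (orth_part z)"
  let ?ds = "\<lambda>w. dG ?y (py w) (orth_part z) (orth_part z) +
    G ?y (pr w - (orth_coeff z *\<^sub>R pv w + dd orth_coeff z w *\<^sub>R ?v)) (orth_part z) + G ?y (orth_part z) (pr w - (orth_coeff z *\<^sub>R pv w + dd orth_coeff z w *\<^sub>R ?v))"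
  have "((\<lambda>z. norm_ratio z * (norm_ratio z * G (py z) (orth_part z) (orth_part z))) has_derivative
     (\<lambda>w. norm_ratio z * (norm_ratio z * ?ds w + dd norm_ratio z w * ?s) + dd norm_ratio z w * (norm_ratio z * ?s))) (at z)"
    by (intro has_derivative_mult sd rjw)
  then have "((\<lambda>z. G (py z) (pv z) (pv z)) has_derivative
     (\<lambda>w. norm_ratio z * (norm_ratio z * ?ds w + dd norm_ratio z w * ?s) + dd norm_ratio z w * (norm_ratio z * ?s))) (at z)"
    using has_derivative_cong_open[OF open_radii_nbhd zr, of "\<lambda>z. norm_ratio z * (norm_ratio z * G (py z) (orth_part z) (orth_part z))"] norm_ratio_eq by simp
  from fun_cong[OF has_derivative_unique[OF this dv], of ?w]
  have "?ds ?w + 2 * dd norm_ratio z ?w * ?s = dG ?y a ?v ?v + 2 * G ?y (pv ?w) ?v"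
    using G_sym[OF y, of ?v "pv ?w"] unfolding norm_ratio_radii[OF z] mult_1 w by linarith
  moreover have "?ds ?w = dG ?y a ?r ?r + 2 * G ?y (pr ?w) ?r"
    using G_sym[OF y, of ?r "pr ?w"] by (simp add: orth_coeff_radii[OF z] orth_part_radii[OF z] b0 w)
  moreover have "dG ?y a ?v ?v = 2 * G ?y (chr G ?y a ?v) ?v" "dG ?y a ?r ?r = 2 * G ?y (chr G ?y a ?r) ?r"
    using metric_compatible[OF y, of ?v ?v a] metric_compatible[OF y, of ?r ?r a]
      G_sym[OF y, of ?v "chr G ?y a ?v"] G_sym[OF y, of ?r "chr G ?y a ?r"] by simp_all
  ultimately have "dd norm_ratio z ?w * ?s = 0" using t(2) by (simp add: w G_simps y)
  moreover have "?s > 0" using z vpos by (simp add: orth_part_radii[OF z] radii_def)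
  ultimately have s0: "dd norm_ratio z ?w = 0" by simp
  have "(to_radii has_derivative (\<lambda>w. (py w, pv w, norm_ratio z *\<^sub>R (pr w - (orth_coeff z *\<^sub>R pv w + dd orth_coeff z w *\<^sub>R ?v)) + dd norm_ratio z w *\<^sub>R orth_part z))) (at z)"
    unfolding to_radii_def[abs_def] by (intro has_derivative_Pair has_derivative_scaleR sd rjd proj_deriv)
  from dd_eqI[OF this] show ?thesis using s0 b0 orth_coeff_radii[OF z] norm_ratio_radii[OF z] by simp
qed

text \<open>A vector fixed by the derivative of the retraction annihilates every function that vanishes on \<open>radii\<close>,
in particular the two equations that define \<open>radii\<close>.\<close>

lemma to_radii_vertical:
  assumes z: "z \<in> radii" and t: "dd to_radii z (0, 0, u) = (0, 0, u)"
  shows "G (py z) u (pv z) = 0" "G (py z) u (pr z) = 0"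
proof -
  let ?y = "py z" and ?v = "pv z" and ?r = "pr z"
  have zr: "z \<in> radii_nbhd" using radii_subset[OF z] .
  have y: "?y \<in> U" using z by (simp add: radii_def)
  have *: "dd f z (0, 0, u) = 0" if f: "f differentiable (at z)" "\<And>w. w \<in> radii \<Longrightarrow> f w = 0" for f :: "_ \<Rightarrow> real"
  proof -
    have "dd (\<lambda>w. f (to_radii w)) z = dd (\<lambda>_. 0) z"
      by (rule dd_cong_open[OF open_radii_nbhd zr]) (use f(2) to_radii_in in auto)
    moreover have "dd (\<lambda>w. f (to_radii w)) z = (\<lambda>v. dd f (to_radii z) (dd to_radii z v))"
      by (rule dd_compose[of to_radii z f]) (use f(1) to_radii_radii[OF z] smooth_on_differentiable[OF to_radii_smooth zr] in auto)
    ultimately show ?thesis using t to_radii_radii[OF z] by (metis frechet_derivative_const)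
  qed
  have 1: "((\<lambda>z. G (py z) (pr z) (pv z)) has_derivative (\<lambda>w. dG ?y (py w) ?r ?v + G ?y (pr w) ?v + G ?y ?r (pv w))) (at z)"
    by (intro G_comp_deriv y proj_deriv)
  show "G ?y u ?v = 0"
    using *[OF differentiableI[OF 1]] dd_eqI[OF 1] linear_0[OF dG_linear(1)[OF y]] by (simp add: radii_def G_simps y)
  have 2: "((\<lambda>z. G (py z) (pr z) (pr z) - G (py z) (pv z) (pv z)) has_derivative
    (\<lambda>w. (dG ?y (py w) ?r ?r + G ?y (pr w) ?r + G ?y ?r (pr w)) - (dG ?y (py w) ?v ?v + G ?y (pv w) ?v + G ?y ?v (pv w)))) (at z)"
    by (intro has_derivative_diff G_comp_deriv y proj_deriv)
  show "G ?y u ?r = 0"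
    using *[OF differentiableI[OF 2]] dd_eqI[OF 2] linear_0[OF dG_linear(1)[OF y]] G_sym[OF y, of ?r u]
    by (simp add: radii_def G_simps y)
qed

end

section \<open>Vector fields given by differential systems\<close>

text \<open>The common form of the three kinds of systems; see \<open>f1_lift\<close>, \<open>f2_lift\<close>, \<open>fj_lift\<close>.\<close>

definition lift_system ::
  "('m, 'e::euclidean_space) chart set \<Rightarrow> ('m, 'e) metric \<Rightarrow> (('m, 'e) radius \<Rightarrow> ('m, 'e) tvec)
    \<Rightarrow> (('m, 'e) radius \<Rightarrow> ('m, 'e) tvec) \<Rightarrow> (('m, 'e) radius \<Rightarrow> ('m, 'e) tvec)
    \<Rightarrow> (real \<Rightarrow> 'm) \<Rightarrow> (real \<Rightarrow> ('m, 'e) tvec) \<Rightarrow> (real \<Rightarrow> ('m, 'e) tvec) \<Rightarrow> real \<Rightarrow> bool" where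
  "lift_system A g \<alpha> \<beta> \<delta> x V R t \<longleftrightarrow>
     curve_velocity A x t = \<alpha> (x t, V t, R t) \<and>
     cov_deriv A g x V t = \<beta> (x t, V t, R t) \<and>
     cov_deriv A g x R t = \<delta> (x t, V t, R t)"

text \<open>The linearised equations of the manifold of curvature radii.\<close>

definition tangent_triple ::
  "('m, 'e::euclidean_space) chart set \<Rightarrow> ('m, 'e) metric \<Rightarrow> ('m, 'e) radius
    \<Rightarrow> ('m, 'e) tvec \<Rightarrow> ('m, 'e) tvec \<Rightarrow> ('m, 'e) tvec \<Rightarrow> bool" where
  "tangent_triple A g = (\<lambda>(x, V, R) a b d. a \<in> tangent_space A x \<and> b \<in> tangent_space A x \<and> d \<in> tangent_space A x \<and>
     g x d V + g x R b = 0 \<and> g x d R = g x b V)"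

locale radii_chart = riemannian_manifold A g
  for A :: "('m::{t2_space, second_countable_topology}, 'e::euclidean_space) chart set" and g +
  fixes c :: "('m, 'e) chart"
  assumes c_in: "c \<in> A"
begin

abbreviation "GG \<equiv> metric_coords A g c"

sublocale M: metric_field "snd c ` fst c" GG
  by (rule chart_metric_field[OF c_in])

definition P :: "('m, 'e) radius set" where
  "P = {q \<in> curvature_radii A g. fst q \<in> fst c}"

definition pt :: "'e \<times> 'e \<times> 'e \<Rightarrow> ('m, 'e) radius" where
  "pt z = (chart_inv c (M.py z), tvec_of_coords A c (chart_inv c (M.py z)) (M.pv (M.to_radii z)),
     tvec_of_coords A c (chart_inv c (M.py z)) (M.pr (M.to_radii z)))"

abbreviation "\<kappa> \<equiv> bundle_chart c"

lemma P_iff: "(x, V, R) \<in> P \<longleftrightarrow> c \<in> charts_at A x \<and> V \<in> tangent_space A x \<and> R \<in> tangent_space A x \<and> \<kappa> (x, V, R) \<in> M.radii"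
proof (cases "c \<in> charts_at A x \<and> V \<in> tangent_space A x \<and> R \<in> tangent_space A x")
  case True
  then have h: "c \<in> charts_at A x" "V \<in> tangent_space A x" "R \<in> tangent_space A x" by auto
  have x: "x \<in> fst c" using h(1) by (simp add: charts_at_iff)
  have y: "snd c x \<in> snd c ` fst c" using x by blast
  have n: "gnorm g x W \<ge> 0" if "W \<in> tangent_space A x" for W
    using inner_formD(5,6)[OF M.innerG[OF y], of "W c"] M.G_zero[OF y]
    by (cases "W c = 0") (auto simp: gnorm_def g_coords[OF h(1) that that])
  have s: "gnorm g x R = gnorm g x V \<longleftrightarrow> g x R R = g x V V"
    by (simp add: gnorm_def)
  have p: "gnorm g x V > 0 \<longleftrightarrow> V c \<noteq> 0"
    using inner_formD(5,6)[OF M.innerG[OF y], of "V c"] M.G_zero[OF y]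
    by (cases "V c = 0") (auto simp: gnorm_def g_coords[OF h(1,2,2)])
  show ?thesis
    using h x y by (auto simp: P_def curvature_radii_def s p g_coords[OF h(1)] M.radii_def bundle_chart_def)
next
  case False
  then show ?thesis using c_in by (auto simp: P_def curvature_radii_def charts_at_iff)
qed

lemma kappa_pt:
  assumes "z \<in> M.radii_nbhd" shows "\<kappa> (pt z) = M.to_radii z"
proof -
  have y: "M.py z \<in> snd c ` fst c" using assms by (simp add: M.radii_nbhd_def)
  have ch: "c \<in> charts_at A (chart_inv c (M.py z))" using c_in chart_inv_in[OF c_in y] by (simp add: charts_at_iff)
  show ?thesis
    using tvec_coord[OF ch] chart_inv_right[OF c_in y] by (simp add: bundle_chart_def pt_def M.to_radii_def)
qed

lemma pt_in:
  assumes "z \<in> M.radii_nbhd" shows "pt z \<in> P"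
proof -
  have y: "M.py z \<in> snd c ` fst c" using assms by (simp add: M.radii_nbhd_def)
  have ch: "c \<in> charts_at A (chart_inv c (M.py z))" using c_in chart_inv_in[OF c_in y] by (simp add: charts_at_iff)
  show ?thesis using ch tvec_in[OF ch] kappa_pt[OF assms] M.to_radii_in[OF assms] unfolding pt_def P_iff by simp
qed

lemma kappa_radii: "q \<in> P \<Longrightarrow> \<kappa> q \<in> M.radii"
  using P_iff by (cases q) auto

lemma pt_kappa:
  assumes "q \<in> P" shows "pt (\<kappa> q) = q"
proof -
  obtain x V R where q: "q = (x, V, R)" by (cases q)
  have h: "c \<in> charts_at A x" "V \<in> tangent_space A x" "R \<in> tangent_space A x" using assms P_iff q by auto
  have "chart_inv c (snd c x) = x" using h(1) chart_inv_left by (simp add: charts_at_iff)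
  then show ?thesis using M.to_radii_radii[OF kappa_radii[OF assms]] tvec_tangent[OF h(1,2)] tvec_tangent[OF h(1,3)]
    by (simp add: pt_def q bundle_chart_def)
qed

sublocale Q: retract P \<kappa> pt M.radii_nbhd
proof
  show "open M.radii_nbhd" by (rule M.open_radii_nbhd)
  show "pt z \<in> P" if "z \<in> M.radii_nbhd" for z using pt_in that .
  show "\<kappa> (pt z) \<in> M.radii_nbhd" if "z \<in> M.radii_nbhd" for z using kappa_pt[OF that] M.to_radii_in[OF that] M.radii_subset by simp
  show "\<kappa> q \<in> M.radii_nbhd" if "q \<in> P" for q using kappa_radii[OF that] M.radii_subset by simp
  show "pt (\<kappa> q) = q" if "q \<in> P" for q using pt_kappa that .
  show "smooth_on M.radii_nbhd (\<lambda>z. \<kappa> (pt z))"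
    by (subst smooth_on_cong[OF M.open_radii_nbhd kappa_pt]) (auto simp: M.to_radii_smooth)
qed

lemma dd_rho: "z \<in> M.radii_nbhd \<Longrightarrow> dd Q.\<rho> z = dd M.to_radii z"
  by (rule dd_cong_open[OF M.open_radii_nbhd]) (auto simp: kappa_pt)

lemma P_charts: "q \<in> P \<Longrightarrow> c \<in> charts_at A (fst q)"
  using P_iff by (cases q) auto

lemma P_radii: "q \<in> P \<Longrightarrow> q \<in> curvature_radii A g"
  by (simp add: P_def)

text \<open>Smoothness is required in all charts around the point; an extension in the chart \<open>c\<close> is carried to
the other charts by the smooth transition maps of the bundle.\<close>

lemma radii_smooth_at_iff:
  assumes "q \<in> P"
  shows "radii_smooth_at A g q F \<longleftrightarrow> Q.smooth_at q F"
proof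
  assume "radii_smooth_at A g q F"
  then obtain S F' where S: "open S" "\<kappa> q \<in> S" "smooth_on S F'"
    and eq: "\<forall>p\<in>curvature_radii A g. fst p \<in> fst c \<and> \<kappa> p \<in> S \<longrightarrow> F p = F' (\<kappa> p)"
    unfolding radii_smooth_at_def using P_charts[OF assms] by blast
  let ?T = "M.radii_nbhd \<inter> Q.\<rho> -` S"
  have T: "open ?T" by (rule continuous_open_preimage[OF smooth_on_continuous[OF Q.smooth_rho] M.open_radii_nbhd S(1)])
  have "smooth_on ?T (\<lambda>z. F' (\<kappa> (pt z)))"
    by (rule smooth_on_compose[OF S(3) smooth_on_subset[OF Q.smooth_rho] T S(1)]) auto
  moreover have "F (pt z) = F' (\<kappa> (pt z))" if "z \<in> ?T" for z
    using eq pt_in[of z] that by (auto simp: P_def)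
  ultimately have "smooth_on ?T (\<lambda>z. F (pt z))" by (subst smooth_on_cong[OF T]) auto
  then show "Q.smooth_at q F" unfolding Q.smooth_at_def
    using T S(2) Q.kappa_in[OF assms] Q.rho_fix[OF assms] by (intro exI[of _ ?T]) auto
next
  assume "Q.smooth_at q F"
  then obtain S where S: "open S" "\<kappa> q \<in> S" "S \<subseteq> M.radii_nbhd" "smooth_on S (\<lambda>z. F (pt z))"
    unfolding Q.smooth_at_def by blast
  show "radii_smooth_at A g q F"
    unfolding radii_smooth_at_def
  proof
    fix d assume d: "d \<in> charts_at A (fst q)"
    then have dA: "d \<in> A" "fst q \<in> fst d" by (auto simp: charts_at_iff)
    let ?T = "bundle_overlap d c \<inter> bundle_transition d c -` S"
    have T: "open ?T" by (rule open_bundle_transition_vimage[OF dA(1) c_in S(1)])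
    have bundle_transition: "bundle_transition d c (bundle_chart d p) = \<kappa> p" "p \<in> P" if "p \<in> curvature_radii A g" "fst p \<in> fst d" "fst p \<in> fst c" for p
    proof -
      show P: "p \<in> P" using that by (simp add: P_def)
      obtain x V R where p: "p = (x, V, R)" by (cases p)
      have "d \<in> charts_at A x" using that(2) dA(1) p by (simp add: charts_at_iff)
      then show "bundle_transition d c (bundle_chart d p) = \<kappa> p" using bundle_transition_bundle[of d x c V R] P P_iff p by auto
    qed
    have q: "fst q \<in> fst c" "q \<in> curvature_radii A g" using assms by (auto simp: P_def)
    have "smooth_on ?T (\<lambda>w. F (pt (bundle_transition d c w)))"
      by (rule smooth_on_compose[OF S(4) smooth_on_subset[OF bundle_transition_smooth[OF dA(1) c_in]] T S(1)]) auto
    moreover have "bundle_chart d q \<in> ?T"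
      using bundle_transition(1)[OF q(2) dA(2) q(1)] S(2) bundle_in_bundle_overlap_iff[OF dA, of "fst (snd q)" "snd (snd q)" c] q(1) by simp
    moreover have "F p = F (pt (bundle_transition d c (bundle_chart d p)))"
      if p: "p \<in> curvature_radii A g" "fst p \<in> fst d" "bundle_chart d p \<in> ?T" for p
    proof -
      have "bundle_chart d p \<in> bundle_overlap d c" using p(3) by (rule IntD1)
      then have "fst p \<in> fst c"
        using bundle_in_bundle_overlap_iff[OF dA(1) p(2), of "fst (snd p)" "snd (snd p)" c] by simp
      then show ?thesis using bundle_transition[OF p(1,2)] pt_kappa by simp
    qed
    ultimately show "\<exists>S F'. open S \<and> bundle_chart d q \<in> S \<and> smooth_on S F' \<and>
        (\<forall>p\<in>curvature_radii A g. fst p \<in> fst d \<and> bundle_chart d p \<in> S \<longrightarrow> F p = F' (bundle_chart d p))"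
      using T by (intro exI[of _ ?T] exI[of _ "\<lambda>w. F (pt (bundle_transition d c w))"]) auto
  qed
qed

lemma radii_openI:
  assumes "open S" shows "radii_open A g {q \<in> P. \<kappa> q \<in> S}"
  unfolding radii_open_def
proof (intro conjI ballI)
  show "{q \<in> P. \<kappa> q \<in> S} \<subseteq> curvature_radii A g" using P_radii by blast
  fix d assume dA: "d \<in> A"
  let ?T = "bundle_overlap d c \<inter> bundle_transition d c -` S"
  have key: "p \<in> {q \<in> P. \<kappa> q \<in> S} \<longleftrightarrow> bundle_chart d p \<in> ?T" if p: "p \<in> curvature_radii A g" "fst p \<in> fst d" for p
  proof (cases "fst p \<in> fst c")
    case True
    then have P: "p \<in> P" using p by (simp add: P_def)
    obtain x V R where e: "p = (x, V, R)" by (cases p)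
    have "d \<in> charts_at A x" using p(2) dA e by (simp add: charts_at_iff)
    then have "bundle_transition d c (bundle_chart d p) = \<kappa> p" using bundle_transition_bundle[of d x c V R] P P_iff e by auto
    then show ?thesis using P bundle_in_bundle_overlap_iff[OF dA p(2), of "fst (snd p)" "snd (snd p)" c] True by simp
  next
    case False
    then show ?thesis using bundle_in_bundle_overlap_iff[OF dA p(2), of "fst (snd p)" "snd (snd p)" c] by (simp add: P_def)
  qed
  show "\<exists>T. open T \<and> (\<forall>p\<in>curvature_radii A g. fst p \<in> fst d \<longrightarrow> (p \<in> {q \<in> P. \<kappa> q \<in> S} \<longleftrightarrow> bundle_chart d p \<in> T))"
  proof (intro exI[of _ ?T] conjI ballI impI)
    show "open ?T" by (rule open_bundle_transition_vimage[OF dA c_in assms])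
  qed (rule key)
qed

lemma radii_openE:
  assumes "radii_open A g Z"
  obtains S where "open S" "S \<subseteq> M.radii_nbhd" "\<And>q. q \<in> P \<Longrightarrow> q \<in> Z \<longleftrightarrow> \<kappa> q \<in> S"
proof -
  obtain S where S: "open S" "\<forall>p\<in>curvature_radii A g. fst p \<in> fst c \<longrightarrow> (p \<in> Z \<longleftrightarrow> \<kappa> p \<in> S)"
    using assms c_in unfolding radii_open_def by blast
  then have "q \<in> P \<Longrightarrow> q \<in> Z \<longleftrightarrow> \<kappa> q \<in> S \<inter> M.radii_nbhd" for q
    using Q.kappa_in by (auto simp: P_def)
  then show ?thesis using that[of "S \<inter> M.radii_nbhd"] S(1) M.open_radii_nbhd by blast
qed

lemma lift_tangent:
  assumes q: "q \<in> P" and t: "tangent_triple A g q a b d"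
  shows "dd Q.\<rho> (\<kappa> q) (M.lift (\<kappa> q) (a c) (b c) (d c)) = M.lift (\<kappa> q) (a c) (b c) (d c)"
proof -
  obtain x V R where e: "q = (x, V, R)" by (cases q)
  have h: "c \<in> charts_at A x" "V \<in> tangent_space A x" "R \<in> tangent_space A x" using q P_iff e by auto
  have u: "a \<in> tangent_space A x" "b \<in> tangent_space A x" "d \<in> tangent_space A x"
    "g x d V + g x R b = 0" "g x d R = g x b V" using t by (auto simp: tangent_triple_def e)
  have "M.py (\<kappa> q) = snd c x" "M.pv (\<kappa> q) = V c" "M.pr (\<kappa> q) = R c" by (simp_all add: e bundle_chart_def)
  moreover have "GG (snd c x) (d c) (V c) + GG (snd c x) (R c) (b c) = 0"
    using u(4) g_coords[OF h(1) u(3) h(2)] g_coords[OF h(1) h(3) u(2)] by simp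
  moreover have "GG (snd c x) (d c) (R c) = GG (snd c x) (b c) (V c)"
    using u(5) g_coords[OF h(1) u(3) h(3)] g_coords[OF h(1) u(2) h(2)] by simp
  ultimately show ?thesis
    unfolding dd_rho[OF Q.kappa_in[OF q]] by (intro M.to_radii_tangent kappa_radii q) simp_all
qed

text \<open>Both sides of each equation of the system are tangent vectors, so the equations in the chart \<open>c\<close> imply those
in all other charts.\<close>

lemma system_iff:
  assumes curve: "radii_curve_at A Z \<gamma> t" and Z: "Z \<subseteq> curvature_radii A g" and q: "\<gamma> t \<in> P"
    and tan: "tangent_triple A g (\<gamma> t) (\<alpha> (\<gamma> t)) (\<beta> (\<gamma> t)) (\<delta> (\<gamma> t))"
  shows "lift_system A g \<alpha> \<beta> \<delta> (\<lambda>s. fst (\<gamma> s)) (\<lambda>s. fst (snd (\<gamma> s))) (\<lambda>s. snd (snd (\<gamma> s))) t \<longleftrightarrow>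
    ((\<lambda>s. \<kappa> (\<gamma> s)) has_vector_derivative M.lift (\<kappa> (\<gamma> t)) (\<alpha> (\<gamma> t) c) (\<beta> (\<gamma> t) c) (\<delta> (\<gamma> t) c)) (at t)"
proof -
  let ?x = "\<lambda>s. fst (\<gamma> s)" and ?V = "\<lambda>s. fst (snd (\<gamma> s))" and ?R = "\<lambda>s. snd (snd (\<gamma> s))"
  have ev: "\<forall>\<^sub>F s in nhds t. \<gamma> s \<in> Z" and cont: "isCont ?x t"
    and df: "\<And>d. d \<in> charts_at A (?x t) \<Longrightarrow> (\<lambda>s. bundle_chart d (\<gamma> s)) differentiable (at t)"
    using curve unfolding radii_curve_at_def by auto
  have c: "c \<in> charts_at A (?x t)" by (rule P_charts[OF q])
  have hZ: "fst (snd p) \<in> tangent_space A (fst p) \<and> snd (snd p) \<in> tangent_space A (fst p)" if "p \<in> Z" for p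
    using Z that by (cases p) (auto simp: curvature_radii_def)
  have evV: "\<forall>\<^sub>F s in nhds t. ?V s \<in> tangent_space A (?x s)" and evR: "\<forall>\<^sub>F s in nhds t. ?R s \<in> tangent_space A (?x s)"
    by (rule eventually_mono[OF ev]; use hZ in blast)+
  have comp: "((\<lambda>s. snd d (?x s)) has_vector_derivative fst D) (at t)"
      "((\<lambda>s. ?V s d) has_vector_derivative fst (snd D)) (at t)"
      "((\<lambda>s. ?R s d) has_vector_derivative snd (snd D)) (at t)"
    if "((\<lambda>s. bundle_chart d (\<gamma> s)) has_vector_derivative D) (at t)" for d D
  proof -
    note 1 = bounded_linear.has_vector_derivative[OF bounded_linear_fst that]
    note 2 = bounded_linear.has_vector_derivative[OF bounded_linear_snd that]
    note 3 = bounded_linear.has_vector_derivative[OF bounded_linear_fst 2]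
    note 4 = bounded_linear.has_vector_derivative[OF bounded_linear_snd 2]
    show "((\<lambda>s. snd d (?x s)) has_vector_derivative fst D) (at t)" "((\<lambda>s. ?V s d) has_vector_derivative fst (snd D)) (at t)"
      "((\<lambda>s. ?R s d) has_vector_derivative snd (snd D)) (at t)"
      using 1 3 4 by (simp_all add: bundle_chart_def case_prod_beta')
  qed
  have dfs: "(\<lambda>s. snd d (?x s)) differentiable (at t)" "(\<lambda>s. ?V s d) differentiable (at t)"
     "(\<lambda>s. ?R s d) differentiable (at t)" if "d \<in> charts_at A (?x t)" for d
    using comp[of d "vector_derivative (\<lambda>s. bundle_chart d (\<gamma> s)) (at t)"] df[OF that] vector_derivative_works
    by (blast intro: differentiableI_vector)+
  have ts: "curve_velocity A ?x t \<in> tangent_space A (?x t)" "cov_deriv A g ?x ?V t \<in> tangent_space A (?x t)"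
    "cov_deriv A g ?x ?R t \<in> tangent_space A (?x t)"
    by (intro velocity_tangent cov_deriv_tangent cont dfs evV evR; assumption)+
  have at: "\<alpha> (\<gamma> t) \<in> tangent_space A (?x t)" "\<beta> (\<gamma> t) \<in> tangent_space A (?x t)" "\<delta> (\<gamma> t) \<in> tangent_space A (?x t)"
    using tan by (auto simp: tangent_triple_def split: prod.splits)
  have teq: "X = Y \<longleftrightarrow> X c = Y c" if "X \<in> tangent_space A (?x t)" "Y \<in> tangent_space A (?x t)" for X Y
    using tangent_eqI[OF that c] by blast
  define D where "D = vector_derivative (\<lambda>s. \<kappa> (\<gamma> s)) (at t)"
  have D: "((\<lambda>s. \<kappa> (\<gamma> s)) has_vector_derivative D) (at t)"
    using df[OF c] vector_derivative_works unfolding D_def by blast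
  have co: "M.py (\<kappa> (\<gamma> t)) = snd c (?x t)" "M.pv (\<kappa> (\<gamma> t)) = ?V t c" "M.pr (\<kappa> (\<gamma> t)) = ?R t c"
    by (simp_all add: bundle_chart_def case_prod_beta')
  note vd = comp[OF D, THEN vector_derivative_at]
  have "lift_system A g \<alpha> \<beta> \<delta> ?x ?V ?R t \<longleftrightarrow> curve_velocity A ?x t c = \<alpha> (\<gamma> t) c \<and>
     cov_deriv A g ?x ?V t c = \<beta> (\<gamma> t) c \<and> cov_deriv A g ?x ?R t c = \<delta> (\<gamma> t) c"
    unfolding lift_system_def prod.collapse using teq ts at by meson
  also have "\<dots> \<longleftrightarrow> D = M.lift (\<kappa> (\<gamma> t)) (\<alpha> (\<gamma> t) c) (\<beta> (\<gamma> t) c) (\<delta> (\<gamma> t) c)"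
    unfolding M.lift_def co prod_eq_iff fst_conv snd_conv
    using c vd by (auto simp: curve_velocity_def cov_deriv_def christoffel_eq algebra_simps)
  also have "\<dots> \<longleftrightarrow> ((\<lambda>s. \<kappa> (\<gamma> s)) has_vector_derivative M.lift (\<kappa> (\<gamma> t)) (\<alpha> (\<gamma> t) c) (\<beta> (\<gamma> t) c) (\<delta> (\<gamma> t) c)) (at t)"
    using D vector_derivative_unique_at by blast
  finally show ?thesis .
qed

text \<open>A vector fixed by the derivative of the retraction is the velocity of the retracted straight line, a curve
of curvature radii.\<close>

lemma pt_curve:
  assumes q: "q \<in> P" and S: "open S" "\<kappa> q \<in> S" "S \<subseteq> M.radii_nbhd" and Z: "\<forall>q\<in>P. \<kappa> q \<in> S \<longrightarrow> q \<in> Z"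
    and w: "dd Q.\<rho> (\<kappa> q) w = w"
  defines "\<gamma> \<equiv> \<lambda>s::real. pt (\<kappa> q + s *\<^sub>R w)"
  shows "radii_curve_at A Z \<gamma> 0" "\<gamma> 0 = q" "((\<lambda>s. \<kappa> (\<gamma> s)) has_vector_derivative w) (at 0)"
    "Q.smooth_at q F \<Longrightarrow> ((\<lambda>s. F (\<gamma> s)) has_vector_derivative dd (\<lambda>z. F (pt z)) (\<kappa> q) w) (at 0)"
proof -
  let ?l = "\<lambda>s::real. \<kappa> q + s *\<^sub>R w"
  have l: "(?l has_vector_derivative w) (at 0)"
    by (auto intro!: derivative_eq_intros)
  show g0: "\<gamma> 0 = q" by (simp add: \<gamma>_def pt_kappa[OF q])
  have ch: "((\<lambda>s. f (?l s)) has_vector_derivative dd f (\<kappa> q) w) (at 0)" if "f differentiable (at (\<kappa> q))" for f :: "_ \<Rightarrow> 'z::real_normed_vector"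
  proof -
    have "(f has_derivative dd f (\<kappa> q)) (at (?l 0))" using dd_works[OF that] by simp
    from has_derivative_compose[OF l[unfolded has_vector_derivative_def] this]
    show ?thesis unfolding has_vector_derivative_def
      by (simp add: linear_scale[OF linear_frechet_derivative[OF that]])
  qed
  show F: "((\<lambda>s. F (\<gamma> s)) has_vector_derivative dd (\<lambda>z. F (pt z)) (\<kappa> q) w) (at 0)" if "Q.smooth_at q F"
    unfolding \<gamma>_def using ch[of "\<lambda>z. F (pt z)"] that smooth_on_differentiable unfolding Q.smooth_at_def by blast
  show kd: "((\<lambda>s. \<kappa> (\<gamma> s)) has_vector_derivative w) (at 0)"
    unfolding \<gamma>_def using ch[of "\<lambda>z. \<kappa> (pt z)"] smooth_on_differentiable[OF Q.smooth_rho Q.kappa_in[OF q]] w by simp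
  have ev: "\<forall>\<^sub>F s in nhds 0. ?l s \<in> T" if "open T" "\<kappa> q \<in> T" for T
  proof -
    have "isCont ?l 0" by (intro continuous_intros)
    then have "\<forall>\<^sub>F s in at 0. ?l s \<in> T" using topological_tendstoD[of ?l "?l 0" "at 0" T] that by (simp add: continuous_at)
    then show ?thesis using that by (simp add: eventually_nhds_conv_at)
  qed
  let ?S = "{w \<in> S. \<kappa> (pt w) \<in> S}"
  have S': "open ?S" "\<kappa> q \<in> ?S" using Q.open_rho_vimage[OF S(1,3)] S(2) Q.rho_fix[OF q] by auto
  have in_P: "\<gamma> s \<in> P" and in_Z: "\<gamma> s \<in> Z" if "?l s \<in> ?S" for s
  proof -
    show "\<gamma> s \<in> P" unfolding \<gamma>_def by (rule pt_in) (use that S(3) in blast)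
    then show "\<gamma> s \<in> Z" using Z that by (simp add: \<gamma>_def)
  qed
  have evZ: "\<forall>\<^sub>F s in nhds 0. \<gamma> s \<in> Z" and evP: "\<forall>\<^sub>F s in nhds 0. \<gamma> s \<in> P"
    using ev[OF S'] in_P in_Z by (auto elim!: eventually_mono)
  have cont: "isCont (\<lambda>s. fst (\<gamma> s)) 0"
  proof -
    have "continuous_on (snd c ` fst c) (chart_inv c)"
      using chart_homeomorphism[OF c_in] by (simp add: homeomorphism_def)
    moreover have "M.py (?l 0) \<in> snd c ` fst c" using Q.kappa_in[OF q] by (simp add: M.radii_nbhd_def)
    ultimately have "isCont (chart_inv c) (M.py (?l 0))"
      using open_image[OF c_in] continuous_on_eq_continuous_at by blast
    moreover have "isCont (\<lambda>s. M.py (?l s)) 0" by (intro continuous_intros)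
    ultimately show ?thesis unfolding \<gamma>_def pt_def fst_conv
      by (rule isCont_o2[rotated])
  qed
  have "(\<lambda>s. bundle_chart d (\<gamma> s)) differentiable (at 0)" if d: "d \<in> charts_at A (fst (\<gamma> 0))" for d
  proof -
    have dA: "d \<in> A" "fst q \<in> fst d" using d g0 by (auto simp: charts_at_iff)
    have "open (fst d)" using open_domain dA by blast
    then have "\<forall>\<^sub>F s in at 0. fst (\<gamma> s) \<in> fst d"
      using topological_tendstoD[OF cont[unfolded continuous_at], of "fst d"] g0 dA by simp
    then have "\<forall>\<^sub>F s in nhds 0. fst (\<gamma> s) \<in> fst d" using g0 dA by (simp add: eventually_nhds_conv_at)
    from eventually_conj[OF this evP] obtain T where T: "open T" "0 \<in> T" "\<And>s. s \<in> T \<Longrightarrow> fst (\<gamma> s) \<in> fst d \<and> \<gamma> s \<in> P"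
      unfolding eventually_nhds by blast
    have e: "bundle_transition c d (\<kappa> (\<gamma> s)) = bundle_chart d (\<gamma> s)" if "s \<in> T" for s
    proof -
      obtain x V R where gs: "\<gamma> s = (x, V, R)" by (cases "\<gamma> s")
      have "(x, V, R) \<in> P" "x \<in> fst d" using T(3)[OF that] gs by auto
      then show ?thesis using bundle_transition_bundle[of c x d V R] P_iff[of x V R] dA(1) gs by (auto simp: charts_at_iff)
    qed
    have "\<kappa> q \<in> bundle_overlap c d" using bundle_in_bundle_overlap_iff[OF c_in, of "fst q" "fst (snd q)" "snd (snd q)" d] q dA by (simp add: P_def)
    then have "(bundle_transition c d has_derivative dd (bundle_transition c d) (\<kappa> q)) (at (\<kappa> (\<gamma> 0)))"
      using smooth_on_has_derivative[OF bundle_transition_smooth[OF c_in dA(1)]] g0 by simp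
    from has_derivative_compose[OF kd[unfolded has_vector_derivative_def] this]
    have "(\<lambda>s. bundle_transition c d (\<kappa> (\<gamma> s))) differentiable (at 0)" by (rule differentiableI)
    then show ?thesis using differentiable_cong_open[OF T(1,2), of "\<lambda>s. bundle_transition c d (\<kappa> (\<gamma> s))" "\<lambda>s. bundle_chart d (\<gamma> s)"] e by blast
  qed
  then show "radii_curve_at A Z \<gamma> 0" unfolding radii_curve_at_def using evZ cont by blast
qed

text \<open>\<open>\<xi>\<close> is the coordinate expression on \<open>S\<close> of the field described by \<open>lift_system\<close>.\<close>

definition lift_field where
  "lift_field S \<alpha> \<beta> \<delta> \<xi> \<longleftrightarrow> smooth_on S \<xi> \<and> (\<forall>q\<in>P. \<kappa> q \<in> S \<longrightarrow>
     tangent_triple A g q (\<alpha> q) (\<beta> q) (\<delta> q) \<and> \<xi> (\<kappa> q) = M.lift (\<kappa> q) (\<alpha> q c) (\<beta> q c) (\<delta> q c))"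

text \<open>Through \<open>q\<close> there is a curve of curvature radii with velocity \<open>\<xi> (\<kappa> q)\<close> by \<open>pt_curve\<close>.  It solves the
system at time \<open>0\<close>, so \<open>X\<close> differentiates functions along it.\<close>

lemma generated_represents:
  assumes Z: "radii_open A g Z" and gen: "generated_by A g Z (lift_system A g \<alpha> \<beta> \<delta>) X"
    and S: "open S" "S \<subseteq> M.radii_nbhd" "\<And>q. q \<in> P \<Longrightarrow> \<kappa> q \<in> S \<Longrightarrow> q \<in> Z"
    and field: "lift_field S \<alpha> \<beta> \<delta> \<xi>"
  shows "Q.represents S X \<xi>"
  unfolding Q.represents_def
proof (intro conjI ballI impI allI S(1,2))
  show "smooth_on S \<xi>" using field unfolding lift_field_def by blast
  fix q assume q: "q \<in> P" "\<kappa> q \<in> S"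
  have t: "tangent_triple A g q (\<alpha> q) (\<beta> q) (\<delta> q)"
    and xi: "\<xi> (\<kappa> q) = M.lift (\<kappa> q) (\<alpha> q c) (\<beta> q c) (\<delta> q c)"
    using field q unfolding lift_field_def by blast+
  show tg: "dd Q.\<rho> (\<kappa> q) (\<xi> (\<kappa> q)) = \<xi> (\<kappa> q)"
    using lift_tangent[OF q(1) t] xi by simp
  fix F :: "('m, 'e) radius \<Rightarrow> real" assume F: "Q.smooth_at q F"
  define \<gamma> where "\<gamma> s = pt (\<kappa> q + s *\<^sub>R \<xi> (\<kappa> q))" for s :: real
  have "\<forall>q\<in>P. \<kappa> q \<in> S \<longrightarrow> q \<in> Z" using S(3) by blast
  note cv = pt_curve[OF q(1) S(1) q(2) S(2) this tg, folded \<gamma>_def]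
  have Zs: "Z \<subseteq> curvature_radii A g" using Z unfolding radii_open_def by blast
  have "lift_system A g \<alpha> \<beta> \<delta> (\<lambda>s. fst (\<gamma> s)) (\<lambda>s. fst (snd (\<gamma> s))) (\<lambda>s. snd (snd (\<gamma> s))) 0"
    using system_iff[OF cv(1) Zs, of \<alpha> \<beta> \<delta>] cv(2,3) q(1) t xi by simp
  then have "integral_curve_at A g X \<gamma> 0"
    using gen cv(1) unfolding generated_by_def by blast
  then have "((\<lambda>s. F (\<gamma> s)) has_real_derivative X F q) (at 0)"
    unfolding integral_curve_at_def using F radii_smooth_at_iff[OF q(1), of F] cv(2) by metis
  moreover have "((\<lambda>s. F (\<gamma> s)) has_real_derivative dd (\<lambda>z. F (pt z)) (\<kappa> q) (\<xi> (\<kappa> q))) (at 0)"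
    using cv(4)[OF F] by (simp add: has_real_derivative_iff_has_vector_derivative)
  ultimately show "X F q = dd (\<lambda>z. F (pt z)) (\<kappa> q) (\<xi> (\<kappa> q))" by (rule DERIV_unique)
qed

text \<open>The derivation along \<open>\<xi>\<close> has the required property: if a curve satisfies its integral curve
equation, then testing with the coordinate functions recovers the velocity of the curve.\<close>

lemma generated_exists:
  assumes S: "open S" "S \<subseteq> M.radii_nbhd" and Z: "Z = {q \<in> P. \<kappa> q \<in> S}"
    and field: "lift_field S \<alpha> \<beta> \<delta> \<xi>"
  shows "\<exists>X. generated_by A g Z (lift_system A g \<alpha> \<beta> \<delta>) X"
proof -
  have smooth: "smooth_on S \<xi>" and tan: "\<And>q. q \<in> Z \<Longrightarrow> tangent_triple A g q (\<alpha> q) (\<beta> q) (\<delta> q)"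
    and xi: "\<And>q. q \<in> Z \<Longrightarrow> \<xi> (\<kappa> q) = M.lift (\<kappa> q) (\<alpha> q c) (\<beta> q c) (\<delta> q c)"
    using field Z unfolding lift_field_def by blast+
  define X where "X F q = dd (\<lambda>z. F (pt z)) (\<kappa> q) (\<xi> (\<kappa> q))" for F :: "('m, 'e) radius \<Rightarrow> real" and q
  have tg: "dd Q.\<rho> (\<kappa> q) (\<xi> (\<kappa> q)) = \<xi> (\<kappa> q)" if "q \<in> Z" for q
    using lift_tangent[OF _ tan[OF that]] xi[OF that] that Z by simp
  have represents: "Q.represents S X \<xi>" unfolding Q.represents_def using S smooth tg Z by (auto simp: X_def)
  have "generated_by A g Z (lift_system A g \<alpha> \<beta> \<delta>) X"
    unfolding generated_by_def
  proof (intro conjI allI impI)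
    show "radii_vector_field A g Z X"
      unfolding radii_vector_field_def
    proof (intro ballI allI impI)
      fix q and F H :: "('m, 'e) radius \<Rightarrow> real" assume q: "q \<in> Z" and FH: "radii_smooth_at A g q F \<and> radii_smooth_at A g q H"
      have qP: "q \<in> P" "\<kappa> q \<in> S" using q Z by auto
      have sm: "Q.smooth_at q F" "Q.smooth_at q H" using FH radii_smooth_at_iff[OF qP(1)] by auto
      have d: "((\<lambda>z. F (pt z)) has_derivative dd (\<lambda>z. F (pt z)) (\<kappa> q)) (at (\<kappa> q))"
         "((\<lambda>z. H (pt z)) has_derivative dd (\<lambda>z. H (pt z)) (\<kappa> q)) (at (\<kappa> q))"
        using sm smooth_on_has_derivative unfolding Q.smooth_at_def by blast+
      have 1: "((\<lambda>z. a * F (pt z) + b * H (pt z)) has_derivative (\<lambda>v. a * dd (\<lambda>z. F (pt z)) (\<kappa> q) v + b * dd (\<lambda>z. H (pt z)) (\<kappa> q) v)) (at (\<kappa> q))" for a b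
        by (intro has_derivative_add has_derivative_mult_right d)
      have 2: "((\<lambda>z. F (pt z) * H (pt z)) has_derivative (\<lambda>v. F (pt (\<kappa> q)) * dd (\<lambda>z. H (pt z)) (\<kappa> q) v + dd (\<lambda>z. F (pt z)) (\<kappa> q) v * H (pt (\<kappa> q)))) (at (\<kappa> q))"
        by (intro has_derivative_mult d)
      show "radii_smooth_at A g q (X F) \<and> (\<forall>a b. X (\<lambda>q. a * F q + b * H q) q = a * X F q + b * X H q) \<and>
        X (\<lambda>q. F q * H q) q = F q * X H q + H q * X F q"
        using Q.represents_smooth[OF represents qP sm(1)] radii_smooth_at_iff[OF qP(1), of "X F"] dd_eqI[OF 1] dd_eqI[OF 2] pt_kappa[OF qP(1)]
        by (simp add: X_def)
    qed
    fix \<gamma> t assume cv: "radii_curve_at A Z \<gamma> t"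
    have evZ: "\<forall>\<^sub>F s in nhds t. \<gamma> s \<in> Z" using cv unfolding radii_curve_at_def by blast
    have q: "\<gamma> t \<in> Z" using evZ by (rule eventually_nhds_x_imp_x)
    have qP: "\<gamma> t \<in> P" "\<kappa> (\<gamma> t) \<in> S" using q Z by auto
    have evP: "\<forall>\<^sub>F s in nhds t. \<gamma> s \<in> P" using evZ by (rule eventually_mono) (simp add: Z)
    have Zs: "Z \<subseteq> curvature_radii A g" using Z P_radii by blast
    have "integral_curve_at A g X \<gamma> t \<longleftrightarrow> ((\<lambda>s. \<kappa> (\<gamma> s)) has_vector_derivative \<xi> (\<kappa> (\<gamma> t))) (at t)"
    proof
      assume "((\<lambda>s. \<kappa> (\<gamma> s)) has_vector_derivative \<xi> (\<kappa> (\<gamma> t))) (at t)"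
      from Q.curve_derivative[OF evP this] show "integral_curve_at A g X \<gamma> t"
        unfolding integral_curve_at_def radii_smooth_at_iff[OF qP(1)] X_def has_real_derivative_iff_has_vector_derivative by blast
    next
      assume i: "integral_curve_at A g X \<gamma> t"
      have "(\<lambda>s. \<kappa> (\<gamma> s)) differentiable (at t)" using cv P_charts[OF qP(1)] unfolding radii_curve_at_def by blast
      then obtain D where D: "((\<lambda>s. \<kappa> (\<gamma> s)) has_vector_derivative D) (at t)" using vector_derivative_works by blast
      have "D = \<xi> (\<kappa> (\<gamma> t))"
      proof (rule euclidean_eqI)
        fix b :: "'e \<times> 'e \<times> 'e"
        have "((\<lambda>s. \<kappa> (\<gamma> s) \<bullet> b) has_real_derivative X (\<lambda>p. \<kappa> p \<bullet> b) (\<gamma> t)) (at t)"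
          using i Q.smooth_at_coordinate[OF qP(1)] radii_smooth_at_iff[OF qP(1)] unfolding integral_curve_at_def by blast
        moreover have "X (\<lambda>p. \<kappa> p \<bullet> b) (\<gamma> t) = \<xi> (\<kappa> (\<gamma> t)) \<bullet> b"
          unfolding X_def Q.dd_coordinate[OF qP(1)] tg[OF q] by simp
        moreover have "((\<lambda>s. \<kappa> (\<gamma> s) \<bullet> b) has_real_derivative D \<bullet> b) (at t)"
          using bounded_linear.has_vector_derivative[OF bounded_linear_inner_left D]
          by (simp add: has_real_derivative_iff_has_vector_derivative)
        ultimately show "D \<bullet> b = \<xi> (\<kappa> (\<gamma> t)) \<bullet> b" using DERIV_unique by metis
      qed
      then show "((\<lambda>s. \<kappa> (\<gamma> s)) has_vector_derivative \<xi> (\<kappa> (\<gamma> t))) (at t)" using D by simp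
    qed
    then show "integral_curve_at A g X \<gamma> t \<longleftrightarrow>
        lift_system A g \<alpha> \<beta> \<delta> (\<lambda>s. fst (\<gamma> s)) (\<lambda>s. fst (snd (\<gamma> s))) (\<lambda>s. snd (snd (\<gamma> s))) t"
      using system_iff[OF cv Zs qP(1), of \<alpha> \<beta> \<delta>, OF tan[OF q]] xi[OF q] by simp
  qed
  then show ?thesis by blast
qed

end

section \<open>Brackets of the adapted fields\<close>

context metric_field
begin

definition bracket :: "('e \<times> 'e \<times> 'e \<Rightarrow> 'e \<times> 'e \<times> 'e) \<Rightarrow> ('e \<times> 'e \<times> 'e \<Rightarrow> 'e \<times> 'e \<times> 'e) \<Rightarrow> 'e \<times> 'e \<times> 'e \<Rightarrow> 'e \<times> 'e \<times> 'e" where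
  "bracket \<xi> \<eta> z = dd \<eta> z (\<xi> z) - dd \<xi> z (\<eta> z)"

text \<open>\<open>xi1\<close> and \<open>xi2\<close> represent \<open>f\<^sub>1\<close> and \<open>f\<^sub>2\<close>; \<open>horiz_v\<close> and \<open>horiz_r\<close> are the horizontal lifts of \<open>v\<close> and \<open>r\<close>.\<close>

definition xi1 :: "'e \<times> 'e \<times> 'e \<Rightarrow> 'e \<times> 'e \<times> 'e" where
  "xi1 z = (pv z, pr z - chr G (py z) (pv z) (pv z), - pv z - chr G (py z) (pv z) (pr z))"
definition xi2 :: "'e \<times> 'e \<times> 'e \<Rightarrow> 'e \<times> 'e \<times> 'e" where
  "xi2 z = (0, pv z, pr z)"
definition horiz_v :: "'e \<times> 'e \<times> 'e \<Rightarrow> 'e \<times> 'e \<times> 'e" where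
  "horiz_v z = (pv z, - chr G (py z) (pv z) (pv z), - chr G (py z) (pv z) (pr z))"
definition horiz_r :: "'e \<times> 'e \<times> 'e \<Rightarrow> 'e \<times> 'e \<times> 'e" where
  "horiz_r z = (pr z, - chr G (py z) (pr z) (pv z), - chr G (py z) (pr z) (pr z))"

lemma bracket_swap: "bracket \<xi> \<eta> z = - bracket \<eta> \<xi> z" by (simp add: bracket_def)

lemma xi1_deriv:
  assumes "py z \<in> U"
  shows "(xi1 has_derivative (\<lambda>w. (pv w,
    pr w - (dchr (py z) (py w) (pv z) (pv z) + chr G (py z) (pv w) (pv z) + chr G (py z) (pv z) (pv w)),
    - pv w - (dchr (py z) (py w) (pv z) (pr z) + chr G (py z) (pv w) (pr z) + chr G (py z) (pv z) (pr w))))) (at z)"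
  unfolding xi1_def[abs_def]
  by (intro has_derivative_Pair has_derivative_diff has_derivative_minus chr_comp_deriv proj_deriv assms)

lemma xi2_deriv: "(xi2 has_derivative (\<lambda>w. (0, pv w, pr w))) (at z)"
  unfolding xi2_def[abs_def] by (intro has_derivative_Pair has_derivative_const proj_deriv)

lemma horiz_v_deriv:
  assumes "py z \<in> U"
  shows "(horiz_v has_derivative (\<lambda>w. (pv w,
    - (dchr (py z) (py w) (pv z) (pv z) + chr G (py z) (pv w) (pv z) + chr G (py z) (pv z) (pv w)),
    - (dchr (py z) (py w) (pv z) (pr z) + chr G (py z) (pv w) (pr z) + chr G (py z) (pv z) (pr w))))) (at z)"
  unfolding horiz_v_def[abs_def]
  by (intro has_derivative_Pair has_derivative_minus chr_comp_deriv proj_deriv assms)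

lemma horiz_r_deriv:
  assumes "py z \<in> U"
  shows "(horiz_r has_derivative (\<lambda>w. (pr w,
    - (dchr (py z) (py w) (pr z) (pv z) + chr G (py z) (pr w) (pv z) + chr G (py z) (pr z) (pv w)),
    - (dchr (py z) (py w) (pr z) (pr z) + chr G (py z) (pr w) (pr z) + chr G (py z) (pr z) (pr w))))) (at z)"
  unfolding horiz_r_def[abs_def]
  by (intro has_derivative_Pair has_derivative_minus chr_comp_deriv proj_deriv assms)

lemma bracket_xi2_xi1:
  assumes y: "py z \<in> U" shows "bracket xi2 xi1 z = horiz_v z"
  unfolding bracket_def dd_eqI[OF xi1_deriv[OF y]] dd_eqI[OF xi2_deriv]
  by (simp add: xi1_def xi2_def horiz_v_def chr_zero y linear_0[OF dchr_linear(1)[OF y]])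

lemma bracket_xi1_horiz_v:
  assumes y: "py z \<in> U" shows "bracket xi1 horiz_v z = horiz_r z"
  unfolding bracket_def dd_eqI[OF xi1_deriv[OF y]] dd_eqI[OF horiz_v_deriv[OF y]]
  using chr_sym[OF y, of "pr z" "pv z"] by (simp add: xi1_def horiz_r_def horiz_v_def chr_simps y)

text \<open>The bracket of the horizontal fields \<open>horiz_v\<close> and \<open>horiz_r\<close> is the curvature term; the vertical part
\<open>(0, r, - v)\<close> of \<open>xi1\<close> rotates \<open>horiz_r\<close> into \<open>- horiz_v\<close>.\<close>

lemma bracket_xi1_horiz_r:
  assumes y: "py z \<in> U"
  shows "py (bracket xi1 horiz_r z) = - pv z"
    and "pv (bracket xi1 horiz_r z) = chr G (py z) (pv z) (pv z) - curv G (py z) (pv z) (pr z) (pv z)"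
proof -
  have s: "dchr (py z) w (pv z) (pr z) = dchr (py z) w (pr z) (pv z)" for w
    by (rule fun_cong[OF dd_cong_open[OF openU y]]) (rule chr_sym)
  show "py (bracket xi1 horiz_r z) = - pv z"
    unfolding bracket_def dd_eqI[OF xi1_deriv[OF y]] dd_eqI[OF horiz_r_deriv[OF y]]
    using chr_sym[OF y, of "pr z" "pv z"] by (simp add: xi1_def horiz_r_def)
  show "pv (bracket xi1 horiz_r z) = chr G (py z) (pv z) (pv z) - curv G (py z) (pv z) (pr z) (pv z)"
    unfolding bracket_def dd_eqI[OF xi1_deriv[OF y]] dd_eqI[OF horiz_r_deriv[OF y]] curv_def
    using chr_sym[OF y, of "pr z" "pv z"] chr_sym[OF y, of "chr G (py z) (pv z) (pr z)" "pv z"]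
    by (simp add: xi1_def horiz_r_def chr_simps y s)
qed

lemma vertical_deriv:
  assumes "B differentiable (at z)"
  shows "((\<lambda>z. (0, 0, B z)) has_derivative (\<lambda>w. (0, 0, dd B z w))) (at z)"
  by (intro has_derivative_Pair has_derivative_const dd_works assms)

lemma bracket_xi1_vertical:
  assumes y: "py z \<in> U" and B: "B differentiable (at z)"
  shows "py (bracket xi1 (\<lambda>z. (0, 0, B z)) z) = 0" "pv (bracket xi1 (\<lambda>z. (0, 0, B z)) z) = - B z"
  unfolding bracket_def dd_eqI[OF xi1_deriv[OF y]] dd_eqI[OF vertical_deriv[OF B]]
  by (simp_all add: xi1_def chr_zero y linear_0[OF dchr_linear(1)[OF y]])

text \<open>The base part of the inner bracket is identically zero, so only the derivative of the base part \<open>v\<close> of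
\<open>xi1\<close> along the \<open>v\<close>-part of the inner bracket contributes.\<close>

lemma bracket_xi1_bracket_vertical:
  assumes S: "open S" "z \<in> S" "\<And>z. z \<in> S \<Longrightarrow> py z \<in> U" and B: "smooth_on S B"
    and sm: "smooth_on S (bracket (\<lambda>z. (0, 0, B z)) xi1)"
  shows "py (bracket xi1 (bracket (\<lambda>z. (0, 0, B z)) xi1) z) = - B z"
proof -
  let ?\<eta> = "bracket (\<lambda>z. (0, 0, B z)) xi1"
  have e: "py (?\<eta> w) = 0" "pv (?\<eta> w) = B w" if "w \<in> S" for w
    using bracket_xi1_vertical[OF S(3)[OF that] smooth_on_differentiable[OF B that]]
    by (simp_all add: bracket_swap[of "\<lambda>z. (0, 0, B z)"])
  have "((\<lambda>w. py (?\<eta> w)) has_derivative (\<lambda>d. py (dd ?\<eta> z d))) (at z)"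
    by (rule has_derivative_fst[OF smooth_on_has_derivative[OF sm S(2)]])
  moreover have "((\<lambda>w. py (?\<eta> w)) has_derivative (\<lambda>d. 0)) (at z)"
    using has_derivative_cong_open[OF S(1,2), of "\<lambda>w. py (?\<eta> w)" "\<lambda>w. 0"] e(1) by simp
  ultimately have "(\<lambda>d. py (dd ?\<eta> z d)) = (\<lambda>d. 0)" by (rule has_derivative_unique)
  then have "py (dd ?\<eta> z (xi1 z)) = 0" by (rule fun_cong)
  then show ?thesis
    using e(2)[OF S(2)] unfolding bracket_def[of xi1 ?\<eta>] by (simp add: dd_eqI[OF xi1_deriv[OF S(3)[OF S(2)]]])
qed

lemma xi_smooth:
  assumes "open S" "\<And>z. z \<in> S \<Longrightarrow> py z \<in> U"
  shows "smooth_on S xi1" "smooth_on S xi2"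
  unfolding xi1_def[abs_def] xi2_def[abs_def]
  by (intro smooth_on_Pair smooth_on_diff smooth_on_uminus smooth_on_const smooth_chr_comp smooth_proj assms; assumption)+

end

context riemannian_manifold
begin

lemma f1_lift: "f1_system A g = lift_system A g (\<lambda>(x, V, R). V) (\<lambda>(x, V, R). R) (\<lambda>(x, V, R) c. - V c)"
  by (intro ext) (auto simp: f1_system_def lift_system_def)

lemma f2_lift: "f2_system A = lift_system A g (\<lambda>_ _. 0) (\<lambda>(x, V, R). V) (\<lambda>(x, V, R). R)"
  using cov_deriv_static by (intro ext) (auto simp: f2_system_def lift_system_def)

lemma fj_lift: "fj_system A b = lift_system A g (\<lambda>_ _. 0) (\<lambda>_ _. 0) b"
  using cov_deriv_static by (intro ext) (auto simp: fj_system_def lift_system_def)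

lemma curvature_radiiD:
  assumes "(x, V, R) \<in> curvature_radii A g"
  shows "V \<in> tangent_space A x" "R \<in> tangent_space A x" "g x R V = 0" "g x V R = 0" "g x R R = g x V V" "g x V V > 0"
proof -
  show V: "V \<in> tangent_space A x" and R: "R \<in> tangent_space A x" and o: "g x R V = 0"
    using assms by (auto simp: curvature_radii_def)
  then show "g x V R = 0" using metric_sym[OF V R] by simp
  show "g x R R = g x V V" "g x V V > 0" using assms by (auto simp: curvature_radii_def gnorm_def)
qed

lemma g_uminus: "u \<in> tangent_space A x \<Longrightarrow> v \<in> tangent_space A x \<Longrightarrow> g x (\<lambda>c. - u c) v = - g x u v"
  using metric_linear[of u x u v "-1" 0] by simp

lemma g_zero: "v \<in> tangent_space A x \<Longrightarrow> g x (\<lambda>_. 0) v = 0" "v \<in> tangent_space A x \<Longrightarrow> g x v (\<lambda>_. 0) = 0"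
  using metric_linear[OF tangent_zero tangent_zero, of v x 0 0] metric_sym[OF tangent_zero, of v x] by auto

lemma tangent_triple_f1:
  assumes "(x, V, R) \<in> curvature_radii A g"
  shows "tangent_triple A g (x, V, R) V R (\<lambda>c. - V c)"
  using curvature_radiiD[OF assms] tangent_uminus by (simp add: tangent_triple_def g_uminus)

lemma tangent_triple_f2:
  assumes "(x, V, R) \<in> curvature_radii A g"
  shows "tangent_triple A g (x, V, R) (\<lambda>_. 0) V R"
  using curvature_radiiD[OF assms] tangent_zero by (simp add: tangent_triple_def)

lemma tangent_triple_fj:
  assumes "(x, V, R) \<in> curvature_radii A g" "b \<in> tangent_space A x" "g x b R = 0" "g x b V = 0"
  shows "tangent_triple A g (x, V, R) (\<lambda>_. 0) (\<lambda>_. 0) b"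
  using curvature_radiiD[OF assms(1)] tangent_zero assms by (simp add: tangent_triple_def g_zero)

end

context radii_chart
begin

lemma f1_field:
  assumes "open S" "S \<subseteq> M.radii_nbhd"
  shows "lift_field S (\<lambda>(x, V, R). V) (\<lambda>(x, V, R). R) (\<lambda>(x, V, R) c. - V c) M.xi1"
  unfolding lift_field_def
proof (intro conjI ballI impI)
  show "smooth_on S M.xi1" using M.xi_smooth[OF assms(1)] assms(2) by (auto simp: M.radii_nbhd_def)
  fix q assume "q \<in> P"
  then show "tangent_triple A g q ((\<lambda>(x, V, R). V) q) ((\<lambda>(x, V, R). R) q) ((\<lambda>(x, V, R) c. - V c) q)"
    using tangent_triple_f1 P_radii by (cases q) auto
  show "M.xi1 (\<kappa> q) = M.lift (\<kappa> q) ((\<lambda>(x, V, R). V) q c) ((\<lambda>(x, V, R). R) q c) ((\<lambda>(x, V, R) c. - V c) q c)"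
    by (cases q) (simp add: M.xi1_def M.lift_def bundle_chart_def)
qed

lemma f2_field:
  assumes "open S" "S \<subseteq> M.radii_nbhd"
  shows "lift_field S (\<lambda>_ _. 0) (\<lambda>(x, V, R). V) (\<lambda>(x, V, R). R) M.xi2"
  unfolding lift_field_def
proof (intro conjI ballI impI)
  show "smooth_on S M.xi2" using M.xi_smooth[OF assms(1)] assms(2) by (auto simp: M.radii_nbhd_def)
  fix q assume q: "q \<in> P"
  then show "tangent_triple A g q (\<lambda>_. 0) ((\<lambda>(x, V, R). V) q) ((\<lambda>(x, V, R). R) q)"
    using tangent_triple_f2 P_radii by (cases q) auto
  have "M.py (\<kappa> q) \<in> snd c ` fst c" using kappa_radii[OF q] by (simp add: M.radii_def)
  then show "M.xi2 (\<kappa> q) = M.lift (\<kappa> q) 0 ((\<lambda>(x, V, R). V) q c) ((\<lambda>(x, V, R). R) q c)"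
    using M.chr_zero[of "M.py (\<kappa> q)"] by (cases q) (simp add: M.xi2_def M.lift_def bundle_chart_def)
qed

lemma fj_field:
  assumes "open S" "smooth_on S (\<lambda>z. b j (pt z) c)" "\<And>q. q \<in> P \<Longrightarrow> \<kappa> q \<in> S \<Longrightarrow> q \<in> Z"
    and "orthogonal_frame A g Z b" "j \<in> {3..DIM('e)}"
  shows "lift_field S (\<lambda>_ _. 0) (\<lambda>_ _. 0) (b j) (\<lambda>z. (0, 0, b j (pt z) c))"
  unfolding lift_field_def
proof (intro conjI ballI impI)
  show "smooth_on S (\<lambda>z. (0, 0, b j (pt z) c))" by (intro smooth_on_Pair smooth_on_const assms)
  fix q assume q: "q \<in> P" "\<kappa> q \<in> S"
  obtain x V R where e: "q = (x, V, R)" by (cases q)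
  have "b j (x, V, R) \<in> tangent_space A x" "g x (b j (x, V, R)) R = 0" "g x (b j (x, V, R)) V = 0"
    using bspec[OF assms(4)[unfolded orthogonal_frame_def] assms(3)[OF q]] assms(5) e by simp_all
  then show "tangent_triple A g q (\<lambda>_. 0) (\<lambda>_. 0) (b j q)" using tangent_triple_fj P_radii[OF q(1)] e by blast
  have "M.py (\<kappa> q) \<in> snd c ` fst c" using kappa_radii[OF q(1)] by (simp add: M.radii_def)
  then show "(0, 0, b j (pt (\<kappa> q)) c) = M.lift (\<kappa> q) 0 0 (b j q c)"
    using M.chr_zero[of "M.py (\<kappa> q)"] pt_kappa[OF q(1)] by (simp add: M.lift_def)
qed

end

text \<open>The fields \<open>f\<^sub>1\<close> and \<open>f\<^sub>2\<close> differ in form from the \<open>f\<^sub>j\<close> with \<open>j \<ge> 3\<close>.\<close>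

lemma sum_split_12:
  fixes f :: "nat \<Rightarrow> 'a::comm_monoid_add"
  assumes "n \<ge> 2"
  shows "(\<Sum>i=1..n. f i) = f 1 + f 2 + (\<Sum>i=3..n. f i)" "(\<Sum>i=2..n. f i) = f 2 + (\<Sum>i=3..n. f i)"
proof -
  show 2: "(\<Sum>i=2..n. f i) = f 2 + (\<Sum>i=3..n. f i)"
    using assms sum.atLeast_Suc_atMost[of 2 n f] by (simp add: numeral_eq_Suc)
  show "(\<Sum>i=1..n. f i) = f 1 + f 2 + (\<Sum>i=3..n. f i)"
    using assms sum.atLeast_Suc_atMost[of 1 n f] 2 by (simp add: numeral_eq_Suc add.assoc)
qed

section \<open>The expansion in coordinates\<close>

locale adapted_chart = radii_chart A g c
  for A :: "('m::{t2_space, second_countable_topology}, 'e::euclidean_space) chart set" and g c +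
  fixes S :: "('e \<times> 'e \<times> 'e) set" and Z and b and f
  assumes dim: "DIM('e) \<ge> 2"
    and S: "open S" "S \<subseteq> M.radii_nbhd" and SZ: "\<And>q. q \<in> P \<Longrightarrow> \<kappa> q \<in> S \<Longrightarrow> q \<in> Z"
    and Z: "radii_open A g Z"
    and frame: "orthogonal_frame A g Z b"
    and bsmooth: "\<And>j. j \<in> {3..DIM('e)} \<Longrightarrow> smooth_on S (\<lambda>z. b j (pt z) c)"
    and fields: "adapted_fields A g Z b f"
begin

definition xj :: "nat \<Rightarrow> 'e \<times> 'e \<times> 'e \<Rightarrow> 'e \<times> 'e \<times> 'e" where
  "xj j z = (0, 0, b j (pt z) c)"

lemma SU: "z \<in> S \<Longrightarrow> M.py z \<in> snd c ` fst c"
  using S(2) by (auto simp: M.radii_nbhd_def)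

lemma frameD:
  assumes "(x, V, R) \<in> Z"
  shows "j \<in> {3..DIM('e)} \<Longrightarrow> b j (x, V, R) \<in> tangent_space A x"
    "j \<in> {3..DIM('e)} \<Longrightarrow> g x (b j (x, V, R)) R = 0"
    "j \<in> {3..DIM('e)} \<Longrightarrow> g x (b j (x, V, R)) V = 0"
    "j \<in> {3..DIM('e)} \<Longrightarrow> gnorm g x (b j (x, V, R)) = gnorm g x R"
    "i \<in> {3..DIM('e)} \<Longrightarrow> j \<in> {3..DIM('e)} \<Longrightarrow> i \<noteq> j \<Longrightarrow> g x (b i (x, V, R)) (b j (x, V, R)) = 0"
    "u \<in> tangent_space A x \<Longrightarrow> g x u R = 0 \<Longrightarrow> g x u V = 0 \<Longrightarrow> \<exists>a. u = (\<lambda>c. \<Sum>j=3..DIM('e). a j *\<^sub>R b j (x, V, R) c)"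
  using bspec[OF frame[unfolded orthogonal_frame_def] assms] by simp_all

lemma represents_f1: "Q.represents S (f 1) M.xi1"
  using generated_represents[OF Z _ S SZ f1_field[OF S]] fields by (simp add: adapted_fields_def f1_lift)

lemma represents_f2: "Q.represents S (f 2) M.xi2"
  using generated_represents[OF Z _ S SZ f2_field[OF S]] fields by (simp add: adapted_fields_def f2_lift)

lemma represents_fj: "j \<in> {3..DIM('e)} \<Longrightarrow> Q.represents S (f j) (xj j)"
  using generated_represents[OF Z _ S SZ fj_field[OF S(1) bsmooth SZ frame]] fields
  by (simp add: adapted_fields_def fj_lift xj_def[abs_def])

lemma represents_lie: "Q.represents S X \<xi> \<Longrightarrow> Q.represents S Y \<eta> \<Longrightarrow> Q.represents S (lie_bracket X Y) (M.bracket \<xi> \<eta>)"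
  using Q.represents_bracket[of S X \<xi> Y \<eta>] unfolding lie_bracket_def M.bracket_def[abs_def] by simp

lemma represents_f21: "Q.represents S (lie_bracket (f 2) (f 1)) M.horiz_v"
  by (rule Q.represents_cong[OF represents_lie[OF represents_f2 represents_f1]]) (use M.bracket_xi2_xi1 SU in blast)

lemma represents_f12: "Q.represents S (lie_bracket (f 1) (f 2)) (\<lambda>z. - M.horiz_v z)"
  by (rule Q.represents_cong[OF represents_lie[OF represents_f1 represents_f2]]) (use M.bracket_xi2_xi1 SU M.bracket_swap[of M.xi1] in auto)

lemma represents_f121: "Q.represents S (lie_bracket (f 1) (lie_bracket (f 2) (f 1))) M.horiz_r"
  by (rule Q.represents_cong[OF represents_lie[OF represents_f1 represents_f21]]) (use M.bracket_xi1_horiz_v SU in blast)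

lemmas represents_f1121 = represents_lie[OF represents_f1 represents_f121]
lemmas represents_f1j = represents_lie[OF represents_f1 represents_fj]
lemmas represents_f1j1 = represents_lie[OF represents_f1 represents_lie[OF represents_fj represents_f1]]

text \<open>The right-hand side of the expansion with coefficients \<open>k\<close>, where \<open>f\<^sub>1\<^sub>2\<close> and \<open>f\<^sub>1\<^sub>2\<^sub>1\<close> have the indices
\<open>n + 1\<close> and \<open>2 * n\<close>.\<close>

definition frame_comb :: "(nat \<Rightarrow> real) \<Rightarrow> 'e \<times> 'e \<times> 'e \<Rightarrow> 'e \<times> 'e \<times> 'e" where
  "frame_comb k z = (let n = DIM('e) in k 1 *\<^sub>R M.xi1 z + k 2 *\<^sub>R M.xi2 z + (\<Sum>j=3..n. k j *\<^sub>R xj j z)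
     + (k (n + 1) *\<^sub>R (- M.horiz_v z) + (\<Sum>j=3..n. k (n + j - 1) *\<^sub>R M.bracket M.xi1 (xj j) z))
     + (k (2 * n) *\<^sub>R M.horiz_r z + (\<Sum>j=3..n. k (2 * n + j - 2) *\<^sub>R M.bracket M.xi1 (M.bracket (xj j) M.xi1) z)))"

lemma expansion_apply:
  assumes q: "q \<in> P" "\<kappa> q \<in> S" and F: "Q.smooth_at q F"
  defines "n \<equiv> DIM('e)"
  shows "(\<Sum>i=1..n. k i * f i F q) + (\<Sum>i=2..n. k (n + i - 1) * lie_bracket (f 1) (f i) F q)
          + (\<Sum>i=2..n. k (2 * n + i - 2) * lie_bracket (f 1) (lie_bracket (f i) (f 1)) F q)
     = dd (\<lambda>z. F (pt z)) (\<kappa> q) (frame_comb k (\<kappa> q))"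
proof -
  let ?L = "dd (\<lambda>z. F (pt z)) (\<kappa> q)"
  have L: "linear ?L"
    using F smooth_on_linear_dd unfolding Q.smooth_at_def by blast
  note app = Q.represents_apply[OF _ q F]
  have n2: "n \<ge> 2" using dim by (simp add: n_def)
  have j: "f i F q = ?L (xj i (\<kappa> q))" "lie_bracket (f 1) (f i) F q = ?L (M.bracket M.xi1 (xj i) (\<kappa> q))"
      "lie_bracket (f 1) (lie_bracket (f i) (f 1)) F q = ?L (M.bracket M.xi1 (M.bracket (xj i) M.xi1) (\<kappa> q))"
    if "i \<in> {3..n}" for i
    using app[OF represents_fj] app[OF represents_f1j] app[OF represents_f1j1] that by (auto simp: n_def)
  have i: "n + 2 - 1 = n + 1" "2 * n + 2 - 2 = 2 * n" by simp_all
  show ?thesis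
    unfolding sum_split_12[OF n2] frame_comb_def Let_def n_def[symmetric] i
    by (simp only: app[OF represents_f1] app[OF represents_f2] app[OF represents_f12] app[OF represents_f121] j linear_add[OF L] linear_scale[OF L]
      linear_sum[OF L] real_scaleR_def cong: sum.cong)
qed

lemma frame_comb_tangent:
  assumes q: "q \<in> P" "\<kappa> q \<in> S"
  shows "dd Q.\<rho> (\<kappa> q) (frame_comb k (\<kappa> q)) = frame_comb k (\<kappa> q)"
proof -
  have z: "\<kappa> q \<in> M.radii_nbhd" using Q.kappa_in[OF q(1)] .
  have lin: "linear (dd Q.\<rho> (\<kappa> q))" by (rule smooth_on_linear_dd[OF Q.smooth_rho z])
  note t = Q.represents_tangent[OF _ q]
  show ?thesis
    unfolding frame_comb_def Let_def
    by (simp only: linear_add[OF lin] linear_scale[OF lin] linear_sum[OF lin] t[OF represents_f1] t[OF represents_f2] t[OF represents_f12]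
      t[OF represents_f121] t[OF represents_fj] t[OF represents_f1j] t[OF represents_f1j1] cong: sum.cong)
qed

text \<open>Tested on the coordinate functions, the identity of derivations becomes an identity of vectors, because
both sides are tangent.\<close>

lemma expansion_iff:
  assumes q: "q \<in> P" "\<kappa> q \<in> S"
  defines "n \<equiv> DIM('e)"
  shows "(\<forall>F. radii_smooth_at A g q F \<longrightarrow>
        lie_bracket (f 1) (lie_bracket (f 1) (lie_bracket (f 2) (f 1))) F q =
            (\<Sum>i=1..n. k i * f i F q) + (\<Sum>i=2..n. k (n + i - 1) * lie_bracket (f 1) (f i) F q)
          + (\<Sum>i=2..n. k (2 * n + i - 2) * lie_bracket (f 1) (lie_bracket (f i) (f 1)) F q)) \<longleftrightarrow>
     M.bracket M.xi1 M.horiz_r (\<kappa> q) = frame_comb k (\<kappa> q)" (is "?A \<longleftrightarrow> ?B")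
proof
  assume e: ?B
  show ?A
  proof (intro allI impI)
    fix F :: "('m, 'e) radius \<Rightarrow> real" assume "radii_smooth_at A g q F"
    then have s: "Q.smooth_at q F" using radii_smooth_at_iff[OF q(1)] by blast
    show "lie_bracket (f 1) (lie_bracket (f 1) (lie_bracket (f 2) (f 1))) F q =
            (\<Sum>i=1..n. k i * f i F q) + (\<Sum>i=2..n. k (n + i - 1) * lie_bracket (f 1) (f i) F q)
          + (\<Sum>i=2..n. k (2 * n + i - 2) * lie_bracket (f 1) (lie_bracket (f i) (f 1)) F q)"
      unfolding n_def expansion_apply[OF q s] Q.represents_apply[OF represents_f1121 q s] e ..
  qed
next
  assume e: ?A
  note tc = frame_comb_tangent[OF q] and t = Q.represents_tangent[OF _ q]
  show ?B
  proof (rule euclidean_eqI)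
    fix u :: "'e \<times> 'e \<times> 'e"
    have s: "Q.smooth_at q (\<lambda>p. \<kappa> p \<bullet> u)" by (rule Q.smooth_at_coordinate[OF q(1)])
    then have "dd (\<lambda>z. \<kappa> (pt z) \<bullet> u) (\<kappa> q) (M.bracket M.xi1 M.horiz_r (\<kappa> q)) = dd (\<lambda>z. \<kappa> (pt z) \<bullet> u) (\<kappa> q) (frame_comb k (\<kappa> q))"
      using e expansion_apply[OF q s, of k] Q.represents_apply[OF represents_f1121 q s] radii_smooth_at_iff[OF q(1), of "\<lambda>p. \<kappa> p \<bullet> u"]
      unfolding n_def by simp
    then show "M.bracket M.xi1 M.horiz_r (\<kappa> q) \<bullet> u = frame_comb k (\<kappa> q) \<bullet> u"
      unfolding Q.dd_coordinate[OF q(1)] tc t[OF represents_f1121] .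
  qed
qed

lemma xj_bracket:
  assumes "j \<in> {3..DIM('e)}" "z \<in> S"
  shows "M.py (M.bracket M.xi1 (xj j) z) = 0" "M.pv (M.bracket M.xi1 (xj j) z) = - b j (pt z) c"
    "M.py (M.bracket M.xi1 (M.bracket (xj j) M.xi1) z) = - b j (pt z) c"
proof -
  have d: "(\<lambda>z. b j (pt z) c) differentiable (at z)" by (rule smooth_on_differentiable[OF bsmooth[OF assms(1)] assms(2)])
  show "M.py (M.bracket M.xi1 (xj j) z) = 0" "M.pv (M.bracket M.xi1 (xj j) z) = - b j (pt z) c"
    using M.bracket_xi1_vertical[OF SU[OF assms(2)] d] by (simp_all add: xj_def[abs_def])
  have "smooth_on S (M.bracket (xj j) M.xi1)"
    using represents_lie[OF represents_fj[OF assms(1)] represents_f1] unfolding Q.represents_def by blast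
  then show "M.py (M.bracket M.xi1 (M.bracket (xj j) M.xi1) z) = - b j (pt z) c"
    using M.bracket_xi1_bracket_vertical[OF S(1) assms(2) SU bsmooth[OF assms(1)]] by (simp add: xj_def[abs_def])
qed

lemma frame_comb_py:
  assumes q: "q \<in> P" "\<kappa> q \<in> S"
  defines "n \<equiv> DIM('e)"
  shows "M.py (frame_comb k (\<kappa> q)) = k 1 *\<^sub>R M.pv (\<kappa> q) - k (n + 1) *\<^sub>R M.pv (\<kappa> q) + k (2 * n) *\<^sub>R M.pr (\<kappa> q)
     - (\<Sum>j=3..n. k (2 * n + j - 2) *\<^sub>R b j q c)"
proof -
  have 1: "(\<Sum>j=3..n. k (n + j - 1) *\<^sub>R M.py (M.bracket M.xi1 (xj j) (\<kappa> q))) = 0"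
    by (intro sum.neutral ballI) (simp add: xj_bracket q n_def)
  have 2: "(\<Sum>j=3..n. k (2 * n + j - 2) *\<^sub>R M.py (M.bracket M.xi1 (M.bracket (xj j) M.xi1) (\<kappa> q)))
    = - (\<Sum>j=3..n. k (2 * n + j - 2) *\<^sub>R b j q c)"
    unfolding sum_negf[symmetric] by (rule sum.cong[OF refl]) (simp add: xj_bracket q n_def pt_kappa)
  show ?thesis
    unfolding frame_comb_def Let_def n_def[symmetric] using 1 2
    by (simp add: fst_sum M.xi1_def M.xi2_def M.horiz_v_def M.horiz_r_def xj_def)
qed

lemma frame_comb_pv:
  assumes q: "q \<in> P" "\<kappa> q \<in> S"
  defines "n \<equiv> DIM('e)"
  assumes zero: "k (2 * n) = 0" "\<And>j. j \<in> {3..n} \<Longrightarrow> k (2 * n + j - 2) = 0"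
  shows "M.pv (frame_comb k (\<kappa> q)) = k 1 *\<^sub>R (M.pr (\<kappa> q) - chr GG (M.py (\<kappa> q)) (M.pv (\<kappa> q)) (M.pv (\<kappa> q))) + k 2 *\<^sub>R M.pv (\<kappa> q)
     + k (n + 1) *\<^sub>R chr GG (M.py (\<kappa> q)) (M.pv (\<kappa> q)) (M.pv (\<kappa> q)) - (\<Sum>j=3..n. k (n + j - 1) *\<^sub>R b j q c)"
proof -
  have 1: "(\<Sum>j=3..n. k (n + j - 1) *\<^sub>R M.pv (M.bracket M.xi1 (xj j) (\<kappa> q))) = - (\<Sum>j=3..n. k (n + j - 1) *\<^sub>R b j q c)"
    unfolding sum_negf[symmetric] by (rule sum.cong[OF refl]) (simp add: xj_bracket q n_def pt_kappa)
  have 2: "(\<Sum>j=3..n. k (2 * n + j - 2) *\<^sub>R M.bracket M.xi1 (M.bracket (xj j) M.xi1) (\<kappa> q)) = 0"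
    by (intro sum.neutral ballI) (simp only: zero(2) scaleR_zero_left)
  show ?thesis
    unfolding frame_comb_def Let_def n_def[symmetric] 2 zero(1) using 1
    by (simp add: fst_sum snd_sum M.xi1_def M.xi2_def M.horiz_v_def M.horiz_r_def xj_def)
qed

lemma frame_coords:
  assumes q: "q \<in> P" "\<kappa> q \<in> S"
  defines "y \<equiv> M.py (\<kappa> q)" and "v \<equiv> M.pv (\<kappa> q)" and "r \<equiv> M.pr (\<kappa> q)" and "n \<equiv> DIM('e)"
  shows "j \<in> {3..n} \<Longrightarrow> GG y (b j q c) r = 0" "j \<in> {3..n} \<Longrightarrow> GG y (b j q c) v = 0"
    "j \<in> {3..n} \<Longrightarrow> GG y (b j q c) (b j q c) = GG y r r"
    "i \<in> {3..n} \<Longrightarrow> j \<in> {3..n} \<Longrightarrow> i \<noteq> j \<Longrightarrow> GG y (b i q c) (b j q c) = 0"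
    "GG y u r = 0 \<Longrightarrow> GG y u v = 0 \<Longrightarrow> \<exists>a. u = (\<Sum>j=3..n. a j *\<^sub>R b j q c)"
proof -
  obtain x V R where e: "q = (x, V, R)" by (cases q)
  have qZ: "(x, V, R) \<in> Z" using SZ[OF q] e by simp
  have h: "c \<in> charts_at A x" "V \<in> tangent_space A x" "R \<in> tangent_space A x" using q P_iff e by auto
  note fr = frameD[OF qZ]
  have yx: "y = snd c x" "v = V c" "r = R c" by (simp_all add: y_def v_def r_def e bundle_chart_def)
  note gc = g_coords[OF h(1)]
  show "GG y (b j q c) r = 0" "GG y (b j q c) v = 0" "GG y (b j q c) (b j q c) = GG y r r" if "j \<in> {3..n}"
    using fr(1-4)[of j] that gc[OF fr(1)[of j] h(3)] gc[OF fr(1)[of j] h(2)] gc[OF fr(1)[of j] fr(1)[of j]] gc[OF h(3,3)]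
    by (simp_all add: yx e n_def gnorm_def)
  show "GG y (b i q c) (b j q c) = 0" if "i \<in> {3..n}" "j \<in> {3..n}" "i \<noteq> j"
    using fr(5)[of i j] that gc[OF fr(1)[of i] fr(1)[of j]] by (simp add: yx e n_def)
  show "\<exists>a. u = (\<Sum>j=3..n. a j *\<^sub>R b j q c)" if u0: "GG y u r = 0" "GG y u v = 0"
  proof -
    let ?u = "tvec_of_coords A c x u"
    have u: "?u \<in> tangent_space A x" "?u c = u" using tvec_in[OF h(1)] tvec_coord[OF h(1)] by auto
    obtain a where "?u = (\<lambda>c. \<Sum>j=3..n. a j *\<^sub>R b j (x, V, R) c)"
      using fr(6)[OF u(1)] u0 gc[OF u(1) h(3)] gc[OF u(1) h(2)] u(2) by (auto simp: yx n_def)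
    then have "?u c = (\<Sum>j=3..n. a j *\<^sub>R b j (x, V, R) c)" by (rule fun_cong)
    then show ?thesis using u(2) e by auto
  qed
qed

text \<open>The base part, paired with \<open>v\<close>, \<open>r\<close> and the \<open>b\<^sub>i\<close>, gives \<open>k (n + 1) = k 1 + 1\<close> and the vanishing of the
coefficients of all \<open>f\<^sub>1\<^sub>i\<^sub>1\<close>.  In the \<open>v\<close>-part, paired with \<open>r\<close>, the Christoffel terms then cancel.\<close>

lemma expansion_coefficient:
  assumes q: "q \<in> P" "\<kappa> q \<in> S" and e: "M.bracket M.xi1 M.horiz_r (\<kappa> q) = frame_comb k (\<kappa> q)"
  defines "y \<equiv> M.py (\<kappa> q)" and "v \<equiv> M.pv (\<kappa> q)" and "r \<equiv> M.pr (\<kappa> q)"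
  shows "k 1 * GG y r r = - GG y (curv GG y v r v) r"
proof -
  define n where "n = DIM('e)"
  have y: "y \<in> snd c ` fst c" using SU[OF q(2)] by (simp add: y_def)
  have rad: "GG y r v = 0" "GG y v r = 0" "GG y r r = GG y v v" "GG y v v > 0"
    using kappa_radii[OF q(1)] M.G_sym[OF y] M.G_pos[OF y] by (simp_all add: M.radii_def y_def v_def r_def)
  note fc = frame_coords[OF q, folded y_def v_def r_def n_def]
  have e1: "- v = k 1 *\<^sub>R v - k (n + 1) *\<^sub>R v + k (2 * n) *\<^sub>R r - (\<Sum>j=3..n. k (2 * n + j - 2) *\<^sub>R b j q c)"
    using arg_cong[OF e, of M.py] unfolding frame_comb_py[OF q] M.bracket_xi1_horiz_r(1)[OF SU[OF q(2)]] v_def r_def n_def .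
  have G1: "- GG y v w = k 1 * GG y v w - k (n + 1) * GG y v w + k (2 * n) * GG y r w - (\<Sum>j=3..n. k (2 * n + j - 2) * GG y (b j q c) w)" for w
    using arg_cong[OF e1, of "\<lambda>x. GG y x w"] by (simp add: M.G_simps M.G_sum y)
  have "(\<Sum>j=3..n. k (2 * n + j - 2) * GG y (b j q c) v) = 0" "(\<Sum>j=3..n. k (2 * n + j - 2) * GG y (b j q c) r) = 0"
    by (intro sum.neutral ballI; simp add: fc)+
  with G1[of v] G1[of r] have "(k 1 + 1 - k (n + 1)) * GG y v v = 0" "k (2 * n) * GG y r r = 0"
    using rad by (simp_all add: algebra_simps)
  then have k1: "k (n + 1) = k 1 + 1" "k (2 * n) = 0" using rad by auto
  have k2: "k (2 * n + i - 2) = 0" if i: "i \<in> {3..n}" for i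
  proof -
    have "(\<Sum>j=3..n. k (2 * n + j - 2) * GG y (b j q c) (b i q c)) = (\<Sum>j=3..n. if j = i then k (2 * n + j - 2) * GG y r r else 0)"
      by (rule sum.cong) (use fc(3,4) i in auto)
    also have "\<dots> = k (2 * n + i - 2) * GG y r r" using i by simp
    finally have "k (2 * n + i - 2) * GG y r r = 0"
      using G1[of "b i q c"] fc(1,2)[OF i] M.G_sym[OF y, of _ "b i q c"] by simp
    then show ?thesis using rad by simp
  qed
  have e2: "chr GG y v v - curv GG y v r v = k 1 *\<^sub>R (r - chr GG y v v) + k 2 *\<^sub>R v
     + k (n + 1) *\<^sub>R chr GG y v v - (\<Sum>j=3..n. k (n + j - 1) *\<^sub>R b j q c)"
    using arg_cong[OF e, of M.pv] frame_comb_pv[OF q, of k] k1(2) k2 M.bracket_xi1_horiz_r(2)[OF SU[OF q(2)]]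
    unfolding v_def r_def n_def y_def by simp
  have "(\<Sum>j=3..n. k (n + j - 1) * GG y (b j q c) r) = 0"
    by (intro sum.neutral ballI) (simp add: fc)
  then have "GG y (chr GG y v v) r - GG y (curv GG y v r v) r = k 1 * (GG y r r - GG y (chr GG y v v) r) + (k 1 + 1) * GG y (chr GG y v v) r"
    using arg_cong[OF e2, of "\<lambda>x. GG y x r"] rad k1 by (simp add: M.G_simps M.G_sum y)
  then show ?thesis by (simp add: algebra_simps)
qed

text \<open>The coefficient \<open>K\<close> makes \<open>Rm(V,R)V + K R\<close> orthogonal to \<open>R\<close>, and it is orthogonal to \<open>V\<close> by skew symmetry of
the curvature, so it is a combination of the \<open>b\<^sub>j\<close>.  This matches the base and the \<open>v\<close>-parts.  The
difference that remains is tangent with \<open>r\<close>-part only, and \<open>to_radii_vertical\<close> applies.\<close>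

lemma expansion_exists:
  assumes q: "q \<in> P" "\<kappa> q \<in> S"
  shows "\<exists>k. M.bracket M.xi1 M.horiz_r (\<kappa> q) = frame_comb k (\<kappa> q)"
proof -
  define y v r n where "y = M.py (\<kappa> q)" and "v = M.pv (\<kappa> q)" and "r = M.pr (\<kappa> q)" and "n = DIM('e)"
  have n2: "n \<ge> 2" using dim by (simp add: n_def)
  have y: "y \<in> snd c ` fst c" using SU[OF q(2)] by (simp add: y_def)
  have rad: "GG y r v = 0" "GG y v r = 0" "GG y r r = GG y v v" "GG y v v > 0"
    using kappa_radii[OF q(1)] M.G_sym[OF y] M.G_pos[OF y] by (simp_all add: M.radii_def y_def v_def r_def)
  note fc = frame_coords[OF q, folded y_def v_def r_def n_def]
  define K where "K = - GG y (curv GG y v r v) r / GG y r r"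
  obtain a where a: "curv GG y v r v + K *\<^sub>R r = (\<Sum>j=3..n. a j *\<^sub>R b j q c)"
    using fc(5)[of "curv GG y v r v + K *\<^sub>R r"] rad M.curv_skew_diag[OF y, of v r v]
    by (auto simp: M.G_simps y K_def)
  \<comment> \<open>The \<open>d j\<close>, the coefficients of the \<open>f\<^sub>j\<close>, are chosen last; the index \<open>m = n + j - 1\<close> of \<open>f\<^sub>1\<^sub>j\<close>
    corresponds to \<open>j = m - n + 1\<close>.\<close>
  define k where "k d m = (if m = 1 then K else if m = 2 then 0 else if m \<le> n then d m
     else if m = n + 1 then K + 1 else if m < 2 * n then a (m - n + 1) else 0)" for d :: "nat \<Rightarrow> real" and m
  have kk: "k d 1 = K" "k d 2 = 0" "k d (n + 1) = K + 1" "k d (2 * n) = 0" for d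
    using n2 by (auto simp: k_def)
  have kj: "k d j = d j" "k d (n + j - 1) = a j" "k d (2 * n + j - 2) = 0" if "j \<in> {3..n}" for d j
    using that by (auto simp: k_def)
  have py: "M.py (frame_comb (k d) (\<kappa> q)) = - v" for d
    unfolding frame_comb_py[OF q] n_def[symmetric] kk using kj(3)
    by (simp add: v_def[symmetric] scaleR_add_left kj(3))
  have "M.pv (frame_comb (k d) (\<kappa> q)) = K *\<^sub>R (r - chr GG y v v) + (K + 1) *\<^sub>R chr GG y v v - (\<Sum>j=3..n. a j *\<^sub>R b j q c)" for d
    using frame_comb_pv[OF q, of "k d"] kk[of d] kj(3)[of _ d] kj(2)[of _ d]
    by (simp add: y_def v_def r_def n_def)
  then have pv: "M.pv (frame_comb (k d) (\<kappa> q)) = chr GG y v v - curv GG y v r v" for d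
    using a[symmetric] by (simp add: algebra_simps)
  define w where "w = M.bracket M.xi1 M.horiz_r (\<kappa> q) - frame_comb (k (\<lambda>_. 0)) (\<kappa> q)"
  have w0: "M.py w = 0" "M.pv w = 0"
    using py[of "\<lambda>_. 0"] pv[of "\<lambda>_. 0"] M.bracket_xi1_horiz_r[OF SU[OF q(2)]] by (simp_all add: w_def y_def v_def r_def)
  have z: "\<kappa> q \<in> M.radii_nbhd" using Q.kappa_in[OF q(1)] .
  have "dd Q.\<rho> (\<kappa> q) w = w"
    unfolding w_def linear_diff[OF smooth_on_linear_dd[OF Q.smooth_rho z]] frame_comb_tangent[OF q] Q.represents_tangent[OF represents_f1121 q] ..
  then have "dd M.to_radii (\<kappa> q) (0, 0, M.pr w) = (0, 0, M.pr w)"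
    unfolding dd_rho[OF z] using w0 by (metis prod.collapse)
  from M.to_radii_vertical[OF kappa_radii[OF q(1)] this]
  obtain d where d: "M.pr w = (\<Sum>j=3..n. d j *\<^sub>R b j q c)"
    using fc(5)[of "M.pr w"] by (auto simp: y_def v_def r_def)
  have s0: "(\<Sum>j=3..n. k d j *\<^sub>R xj j (\<kappa> q)) = (\<Sum>j=3..n. d j *\<^sub>R xj j (\<kappa> q))" for d
    by (rule sum.cong) (simp_all add: kj)
  have s1: "(\<Sum>j=3..n. k d (n + j - 1) *\<^sub>R M.bracket M.xi1 (xj j) (\<kappa> q)) = (\<Sum>j=3..n. a j *\<^sub>R M.bracket M.xi1 (xj j) (\<kappa> q))" for d
    by (rule sum.cong) (simp_all only: kj)
  have s2: "(\<Sum>j=3..n. k d (2 * n + j - 2) *\<^sub>R M.bracket M.xi1 (M.bracket (xj j) M.xi1) (\<kappa> q)) = 0" for d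
    by (intro sum.neutral ballI) (simp only: kj scaleR_zero_left)
  have "frame_comb (k d) (\<kappa> q) = frame_comb (k (\<lambda>_. 0)) (\<kappa> q) + (\<Sum>j=3..n. d j *\<^sub>R xj j (\<kappa> q))"
    unfolding frame_comb_def Let_def n_def[symmetric] kk s0 s1 s2 by (simp add: algebra_simps)
  also have "(\<Sum>j=3..n. d j *\<^sub>R xj j (\<kappa> q)) = (0, 0, M.pr w)"
    unfolding d by (simp add: prod_eq_iff fst_sum snd_sum xj_def pt_kappa[OF q(1)])
  also have "(0, 0, M.pr w) = w" using w0 by (simp add: prod_eq_iff)
  finally show ?thesis by (intro exI[of _ "k d"]) (simp add: w_def)
qed

end

section \<open>The coefficient of the first field\<close>

context radii_chart
begin

text \<open>Gram-Schmidt starts with \<open>v\<close> and the part of \<open>r\<close> orthogonal to \<open>v\<close>, both normalised: these are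
orthonormal on a whole neighbourhood of the curvature radii, where \<open>v\<close> and \<open>r\<close> themselves need not be
orthogonal.  The remaining vectors are rescaled to the length of \<open>v\<close>.\<close>

lemma frame_exists:
  assumes p: "p \<in> P" and dim: "DIM('e) \<ge> 2"
  shows "\<exists>S b. open S \<and> S \<subseteq> M.radii_nbhd \<and> \<kappa> p \<in> S \<and> orthogonal_frame A g {q \<in> P. \<kappa> q \<in> S} b \<and>
     (\<forall>j\<in>{3..DIM('e)}. smooth_on S (\<lambda>z. b j (pt z) c))"
proof -
  define e where "e i z = (if i = (1::nat) then GG (M.py z) (M.pv z) (M.pv z) powr (-1/2) *\<^sub>R M.pv z
     else GG (M.py z) (M.orth_part z) (M.orth_part z) powr (-1/2) *\<^sub>R M.orth_part z)" for i z
  have U: "M.py z \<in> snd c ` fst c" "GG (M.py z) (M.pv z) (M.pv z) > 0" "GG (M.py z) (M.orth_part z) (M.orth_part z) > 0" if "z \<in> M.radii_nbhd" for z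
    using that M.G_pos by (auto simp: M.radii_nbhd_def)
  have rjs: "smooth_on M.radii_nbhd M.orth_part" by (rule M.orth_part_smooth[OF M.open_radii_nbhd]) (auto simp: M.radii_nbhd_def)
  have es: "smooth_on M.radii_nbhd (e i)" for i
    unfolding e_def[abs_def]
    by (cases "i = 1"; simp only: if_True if_False simp_thms; intro smooth_on_scaleR smooth_on_powr M.smooth_G_comp M.smooth_proj rjs M.open_radii_nbhd U)
  have unit: "(a powr (-1/2) * (a powr (-1/2) * a)) = 1" if "a > 0" for a :: real
  proof -
    have "a powr (-1/2) * a powr (-1/2) = a powr (-1)" by (simp flip: powr_add)
    then show ?thesis using that by (simp add: powr_minus flip: mult.assoc)
  qed
  have on2: "orthonormal_upto 2 (GG (M.py z)) (\<lambda>i. e i z)" if z: "z \<in> M.radii_nbhd" for z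
  proof -
    note y = U(1)[OF z]
    have o: "GG (M.py z) (M.orth_part z) (M.pv z) = 0" "GG (M.py z) (M.pv z) (M.orth_part z) = 0"
      using M.orth_part_orth[OF z] M.G_sym[OF y] by auto
    have "{1..2::nat} = {1, 2}" by auto
    then show ?thesis
      using unit[OF U(2)[OF z]] unit[OF U(3)[OF z]]
      by (simp add: orthonormal_upto_def e_def M.G_scale[OF y] o)
  qed
  have inn: "inner_form (GG (M.py z))" if "z \<in> M.radii_nbhd" for z using M.innerG U(1) that by blast
  have smG: "smooth_on M.radii_nbhd (\<lambda>z. GG (M.py z) u v)" for u v
    by (intro M.smooth_G_comp M.open_radii_nbhd U smooth_on_const)
  obtain S1 fr where S1: "open S1" "\<kappa> p \<in> S1" "S1 \<subseteq> M.radii_nbhd" and fr: "\<forall>i\<in>{1..2}. fr i = e i"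
     "\<forall>i\<in>{1..DIM('e)}. smooth_on S1 (fr i)" "\<forall>z\<in>S1. orthonormal_upto DIM('e) (GG (M.py z)) (\<lambda>i. fr i z)"
    using smooth_orthonormal_extend[OF M.open_radii_nbhd Q.kappa_in[OF p], of "\<lambda>z. GG (M.py z)", OF inn smG dim es on2] by blast
  define B where "B j z = GG (M.py z) (M.pv z) (M.pv z) powr (1/2) *\<^sub>R fr j z" for j z
  have Bs: "smooth_on S1 (B j)" if "j \<in> {1..DIM('e)}" for j
    unfolding B_def[abs_def]
    using fr(2) that S1(3) by (intro smooth_on_scaleR smooth_on_powr M.smooth_G_comp M.smooth_proj S1(1) U) auto
  define S where "S = {w \<in> S1. \<kappa> (pt w) \<in> S1}"
  have S: "open S" "S \<subseteq> S1" "\<kappa> p \<in> S"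
    using Q.open_rho_vimage[OF S1(1,3)] S1(2) Q.rho_fix[OF p] by (auto simp: S_def)
  have Srd: "S \<subseteq> M.radii_nbhd" using S(2) S1(3) by blast
  have Brho: "smooth_on S (\<lambda>w. B j (\<kappa> (pt w)))" if "j \<in> {1..DIM('e)}" for j
    by (rule smooth_on_compose[OF Bs[OF that] smooth_on_subset[OF Q.smooth_rho Srd] S(1) S1(1)]) (simp add: S_def)
  define b where "b j q = tvec_of_coords A c (fst q) (B j (\<kappa> q))" for j and q :: "('m, 'e) radius"
  have bc: "b j (pt z) c = B j (\<kappa> (pt z))" if "z \<in> S" for j z
    unfolding b_def by (rule tvec_coord[OF P_charts[OF pt_in]]) (use that Srd in blast)
  have bsm: "smooth_on S (\<lambda>z. b j (pt z) c)" if "j \<in> {3..DIM('e)}" for j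
    using smooth_on_cong[OF S(1) bc, of "\<lambda>z. z" "\<lambda>_. j"] Brho[of j] that by auto
  have "orthogonal_frame A g {q \<in> P. \<kappa> q \<in> S} b"
    unfolding orthogonal_frame_def
  proof (safe)
    fix x V R assume q: "(x, V, R) \<in> P" and kS: "\<kappa> (x, V, R) \<in> S"
    let ?q = "(x, V, R)" let ?z = "\<kappa> ?q"
    have h: "c \<in> charts_at A x" "V \<in> tangent_space A x" "R \<in> tangent_space A x" and rad: "?z \<in> M.radii" using q P_iff by auto
    have z: "?z \<in> M.radii_nbhd" and zS1: "?z \<in> S1" using kS Srd S by auto
    have yx: "M.py ?z = snd c x" "M.pv ?z = V c" "M.pr ?z = R c" by (simp_all add: bundle_chart_def)
    let ?y = "snd c x" and ?v = "V c" and ?r = "R c"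
    have y: "?y \<in> snd c ` fst c" using U(1)[OF z] yx by simp
    have gv: "GG ?y ?v ?v > 0" "GG ?y ?r ?r = GG ?y ?v ?v"
      using U(2)[OF z] rad by (auto simp: yx M.radii_def)
    have on: "GG ?y (fr i ?z) (fr j ?z) = (if i = j then 1 else 0)" if "i \<in> {1..DIM('e)}" "j \<in> {1..DIM('e)}" for i j
      using fr(3) zS1 that unfolding orthonormal_upto_def yx(1)[symmetric] by blast
    have f12: "fr 1 ?z = GG ?y ?v ?v powr (-1/2) *\<^sub>R ?v" "fr 2 ?z = GG ?y ?v ?v powr (-1/2) *\<^sub>R ?r"
      using fr(1) gv(2) M.orth_part_radii[OF rad] by (simp_all add: e_def yx)
    have orth: "GG ?y u ?v = 0 \<longleftrightarrow> GG ?y u (fr 1 ?z) = 0" "GG ?y u ?r = 0 \<longleftrightarrow> GG ?y u (fr 2 ?z) = 0" for u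
      unfolding f12 M.G_scale[OF y] using gv by simp_all
    have bt: "b j ?q \<in> tangent_space A x" "b j ?q c = GG ?y ?v ?v powr (1/2) *\<^sub>R fr j ?z" for j
      using tvec_in[OF h(1)] tvec_coord[OF h(1)] by (auto simp: b_def B_def yx)
    have sq: "GG ?y ?v ?v powr (1/2) * GG ?y ?v ?v powr (1/2) = GG ?y ?v ?v"
      using gv by (simp flip: powr_add)
    note gc = g_coords[OF h(1)]
    {
      fix j assume j: "j \<in> {3..DIM('e)}"
      show "b j ?q \<in> tangent_space A x" by (rule bt(1))
      show "g x (b j ?q) R = 0" "g x (b j ?q) V = 0"
        unfolding gc[OF bt(1) h(2)] gc[OF bt(1) h(3)] bt(2) using on[of j 1] on[of j 2] orth[of "fr j ?z"] j dim
        by (simp_all add: M.G_scale[OF y])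
      show "gnorm g x (b j ?q) = gnorm g x R"
        unfolding gnorm_def gc[OF bt(1) bt(1)] gc[OF h(3,3)] bt(2) using on[of j j] j gv sq by (simp add: M.G_scale[OF y])
      fix d assume d: "d \<in> charts_at A x"
      then have dA: "d \<in> A" "x \<in> fst d" by (auto simp: charts_at_iff)
      let ?T = "S \<inter> bundle_overlap c d"
      have T: "open ?T" using S(1) open_bundle_overlap[OF c_in dA(1)] by blast
      have zT: "?z \<in> ?T" using kS bundle_in_bundle_overlap_iff[OF c_in, of x V R d] h(1) dA by (simp add: charts_at_iff)
      have sd: "smooth_on ?T (\<lambda>w. dd (transition c d) (M.py w) (B j (\<kappa> (pt w))))"
        by (rule smooth_on_dd_apply[OF T open_overlap[OF c_in dA(1)] smooth_transition[OF c_in dA(1)] M.smooth_proj(1)[OF T] _ smooth_on_subset[OF Brho]])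
          (use j in auto)
      have beq: "b j (pt w) d = dd (transition c d) (M.py w) (B j (\<kappa> (pt w)))" if w: "w \<in> ?T" for w
      proof -
        have "M.py w \<in> snd c ` (fst c \<inter> fst d)" using w by auto
        then obtain x' where x': "x' \<in> fst c" "x' \<in> fst d" "M.py w = snd c x'" by blast
        have "fst (pt w) = x'" using x' chart_inv_left[OF c_in] by (simp add: pt_def)
        then show ?thesis using x' dA by (simp add: b_def tvec_of_coords_def charts_at_iff)
      qed
      have "smooth_on ?T (\<lambda>w. b j (pt w) d)" by (rule iffD2[OF smooth_on_cong[OF T beq] sd])
      then show "radii_smooth_at A g ?q (\<lambda>q. b j q d)"
        unfolding radii_smooth_at_iff[OF q] Q.smooth_at_def using T zT Srd by (intro exI[of _ ?T] conjI) auto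
    }
    show "g x (b i ?q) (b j ?q) = 0" if "i \<in> {3..DIM('e)}" "j \<in> {3..DIM('e)}" "i \<noteq> j" for i j
      unfolding gc[OF bt(1) bt(1)] bt(2) using on[of i j] that by (simp add: M.G_scale[OF y])
    fix u assume u: "u \<in> tangent_space A x" "g x u R = 0" "g x u V = 0"
    have "orthonormal_upto DIM('e) (GG ?y) (\<lambda>i. fr i ?z)" using fr(3) zS1 yx(1) by metis
    from orthonormal_expand[OF M.innerG[OF y] this, of "u c"]
    have uc: "u c = (\<Sum>i=1..DIM('e). GG ?y (fr i ?z) (u c) *\<^sub>R fr i ?z)" .
    have "GG ?y (fr 1 ?z) (u c) = 0" "GG ?y (fr 2 ?z) (u c) = 0"
      using u orth[of "u c"] gc[OF u(1) h(2)] gc[OF u(1) h(3)] M.G_sym[OF y, of _ "u c"] by auto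
    then have uc: "u c = (\<Sum>i=3..DIM('e). GG ?y (fr i ?z) (u c) *\<^sub>R fr i ?z)"
      using uc sum_split_12(1)[OF dim, of "\<lambda>i. GG ?y (fr i ?z) (u c) *\<^sub>R fr i ?z"] by simp
    define a where "a j = GG ?y (fr j ?z) (u c) * GG ?y ?v ?v powr (-1/2)" for j
    have inv: "GG ?y ?v ?v powr (-1/2) * GG ?y ?v ?v powr (1/2) = 1" using gv by (simp flip: powr_add)
    have "u c = (\<Sum>j=3..DIM('e). a j *\<^sub>R b j ?q c)"
      by (subst uc) (intro sum.cong refl, simp only: bt(2) a_def scaleR_scaleR mult.assoc inv mult_1_right)
    then have "u = (\<lambda>c. \<Sum>j=3..DIM('e). a j *\<^sub>R b j ?q c)"
      using tangent_eqI[OF u(1) tangent_sum[of "{3..DIM('e)}" "\<lambda>j. b j ?q"] h(1)] bt(1) by blast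
    then show "\<exists>a. u = (\<lambda>c. \<Sum>j=3..DIM('e). a j *\<^sub>R b j ?q c)" by blast
  qed
  then show ?thesis using S(1,3) Srd bsm by blast
qed

lemma fields_exist:
  assumes S: "open S" "S \<subseteq> M.radii_nbhd" and Z: "Z = {q \<in> P. \<kappa> q \<in> S}"
    and frame: "orthogonal_frame A g Z b" and bsm: "\<And>j. j \<in> {3..DIM('e)} \<Longrightarrow> smooth_on S (\<lambda>z. b j (pt z) c)"
  shows "\<exists>f. adapted_fields A g Z b f"
proof -
  obtain X1 where X1: "generated_by A g Z (f1_system A g) X1"
    using generated_exists[OF S Z f1_field[OF S]] unfolding f1_lift by blast
  obtain X2 where X2: "generated_by A g Z (f2_system A) X2"
    using generated_exists[OF S Z f2_field[OF S]] unfolding f2_lift by blast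
  have "\<exists>X. generated_by A g Z (fj_system A (b j)) X" if j: "j \<in> {3..DIM('e)}" for j
    unfolding fj_lift by (rule generated_exists[OF S Z fj_field[OF S(1) bsm[OF j] _ frame j]]) (simp add: Z)
  then obtain Y where Y: "\<And>j. j \<in> {3..DIM('e)} \<Longrightarrow> generated_by A g Z (fj_system A (b j)) (Y j)" by metis
  have "adapted_fields A g Z b (\<lambda>i. if i = 1 then X1 else if i = 2 then X2 else Y i)"
    unfolding adapted_fields_def using X1 X2 Y by simp
  then show ?thesis by blast
qed

text \<open>Every admissible choice of \<open>W\<close>, frame, fields and coefficients can be analysed in the given chart \<open>c\<close>
after shrinking to a neighbourhood \<open>S\<close> of \<open>\<kappa> p\<close> on which all \<open>b j\<close> are smooth in coordinates.\<close>

lemma c1_coords: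
  assumes p: "p \<in> P" and dim: "DIM('e) \<ge> 2"
  defines "y \<equiv> M.py (\<kappa> p)" and "v \<equiv> M.pv (\<kappa> p)" and "r \<equiv> M.pr (\<kappa> p)"
  shows "c1 A g p = - GG y (curv GG y v r v) r / GG y r r"
  unfolding c1_def
proof (rule the_equality)
  have pos: "GG y r r > 0"
    using kappa_radii[OF p] M.G_pos by (auto simp: M.radii_def y_def v_def r_def)
  obtain S b where SS: "open S" "S \<subseteq> M.radii_nbhd" "\<kappa> p \<in> S" and frame: "orthogonal_frame A g {q \<in> P. \<kappa> q \<in> S} b"
    and bsm: "\<forall>j\<in>{3..DIM('e)}. smooth_on S (\<lambda>z. b j (pt z) c)"
    using frame_exists[OF p dim] by blast
  define Z where "Z = {q \<in> P. \<kappa> q \<in> S}"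
  have Zo: "radii_open A g Z" unfolding Z_def by (rule radii_openI[OF SS(1)])
  obtain f where f: "adapted_fields A g Z b f"
    using fields_exist[OF SS(1,2) Z_def] frame bsm unfolding Z_def by blast
  interpret adapted_chart A g c S Z b f
    by unfold_locales (use dim SS Zo frame bsm f in \<open>auto simp: Z_def\<close>)
  have "\<exists>k. \<forall>q\<in>Z. M.bracket M.xi1 M.horiz_r (\<kappa> q) = frame_comb (k q) (\<kappa> q)"
    by (rule bchoice) (use expansion_exists in \<open>auto simp: Z_def\<close>)
  then obtain k where k: "\<forall>q\<in>Z. M.bracket M.xi1 M.horiz_r (\<kappa> q) = frame_comb (k q) (\<kappa> q)" ..
  have "f1121_expansion A g Z f (\<lambda>i q. k q i)"
    unfolding f1121_expansion_def Let_def
  proof (intro ballI)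
    fix q assume "q \<in> Z"
    then have q: "q \<in> P" "\<kappa> q \<in> S" "M.bracket M.xi1 M.horiz_r (\<kappa> q) = frame_comb (k q) (\<kappa> q)"
      using bspec[OF k] unfolding Z_def by blast+
    from expansion_iff[OF q(1,2), of "k q"] q(3)
    show "\<forall>F. radii_smooth_at A g q F \<longrightarrow>
        lie_bracket (f 1) (lie_bracket (f 1) (lie_bracket (f 2) (f 1))) F q =
            (\<Sum>i=1..DIM('e). k q i * f i F q) + (\<Sum>i=2..DIM('e). k q (DIM('e) + i - 1) * lie_bracket (f 1) (f i) F q)
          + (\<Sum>i=2..DIM('e). k q (2 * DIM('e) + i - 2) * lie_bracket (f 1) (lie_bracket (f i) (f 1)) F q)"
      by blast
  qed
  moreover have pZ: "p \<in> Z" using p SS by (simp add: Z_def)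
  moreover have "- GG y (curv GG y v r v) r / GG y r r = k p 1"
    using expansion_coefficient[OF p SS(3), of "k p"] k pZ pos unfolding y_def v_def r_def by (simp add: field_simps)
  ultimately show "\<exists>W b f k. radii_open A g W \<and> p \<in> W \<and> orthogonal_frame A g W b \<and>
     adapted_fields A g W b f \<and> f1121_expansion A g W f k \<and> - GG y (curv GG y v r v) r / GG y r r = k 1 p"
    using Zo frame f unfolding Z_def[symmetric]
    by (intro exI[of _ Z] exI[of _ b] exI[of _ f] exI[of _ "\<lambda>i q. k q i"]) auto
next
  fix a assume "\<exists>W b f k. radii_open A g W \<and> p \<in> W \<and> orthogonal_frame A g W b \<and>
     adapted_fields A g W b f \<and> f1121_expansion A g W f k \<and> a = k 1 p"
  then obtain Z b f k where h: "radii_open A g Z" "p \<in> Z" "orthogonal_frame A g Z b"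
     "adapted_fields A g Z b f" "f1121_expansion A g Z f k" "a = k 1 p" by blast
  have pos: "GG y r r > 0"
    using kappa_radii[OF p] M.G_pos by (auto simp: M.radii_def y_def v_def r_def)
  obtain S0 where S0: "open S0" "S0 \<subseteq> M.radii_nbhd" "\<And>q. q \<in> P \<Longrightarrow> q \<in> Z \<longleftrightarrow> \<kappa> q \<in> S0"
    using radii_openE[OF h(1)] by blast
  have "\<exists>T. open T \<and> \<kappa> p \<in> T \<and> smooth_on T (\<lambda>z. b j (pt z) c)" if j: "j \<in> {3..DIM('e)}" for j
  proof -
    obtain x V R where e: "p = (x, V, R)" by (cases p)
    have "(x, V, R) \<in> Z" "c \<in> charts_at A x" using h(2) e P_charts[OF p] by auto
    then have "radii_smooth_at A g p (\<lambda>q. b j q c)"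
      using bspec[OF h(3)[unfolded orthogonal_frame_def], of "(x, V, R)"] j e by simp
    then show ?thesis unfolding radii_smooth_at_iff[OF p] Q.smooth_at_def by blast
  qed
  then obtain T where T: "\<And>j. j \<in> {3..DIM('e)} \<Longrightarrow> open (T j) \<and> \<kappa> p \<in> T j \<and> smooth_on (T j) (\<lambda>z. b j (pt z) c)" by metis
  define S where "S = S0 \<inter> (\<Inter>j\<in>{3..DIM('e)}. T j)"
  have "open (\<Inter>j\<in>{3..DIM('e)}. T j)" by (rule open_INT) (use T in auto)
  then have SS: "open S" "S \<subseteq> S0" "\<kappa> p \<in> S" "\<And>j. j \<in> {3..DIM('e)} \<Longrightarrow> S \<subseteq> T j"
    using S0 T h(2) p by (auto simp: S_def)
  interpret adapted_chart A g c S Z b f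
  proof unfold_locales
    show "smooth_on S (\<lambda>z. b j (pt z) c)" if "j \<in> {3..DIM('e)}" for j
      using T[OF that] smooth_on_subset SS(4)[OF that] by blast
  qed (use dim SS S0 h in auto)
  have "\<forall>F. radii_smooth_at A g p F \<longrightarrow>
        lie_bracket (f 1) (lie_bracket (f 1) (lie_bracket (f 2) (f 1))) F p =
            (\<Sum>i=1..DIM('e). k i p * f i F p) + (\<Sum>i=2..DIM('e). k (DIM('e) + i - 1) p * lie_bracket (f 1) (f i) F p)
          + (\<Sum>i=2..DIM('e). k (2 * DIM('e) + i - 2) p * lie_bracket (f 1) (lie_bracket (f i) (f 1)) F p)"
    using bspec[OF h(5)[unfolded f1121_expansion_def Let_def] h(2)] .
  then have "M.bracket M.xi1 M.horiz_r (\<kappa> p) = frame_comb (\<lambda>i. k i p) (\<kappa> p)"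
    using expansion_iff[OF p SS(3), of "\<lambda>i. k i p"] by blast
  from expansion_coefficient[OF p SS(3) this] show "a = - GG y (curv GG y v r v) r / GG y r r"
    using pos h(6) unfolding y_def v_def r_def by (simp add: field_simps)
qed

end

context riemannian_manifold
begin

lemma chart_exists: "\<exists>c. c \<in> charts_at A x"
proof -
  have "x \<in> (\<Union>c\<in>A. fst c)" unfolding atlas_covers by (rule UNIV_I)
  then show ?thesis by (auto simp: charts_at_iff)
qed

lemma sectional_coords:
  assumes c: "c \<in> charts_at A x" and X: "X \<in> tangent_space A x" and Y: "Y \<in> tangent_space A x"
  defines "G \<equiv> metric_coords A g c (snd c x)"
  shows "sectional_curvature A g x X Y =
     G (curv (metric_coords A g c) (snd c x) (X c) (Y c) (Y c)) (X c) / (G (X c) (X c) * G (Y c) (Y c) - (G (X c) (Y c))\<^sup>2)"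
  unfolding sectional_curvature_def g_coords[OF c curvature_tangent[OF X Y Y] X] g_coords[OF c X X] g_coords[OF c X Y]
    g_coords[OF c Y Y] curvature_coords[OF c] G_def ..

theorem c1_sectional:
  assumes q: "(x, V, R) \<in> curvature_radii A g" and dim: "DIM('e) \<ge> 2"
  shows "c1 A g (x, V, R) = (gnorm g x R)\<^sup>2 * sectional_curvature A g x R V"
proof -
  obtain c where c: "c \<in> charts_at A x" using chart_exists by blast
  interpret radii_chart A g c by unfold_locales (use c in \<open>simp add: charts_at_iff\<close>)
  note d = curvature_radiiD[OF q]
  have P: "(x, V, R) \<in> P" using q c by (simp add: P_def charts_at_iff)
  let ?y = "snd c x" and ?v = "V c" and ?r = "R c"
  have y: "?y \<in> snd c ` fst c" using c by (simp add: charts_at_iff)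
  have e: "GG ?y ?r ?v = 0" "GG ?y ?r ?r = GG ?y ?v ?v" "GG ?y ?v ?v > 0" "g x R R = GG ?y ?r ?r"
    using d(3,5,6) g_coords[OF c d(2,1)] g_coords[OF c d(2,2)] g_coords[OF c d(1,1)] by auto
  have "(gnorm g x R)\<^sup>2 = GG ?y ?r ?r" using e by (simp add: gnorm_def)
  moreover have "curv GG ?y ?r ?v ?v = - curv GG ?y ?v ?r ?v" by (rule M.curv_antisym)
  ultimately show ?thesis
    unfolding c1_coords[OF P dim] sectional_coords[OF c d(2,1)]
    using e by (simp add: bundle_chart_def M.G_neg[OF y] power2_eq_square)
qed

text \<open>In dimension 2, independent vectors \<open>u\<close>, \<open>w\<close> arise from \<open>R\<close>, \<open>V\<close> by an invertible linear substitution, and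
the numerator and the denominator of sectional curvature are both multiplied by the square \<open>D\<^sup>2\<close> of its determinant.\<close>

lemma gaussian_eq:
  assumes q: "(x, V, R) \<in> curvature_radii A g" and dim: "DIM('e) = 2"
  shows "gaussian_curvature A g x = sectional_curvature A g x R V"
proof -
  obtain c where c: "c \<in> charts_at A x" using chart_exists by blast
  interpret radii_chart A g c by unfold_locales (use c in \<open>simp add: charts_at_iff\<close>)
  note d = curvature_radiiD[OF q]
  let ?y = "snd c x" and ?v = "V c" and ?r = "R c"
  have y: "?y \<in> snd c ` fst c" using c by (simp add: charts_at_iff)
  define G where "G = GG ?y"
  have e: "G ?r ?v = 0" "G ?v ?r = 0" "G ?r ?r = G ?v ?v" "G ?v ?v > 0"
    using d(3-6) g_coords[OF c d(2,1)] g_coords[OF c d(1,2)] g_coords[OF c d(2,2)] g_coords[OF c d(1,1)] by (auto simp: G_def)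
  note Gs = M.G_simps[OF y, folded G_def]
  let ?curv = "curv GG ?y"
  define N where "N = G (?curv ?r ?v ?v) ?r"
  have rl: "?curv (a *\<^sub>R X + b *\<^sub>R X') Y Z = a *\<^sub>R ?curv X Y Z + b *\<^sub>R ?curv X' Y Z"
     "?curv X (a *\<^sub>R Y + b *\<^sub>R Y') Z = a *\<^sub>R ?curv X Y Z + b *\<^sub>R ?curv X Y' Z"
     "?curv X Y (a *\<^sub>R Z + b *\<^sub>R Z') = a *\<^sub>R ?curv X Y Z + b *\<^sub>R ?curv X Y Z'" for a b X X' Y Y' Z Z'
    by (simp_all only: linear_add[OF M.curv_linear(1)[OF y]] linear_scale[OF M.curv_linear(1)[OF y]]
       linear_add[OF M.curv_linear(2)[OF y]] linear_scale[OF M.curv_linear(2)[OF y]]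
       linear_add[OF M.curv_linear(3)[OF y]] linear_scale[OF M.curv_linear(3)[OF y]])
  have r0: "?curv X X Z = 0" for X Z
    unfolding curv_def by simp
  have ra: "?curv ?v ?r Z = - ?curv ?r ?v Z" for Z by (rule M.curv_antisym)
  have rs: "G (?curv ?r ?v ?r) ?v = - N" "G (?curv ?r ?v ?r) ?r = 0" "G (?curv ?r ?v ?v) ?v = 0" "G (?curv ?r ?v ?v) ?r = N"
    using M.curv_skew[OF y, of ?r ?v ?r ?v] M.curv_skew_diag[OF y, of ?r ?v] unfolding N_def G_def by auto
  have main: "sectional_curvature A g x u w = sectional_curvature A g x R V"
    if u: "u \<in> tangent_space A x" and w: "w \<in> tangent_space A x"
      and ind: "\<forall>a b. (\<lambda>c. a *\<^sub>R u c + b *\<^sub>R w c) = (\<lambda>_. 0) \<longrightarrow> a = 0 \<and> b = 0" for u w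
  proof -
    define s where "s = G ?v ?v powr (-1/2)"
    have s1: "s * (s * G ?v ?v) = 1"
    proof -
      have "s * s = G ?v ?v powr (-1)" unfolding s_def by (simp flip: powr_add)
      then show ?thesis using e(4) by (simp add: powr_minus flip: mult.assoc)
    qed
    define bs where "bs i = s *\<^sub>R (if i = (1::nat) then ?r else ?v)" for i
    have "{1..2::nat} = {1, 2}" by auto
    then have "orthonormal_upto DIM('e) G bs"
      unfolding dim orthonormal_upto_def bs_def using e s1 by (simp add: Gs)
    from orthonormal_expand[OF M.innerG[OF y, folded G_def] this]
    have ex: "\<exists>a b. z = a *\<^sub>R ?r + b *\<^sub>R ?v" for z
      unfolding dim \<open>{1..2::nat} = {1, 2}\<close> by (intro exI[of _ "G (bs 1) z * s"] exI[of _ "G (bs 2) z * s"]) (simp add: bs_def)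
    obtain a b where ab: "u c = a *\<^sub>R ?r + b *\<^sub>R ?v" using ex by blast
    obtain a' b' where ab': "w c = a' *\<^sub>R ?r + b' *\<^sub>R ?v" using ex by blast
    define D where "D = a * b' - a' * b"
    have lin: "p = 0 \<and> q = 0" if "p *\<^sub>R u c + q *\<^sub>R w c = 0" for p q
      using ind tangent_eqI[OF tangent_comb[OF u w] tangent_zero c] that by blast
    have "D \<noteq> 0"
    proof
      assume D: "D = 0"
      have "a' *\<^sub>R u c + (- a) *\<^sub>R w c = - D *\<^sub>R ?v" "b' *\<^sub>R u c + (- b) *\<^sub>R w c = D *\<^sub>R ?r"
        unfolding ab ab' D_def by (simp_all add: algebra_simps)
      with D lin[of a' "- a"] lin[of b' "- b"] have "a = 0" "b = 0" by auto
      then have "1 *\<^sub>R u c + 0 *\<^sub>R w c = 0" using ab by simp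
      from lin[OF this] show False by simp
    qed
    have num: "G (?curv (u c) (w c) (w c)) (u c) = D\<^sup>2 * N"
      unfolding ab ab' rl r0 ra by (simp add: Gs rs D_def power2_eq_square algebra_simps)
    have den: "G (u c) (u c) * G (w c) (w c) - (G (u c) (w c))\<^sup>2 = D\<^sup>2 * (G ?r ?r * G ?v ?v)"
      unfolding ab ab' by (simp add: Gs e D_def power2_eq_square algebra_simps)
    show ?thesis
      unfolding sectional_coords[OF c u w] sectional_coords[OF c d(2,1)] G_def[symmetric] num den
      using \<open>D \<noteq> 0\<close> e by (simp add: N_def)
  qed
  have indRV: "\<forall>a b. (\<lambda>c. a *\<^sub>R R c + b *\<^sub>R V c) = (\<lambda>_. 0) \<longrightarrow> a = 0 \<and> b = 0"
  proof (intro allI impI)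
    fix a b assume "(\<lambda>c. a *\<^sub>R R c + b *\<^sub>R V c) = (\<lambda>_. 0)"
    then have 0: "a *\<^sub>R ?r + b *\<^sub>R ?v = 0" by (rule fun_cong)
    have "G (a *\<^sub>R ?r + b *\<^sub>R ?v) ?r = a * G ?v ?v" "G (a *\<^sub>R ?r + b *\<^sub>R ?v) ?v = b * G ?v ?v" by (simp_all add: Gs e)
    then show "a = 0 \<and> b = 0" using e(4) Gs unfolding 0 by simp
  qed
  show ?thesis
    unfolding gaussian_curvature_def
    by (rule the_equality) (use main d(1,2) indRV in blast)+
qed

end

section \<open>Homotheties\<close>

lemma quotient_scale:
  fixes l N a b e :: real
  assumes "l > 0"
  shows "l * (l * N / (l * a * (l * b) - (l * e)\<^sup>2)) = N / (a * b - e\<^sup>2)"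
proof -
  have "l * a * (l * b) - (l * e)\<^sup>2 = l * (l * (a * b - e\<^sup>2))"
    by (simp add: power2_eq_square algebra_simps)
  then show ?thesis using assms by simp
qed

locale homothetic = D: riemannian_manifold A g + C: riemannian_manifold B h
  for A :: "('m::{t2_space, second_countable_topology}, 'e::euclidean_space) chart set" and g
  and B :: "('k::{t2_space, second_countable_topology}, 'e) chart set" and h +
  fixes \<phi> :: "'m \<Rightarrow> 'k" and l :: real
  assumes smooth_phi: "smooth_map A B \<phi>" and l: "l > 0"
    and scale: "u \<in> tangent_space A x \<Longrightarrow> v \<in> tangent_space A x \<Longrightarrow>
        h (\<phi> x) (pushforward A B \<phi> x u) (pushforward A B \<phi> x v) = l * g x u v"
begin

abbreviation loc :: "('m, 'e) chart \<Rightarrow> ('k, 'e) chart \<Rightarrow> 'e \<Rightarrow> 'e" where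
  "loc c d \<equiv> snd d \<circ> \<phi> \<circ> chart_inv c"

lemma loc_domain:
  assumes "c \<in> A" "d \<in> B"
  shows "open (snd c ` (fst c \<inter> \<phi> -` fst d))" "smooth_on (snd c ` (fst c \<inter> \<phi> -` fst d)) (loc c d)"
proof -
  have "open (\<phi> -` fst d)"
    using smooth_phi C.open_domain[OF assms(2)] unfolding smooth_map_def by (metis open_vimage)
  then show "open (snd c ` (fst c \<inter> \<phi> -` fst d))" by (rule D.open_chart_image[OF assms(1)])
  show "smooth_on (snd c ` (fst c \<inter> \<phi> -` fst d)) (loc c d)"
    using smooth_phi assms unfolding smooth_map_def by blast
qed

lemma loc_differentiable:
  assumes "c \<in> charts_at A x" "d \<in> charts_at B (\<phi> x)"
  shows "loc c d differentiable (at (snd c x))"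
  by (rule smooth_on_differentiable[OF loc_domain(2)]) (use assms in \<open>auto simp: charts_at_iff\<close>)

lemma loc_chain_domain:
  assumes "c \<in> charts_at A x" "c' \<in> charts_at A x" "d \<in> charts_at B (\<phi> x)"
  shows "dd (loc c' d) (snd c' x) (dd (transition c c') (snd c x) u) = dd (loc c d) (snd c x) u"
proof -
  have c: "c \<in> A" "x \<in> fst c" "c' \<in> A" "x \<in> fst c'" using assms by (auto simp: charts_at_iff)
  have "dd (loc c d) (snd c x) = dd (\<lambda>y. loc c' d (transition c c' y)) (snd c x)"
    by (rule dd_cong_open[OF D.open_overlap[OF c(1,3)]]) (use c D.chart_inv_left[OF c(1)] D.chart_inv_left[OF c(3)] in auto)
  also have "\<dots> = (\<lambda>v. dd (loc c' d) (transition c c' (snd c x)) (dd (transition c c') (snd c x) v))"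
    by (rule dd_compose[of "transition c c'" "snd c x" "loc c' d"])
      (simp_all only: D.transition_coord[OF c(1,2)] D.transition_differentiable[OF assms(1,2)] loc_differentiable[OF assms(2,3)])
  finally show ?thesis by (simp only: D.transition_coord[OF c(1,2)])
qed

lemma loc_chain_range:
  assumes "c \<in> charts_at A x" "d \<in> charts_at B (\<phi> x)" "d' \<in> charts_at B (\<phi> x)"
  shows "dd (transition d d') (snd d (\<phi> x)) (dd (loc c d) (snd c x) u) = dd (loc c d') (snd c x) u"
proof -
  have c: "c \<in> A" "x \<in> fst c" "d \<in> B" "\<phi> x \<in> fst d" using assms by (auto simp: charts_at_iff)
  have x: "loc c d (snd c x) = snd d (\<phi> x)" using D.chart_inv_left[OF c(1,2)] by simp
  have "dd (loc c d') (snd c x) = dd (\<lambda>y. transition d d' (loc c d y)) (snd c x)"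
    by (rule dd_cong_open[OF loc_domain(1)[OF c(1,3)]]) (use c D.chart_inv_left[OF c(1)] C.chart_inv_left[OF c(3)] in auto)
  also have "\<dots> = (\<lambda>v. dd (transition d d') (loc c d (snd c x)) (dd (loc c d) (snd c x) v))"
    by (rule dd_compose[of "loc c d" "snd c x" "transition d d'"])
      (simp_all only: x loc_differentiable[OF assms(1,2)] C.transition_differentiable[OF assms(2,3)])
  finally show ?thesis by (simp only: x)
qed

text \<open>\<open>pushforward\<close> is defined with an arbitrary chart around \<open>x\<close>; by the chain rule every chart gives the same
value.\<close>

lemma push_coord:
  assumes "c \<in> charts_at A x" "d \<in> charts_at B (\<phi> x)" "U \<in> tangent_space A x"
  shows "pushforward A B \<phi> x U d = dd (loc c d) (snd c x) (U c)"
proof -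
  define c' where "c' = (SOME c. c \<in> charts_at A x)"
  have c': "c' \<in> charts_at A x" unfolding c'_def using assms(1) by (rule someI)
  have "pushforward A B \<phi> x U d = dd (loc c' d) (snd c' x) (U c')"
    using assms(2) by (simp add: pushforward_def c'_def[symmetric] Let_def)
  also have "U c' = dd (transition c c') (snd c x) (U c)" by (rule D.tangentD[OF assms(3,1) c'])
  finally show ?thesis by (simp only: loc_chain_domain[OF assms(1) c' assms(2)])
qed

lemma push_tangent:
  assumes "U \<in> tangent_space A x"
  shows "pushforward A B \<phi> x U \<in> tangent_space B (\<phi> x)"
proof (rule C.tangentI)
  show "pushforward A B \<phi> x U d = 0" if "d \<notin> charts_at B (\<phi> x)" for d
    using that by (simp add: pushforward_def)
  obtain c where c: "c \<in> charts_at A x" using D.chart_exists by blast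
  fix d d' assume d: "d \<in> charts_at B (\<phi> x)" "d' \<in> charts_at B (\<phi> x)"
  show "pushforward A B \<phi> x U d' = dd (transition d d') (snd d (\<phi> x)) (pushforward A B \<phi> x U d)"
    by (simp only: push_coord[OF c d(1) assms] push_coord[OF c d(2) assms] loc_chain_range[OF c d])
qed

lemma push_tvec:
  assumes "c \<in> charts_at A x" "d \<in> charts_at B (\<phi> x)"
  shows "pushforward A B \<phi> x (tvec_of_coords A c x u) = tvec_of_coords B d (\<phi> x) (dd (loc c d) (snd c x) u)"
  by (rule C.tangent_eqI[OF push_tangent[OF D.tvec_in[OF assms(1)]] C.tvec_in[OF assms(2)] assms(2)])
    (simp only: push_coord[OF assms D.tvec_in[OF assms(1)]] D.tvec_coord[OF assms(1)] C.tvec_coord[OF assms(2)])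

lemma loc_homothety:
  assumes c: "c \<in> A" "d \<in> B"
  shows "scaled_pullback (snd c ` (fst c \<inter> \<phi> -` fst d)) (metric_coords A g c) (snd d ` fst d) (metric_coords B h d) (loc c d) l"
  unfolding scaled_pullback_def scaled_pullback_axioms_def
proof (intro conjI allI impI)
  show "metric_field (snd c ` (fst c \<inter> \<phi> -` fst d)) (metric_coords A g c)"
    by (rule metric_field_subset[OF D.chart_metric_field[OF c(1)] loc_domain(1)[OF c]]) auto
  show "metric_field (snd d ` fst d) (metric_coords B h d)" by (rule C.chart_metric_field[OF c(2)])
  show "smooth_on (snd c ` (fst c \<inter> \<phi> -` fst d)) (loc c d)" by (rule loc_domain(2)[OF c])
  show "l > 0" by (rule l)
  fix y assume "y \<in> snd c ` (fst c \<inter> \<phi> -` fst d)"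
  then obtain x where x: "x \<in> fst c" "\<phi> x \<in> fst d" "y = snd c x" by blast
  have ch: "c \<in> charts_at A x" "d \<in> charts_at B (\<phi> x)" using x c by (auto simp: charts_at_iff)
  have lx: "loc c d (snd c x) = snd d (\<phi> x)" using D.chart_inv_left[OF c(1) x(1)] by simp
  show "loc c d y \<in> snd d ` fst d" unfolding x(3) lx using x(2) by blast
  fix u v
  show "metric_coords B h d (loc c d y) (dd (loc c d) y u) (dd (loc c d) y v) = l * metric_coords A g c y u v"
    unfolding x(3) lx D.metric_coords_at[OF ch(1)] C.metric_coords_at[OF ch(2)] push_tvec[OF ch, symmetric]
    by (rule scale[OF D.tvec_in[OF ch(1)] D.tvec_in[OF ch(1)]])
qed

lemma push_radii:
  assumes "(x, V, R) \<in> curvature_radii A g"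
  shows "(\<phi> x, pushforward A B \<phi> x V, pushforward A B \<phi> x R) \<in> curvature_radii B h"
  using D.curvature_radiiD[OF assms] l by (simp add: curvature_radii_def push_tangent scale gnorm_def)

text \<open>Curvature is carried over unchanged by \<open>curv_transform\<close>.  One metric factor in the numerator and two
in the denominator leave the factor \<open>1 / l\<close>.\<close>

lemma push_sectional:
  assumes V: "V \<in> tangent_space A x" and R: "R \<in> tangent_space A x"
  shows "l * sectional_curvature B h (\<phi> x) (pushforward A B \<phi> x R) (pushforward A B \<phi> x V) = sectional_curvature A g x R V"
proof -
  obtain c where c: "c \<in> charts_at A x" using D.chart_exists by blast
  obtain d where d: "d \<in> charts_at B (\<phi> x)" using C.chart_exists by blast
  have cA: "c \<in> A" "x \<in> fst c" "d \<in> B" "\<phi> x \<in> fst d" using c d by (auto simp: charts_at_iff)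
  interpret T: scaled_pullback "snd c ` (fst c \<inter> \<phi> -` fst d)" "metric_coords A g c" "snd d ` fst d" "metric_coords B h d" "loc c d" l
    by (rule loc_homothety[OF cA(1,3)])
  have y: "snd c x \<in> snd c ` (fst c \<inter> \<phi> -` fst d)" using cA by blast
  have lx: "snd d (\<phi> x) = loc c d (snd c x)" using D.chart_inv_left[OF cA(1,2)] by simp
  show ?thesis
    unfolding D.sectional_coords[OF c R V] C.sectional_coords[OF d push_tangent[OF R] push_tangent[OF V]]
      push_coord[OF c d R] push_coord[OF c d V] lx T.curv_transform[OF y, symmetric] T.pull[OF y]
    by (rule quotient_scale[OF l])
qed

lemma c1_invariant:
  assumes q: "(x, V, R) \<in> curvature_radii A g" and dim: "DIM('e) \<ge> 2"
  shows "c1 B h (\<phi> x, pushforward A B \<phi> x V, pushforward A B \<phi> x R) = c1 A g (x, V, R)"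
proof -
  note d = D.curvature_radiiD[OF q]
  have "(gnorm h (\<phi> x) (pushforward A B \<phi> x R))\<^sup>2 = l * (gnorm g x R)\<^sup>2"
    using d(5,6) l by (simp add: gnorm_def scale[OF d(2,2)])
  then show ?thesis
    unfolding C.c1_sectional[OF push_radii[OF q] dim] D.c1_sectional[OF q dim] push_sectional[OF d(1,2), symmetric]
    by simp
qed

end

theorem proposition4p3:
  fixes A :: "('m::{t2_space, second_countable_topology}, 'e::euclidean_space) chart set"
    and g :: "('m, 'e) metric"
  assumes "riemannian_manifold A g"
    and "DIM('e) \<ge> 2"
  shows "(\<forall>(B :: ('k::{t2_space, second_countable_topology}, 'e) chart set)
            (h :: ('k, 'e) metric) (\<phi> :: 'm \<Rightarrow> 'k).
            riemannian_manifold B h \<and> homothety A g B h \<phi> \<longrightarrow>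
            (\<forall>(x, V, R) \<in> curvature_radii A g.
               c1 B h (\<phi> x, pushforward A B \<phi> x V, pushforward A B \<phi> x R) = c1 A g (x, V, R)))
       \<and> (\<forall>(x, V, R) \<in> curvature_radii A g.
            c1 A g (x, V, R) = (gnorm g x R)\<^sup>2 * sectional_curvature A g x R V)
       \<and> (DIM('e) = 2 \<longrightarrow>
            (\<forall>(x, V, R) \<in> curvature_radii A g.
               c1 A g (x, V, R) = (gnorm g x R)\<^sup>2 * gaussian_curvature A g x))"
proof -
  interpret riemannian_manifold A g by fact
  have inv: "c1 B h (\<phi> x, pushforward A B \<phi> x V, pushforward A B \<phi> x R) = c1 A g (x, V, R)"
    if B: "riemannian_manifold B h" and hom: "homothety A g B h \<phi>" and q: "(x, V, R) \<in> curvature_radii A g"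
    for B :: "('k, 'e) chart set" and h \<phi> x V R
  proof -
    obtain l where l: "l > 0" "\<forall>x. \<forall>u\<in>tangent_space A x. \<forall>v\<in>tangent_space A x.
        h (\<phi> x) (pushforward A B \<phi> x u) (pushforward A B \<phi> x v) = l * g x u v"
      and sm: "smooth_map A B \<phi>"
      using hom unfolding homothety_def diffeomorphism_def by blast
    interpret homothetic A g B h \<phi> l
      by (intro homothetic.intro homothetic_axioms.intro) (use B l sm assms(1) in auto)
    show ?thesis by (rule c1_invariant[OF q assms(2)])
  qed
  then show ?thesis
    using c1_sectional[OF _ assms(2)] gaussian_eq by fastforce
qed

end
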